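(* Let $R$ be a commutative Noetherian local ring and let $M$ be a finitely generated $R$-module. Suppose that $R$ and $M$ both satisfy Serre's condition $(S_2)$. If $M^*=\operatorname{Hom}_R(M,R)$ is free, then $M$ is free.
   Context: A finitely generated $R$-module $M$ satisfies Serre's condition $(S_i)$ if $\operatorname{depth}_{R_{\mathfrak p}} M_{\mathfrak p}\ge \min\{i,\operatorname{ht}\mathfrak p\}$ for every prime $\mathfrak p$ of $R$ (the zero module has depth $\infty$); $R$ satisfies $(S_i)$ if it does so as a module over itself. *)

theory Defs
  imports "HOL-Algebra.Module" "HOL-Algebra.Ring_Divisibility" "HOL-Library.Extended_Nat"
begin

section \<open>Modules\<close>

text \<open>The fields \<open>mult\<close> and \<open>one\<close> of a module record play no role in \<^locale>\<open>module\<close>; below they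
  are left \<open>undefined\<close> whenever a module is constructed.\<close>

definition self_module :: "('a, 'm) ring_scheme \<Rightarrow> ('a, 'a) module" where
  "self_module R =
     \<lparr>carrier = carrier R, monoid.mult = undefined, one = undefined,
      ring.zero = ring.zero R, ring.add = ring.add R, smult = monoid.mult R\<rparr>"

definition submodule_span ::
    "('a, 'm) ring_scheme \<Rightarrow> ('a, 'b, 'n) module_scheme \<Rightarrow> 'b set \<Rightarrow> 'b set" where
  "submodule_span R M X = \<Inter>{N. submodule N R M \<and> X \<subseteq> N}"

definition finitely_generated_module ::
    "('a, 'm) ring_scheme \<Rightarrow> ('a, 'b, 'n) module_scheme \<Rightarrow> bool" where
  "finitely_generated_module R M \<longleftrightarrow>
     (\<exists>X. finite X \<and> X \<subseteq> carrier M \<and> submodule_span R M X = carrier M)"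

text \<open>A basis: every element is a linear combination of \<open>B\<close> for exactly one finitely supported family
  of coefficients. Families are extensional, so that they are determined by their values on \<open>B\<close>.\<close>

definition module_basis ::
    "('a, 'm) ring_scheme \<Rightarrow> ('a, 'b, 'n) module_scheme \<Rightarrow> 'b set \<Rightarrow> bool" where
  "module_basis R M B \<longleftrightarrow>
     B \<subseteq> carrier M \<and>
     (\<forall>x \<in> carrier M. \<exists>!c. c \<in> B \<rightarrow>\<^sub>E carrier R \<and> finite {b \<in> B. c b \<noteq> \<zero>\<^bsub>R\<^esub>} \<and>
        x = (\<Oplus>\<^bsub>M\<^esub> b \<in> {b \<in> B. c b \<noteq> \<zero>\<^bsub>R\<^esub>}. c b \<odot>\<^bsub>M\<^esub> b))"

definition free_module ::
    "('a, 'm) ring_scheme \<Rightarrow> ('a, 'b, 'n) module_scheme \<Rightarrow> bool" where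
  "free_module R M \<longleftrightarrow> (\<exists>B. module_basis R M B)"

text \<open>Module homomorphisms are taken extensional on \<open>carrier M\<close>, so that equality of functions is
  equality of homomorphisms.\<close>

definition hom_module ::
    "('a, 'm) ring_scheme \<Rightarrow> ('a, 'b, 'n) module_scheme \<Rightarrow> ('a, 'c, 'k) module_scheme
      \<Rightarrow> ('a, 'b \<Rightarrow> 'c) module" where
  "hom_module R M N =
     \<lparr>carrier = {f \<in> carrier M \<rightarrow>\<^sub>E carrier N.
        (\<forall>x \<in> carrier M. \<forall>y \<in> carrier M. f (x \<oplus>\<^bsub>M\<^esub> y) = f x \<oplus>\<^bsub>N\<^esub> f y) \<and>
        (\<forall>a \<in> carrier R. \<forall>x \<in> carrier M. f (a \<odot>\<^bsub>M\<^esub> x) = a \<odot>\<^bsub>N\<^esub> f x)},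
      monoid.mult = undefined, one = undefined,
      ring.zero = (\<lambda>x \<in> carrier M. \<zero>\<^bsub>N\<^esub>),
      ring.add = (\<lambda>f g. \<lambda>x \<in> carrier M. f x \<oplus>\<^bsub>N\<^esub> g x),
      smult = (\<lambda>a f. \<lambda>x \<in> carrier M. a \<odot>\<^bsub>N\<^esub> f x)\<rparr>"

definition dual_module ::
    "('a, 'm) ring_scheme \<Rightarrow> ('a, 'b, 'n) module_scheme \<Rightarrow> ('a, 'b \<Rightarrow> 'a) module" where
  "dual_module R M = hom_module R M (self_module R)"


section \<open>Localization\<close>

text \<open>Fractions \<open>m/s\<close> are classes of pairs \<open>(m, s)\<close>, where \<open>m/s = n/t\<close> iff \<open>u t m = u s n\<close> for
  some \<open>u \<in> S\<close>. The operations are the unions, over all representatives, of the class of the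
  expected result; for a multiplicative set \<open>S\<close> this class does not depend on the representatives.\<close>

definition frac_rel ::
    "'a set \<Rightarrow> ('a, 'b, 'n) module_scheme \<Rightarrow> (('b \<times> 'a) \<times> ('b \<times> 'a)) set" where
  "frac_rel S M = {((m, s), (n, t)).
     m \<in> carrier M \<and> s \<in> S \<and> n \<in> carrier M \<and> t \<in> S \<and>
     (\<exists>u \<in> S. u \<odot>\<^bsub>M\<^esub> (t \<odot>\<^bsub>M\<^esub> m) = u \<odot>\<^bsub>M\<^esub> (s \<odot>\<^bsub>M\<^esub> n))}"

definition loc_frac ::
    "'a set \<Rightarrow> ('a, 'b, 'n) module_scheme \<Rightarrow> 'b \<Rightarrow> 'a \<Rightarrow> ('b \<times> 'a) set" where
  "loc_frac S M m s = frac_rel S M `` {(m, s)}"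

definition loc_ring ::
    "('a, 'm) ring_scheme \<Rightarrow> 'a set \<Rightarrow> ('a \<times> 'a) set ring" where
  "loc_ring R S =
     \<lparr>carrier = (carrier R \<times> S) // frac_rel S (self_module R),
      monoid.mult = (\<lambda>A B. \<Union>(a, s) \<in> A. \<Union>(b, t) \<in> B.
                loc_frac S (self_module R) (a \<otimes>\<^bsub>R\<^esub> b) (s \<otimes>\<^bsub>R\<^esub> t)),
      one = loc_frac S (self_module R) \<one>\<^bsub>R\<^esub> \<one>\<^bsub>R\<^esub>,
      ring.zero = loc_frac S (self_module R) \<zero>\<^bsub>R\<^esub> \<one>\<^bsub>R\<^esub>,
      ring.add = (\<lambda>A B. \<Union>(a, s) \<in> A. \<Union>(b, t) \<in> B.
                loc_frac S (self_module R) (t \<otimes>\<^bsub>R\<^esub> a \<oplus>\<^bsub>R\<^esub> s \<otimes>\<^bsub>R\<^esub> b) (s \<otimes>\<^bsub>R\<^esub> t))\<rparr>"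

definition loc_module ::
    "('a, 'm) ring_scheme \<Rightarrow> 'a set \<Rightarrow> ('a, 'b, 'n) module_scheme
      \<Rightarrow> (('a \<times> 'a) set, ('b \<times> 'a) set) module" where
  "loc_module R S M =
     \<lparr>carrier = (carrier M \<times> S) // frac_rel S M,
      monoid.mult = undefined, one = undefined,
      ring.zero = loc_frac S M \<zero>\<^bsub>M\<^esub> \<one>\<^bsub>R\<^esub>,
      ring.add = (\<lambda>X Y. \<Union>(m, s) \<in> X. \<Union>(n, t) \<in> Y.
               loc_frac S M (t \<odot>\<^bsub>M\<^esub> m \<oplus>\<^bsub>M\<^esub> s \<odot>\<^bsub>M\<^esub> n) (s \<otimes>\<^bsub>R\<^esub> t)),
      smult = (\<lambda>A X. \<Union>(a, s) \<in> A. \<Union>(m, t) \<in> X.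
               loc_frac S M (a \<odot>\<^bsub>M\<^esub> m) (s \<otimes>\<^bsub>R\<^esub> t))\<rparr>"

abbreviation loc_ring_at :: "('a, 'm) ring_scheme \<Rightarrow> 'a set \<Rightarrow> ('a \<times> 'a) set ring" where
  "loc_ring_at R p \<equiv> loc_ring R (carrier R - p)"

abbreviation loc_module_at ::
    "('a, 'm) ring_scheme \<Rightarrow> 'a set \<Rightarrow> ('a, 'b, 'n) module_scheme
      \<Rightarrow> (('a \<times> 'a) set, ('b \<times> 'a) set) module" where
  "loc_module_at R p M \<equiv> loc_module R (carrier R - p) M"


section \<open>Local rings, depth, height\<close>

definition local_ring :: "('a, 'm) ring_scheme \<Rightarrow> bool" where
  "local_ring R \<longleftrightarrow> cring R \<and> (\<exists>!I. maximalideal I R)"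

definition max_ideal :: "('a, 'm) ring_scheme \<Rightarrow> 'a set" where
  "max_ideal R = (THE I. maximalideal I R)"

text \<open>\<open>seq_submodule R M xs\<close> is the submodule \<open>(x\<^sub>1, \<dots>, x\<^sub>n)M\<close> of \<open>M\<close>.\<close>

definition seq_submodule ::
    "('a, 'm) ring_scheme \<Rightarrow> ('a, 'b, 'n) module_scheme \<Rightarrow> 'a list \<Rightarrow> 'b set" where
  "seq_submodule R M xs = submodule_span R M {x \<odot>\<^bsub>M\<^esub> m | x m. x \<in> set xs \<and> m \<in> carrier M}"

text \<open>The first condition on a regular sequence says that multiplication by \<open>x\<^sub>i\<close> is injective on
  \<open>M/(x\<^sub>1, \<dots>, x\<^sub>i\<^sub>-\<^sub>1)M\<close>, the second that \<open>M/(x\<^sub>1, \<dots>, x\<^sub>n)M\<close> is nonzero.\<close>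

definition regular_sequence ::
    "('a, 'm) ring_scheme \<Rightarrow> ('a, 'b, 'n) module_scheme \<Rightarrow> 'a list \<Rightarrow> bool" where
  "regular_sequence R M xs \<longleftrightarrow>
     set xs \<subseteq> carrier R \<and>
     (\<forall>i < length xs. \<forall>m \<in> carrier M.
        (xs ! i) \<odot>\<^bsub>M\<^esub> m \<in> seq_submodule R M (take i xs) \<longrightarrow> m \<in> seq_submodule R M (take i xs)) \<and>
     seq_submodule R M xs \<noteq> carrier M"

text \<open>Depth of a module over a local ring; the zero module has depth \<open>\<infinity>\<close>.\<close>

definition depth ::
    "('a, 'm) ring_scheme \<Rightarrow> ('a, 'b, 'n) module_scheme \<Rightarrow> enat" where
  "depth R M =
     (if carrier M = {\<zero>\<^bsub>M\<^esub>} then \<infinity>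
      else Sup {enat (length xs) | xs. set xs \<subseteq> max_ideal R \<and> regular_sequence R M xs})"

definition height :: "('a, 'm) ring_scheme \<Rightarrow> 'a set \<Rightarrow> enat" where
  "height R p =
     Sup {enat n | n. \<exists>P. (\<forall>i \<le> n. primeideal (P i) R) \<and> (\<forall>i < n. P i \<subset> P (Suc i)) \<and> P n = p}"

definition serre_condition ::
    "nat \<Rightarrow> ('a, 'm) ring_scheme \<Rightarrow> ('a, 'b, 'n) module_scheme \<Rightarrow> bool" where
  "serre_condition i R M \<longleftrightarrow>
     (\<forall>p. primeideal p R \<longrightarrow>
        depth (loc_ring_at R p) (loc_module_at R p M) \<ge> min (enat i) (height R p))"

end

theory Submission
  imports Defs
begin

text \<open>Let \<open>b\<^sub>1, \<dots>, b\<^sub>n\<close> be a basis of \<open>M\<^sup>*\<close> and \<open>\<phi> = (b\<^sub>1, \<dots>, b\<^sub>n) : M \<rightarrow> R\<^sup>n\<close>; every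
  functional on \<open>M\<close> factors uniquely through \<open>\<phi>\<close>. If \<open>p = (0 : s)\<close> is an associated prime of \<open>R\<close>
  and the cokernel \<open>C\<close> of \<open>\<phi>\<close> were nonzero at \<open>p\<close>, there would be a nonzero map \<open>C \<rightarrow> R/p \<cong> Rs\<close>,
  contradicting uniqueness. Hence \<open>C\<close> vanishes at the associated primes of \<open>R\<close> and is killed by a
  regular element \<open>x\<close>.

  The kernel of \<open>\<phi>\<close> has only associated primes of height 0 by the Serre condition on \<open>M\<close>. At such a
  prime \<open>M\<close> is the sum of the kernel and a free module, so a nonzero kernel would carry a functional
  which extends to \<open>M\<close>, although all functionals on \<open>M\<close> vanish on the kernel. So \<open>\<phi>\<close> is injective.

  Let \<open>q\<close> be an associated prime of \<open>C\<close>; it contains \<open>x\<close>. If \<open>q\<close> is minimal over \<open>x\<close>, then \<open>q\<close> is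
  associated to \<open>R/xR\<close> and there is a nonzero map \<open>C \<rightarrow> R/xR\<close>, i.e. a functional on \<open>R\<^sup>n\<close> that is
  divisible by \<open>x\<close> on \<open>\<phi>(M)\<close> but not on \<open>R\<^sup>n\<close>; its quotient by \<open>x\<close> contradicts the factorization
  property. Otherwise \<open>q\<close> has height at least 2, so \<open>M\<^sub>q\<close> has depth at least 2, which forces an
  element of \<open>R\<^sup>n\<close> multiplied into \<open>\<phi>(M)\<close> by \<open>q\<close> to lie in \<open>\<phi>(M)\<^sub>q\<close>.\<close>

section \<open>Submodules and noetherian modules\<close>

text \<open>The obstacle is to argue at a prime p without carrying quotients and localizations
  along. A quotient M/N is represented by N alone: the annihilators of its elements are the ideals
  \<open>colon R M N x\<close>, and its associated primes are the prime ones among them. A statement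
  at p becomes a statement in M up to a factor outside p, and fractions occur only where Serre's
  condition is unpacked. The nonzero map on C exists because a submodule N of R^n that contains the
  image of M and is maximal with nonzero quotient at p makes (R^n/N)_p a line over the residue field
  of p. A common denominator t turns the coordinate on that line into a map to R/p. For the kernel,
  lifts of multiples of the unit vectors give a section of the evaluation map up to a factor t0
  outside p. A functional vanishing on the image of the section has coefficients killed by t0,
  whereas the functional built from a nonzero kernel takes a value that t0 does not kill. In the
  last case height 2 comes from an explicit chain: a prime over x strictly inside q contains an
  associated prime of R, which misses the regular element x.\<close>

definition noetherian_module ::
    "('a, 'm) ring_scheme \<Rightarrow> ('a, 'b, 'n) module_scheme \<Rightarrow> bool" where
  "noetherian_module R M \<longleftrightarrow>
     (\<forall>\<F>. \<F> \<noteq> {} \<longrightarrow> (\<forall>N \<in> \<F>. submodule N R M) \<longrightarrow>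
       (\<exists>N \<in> \<F>. \<forall>N' \<in> \<F>. N \<subseteq> N' \<longrightarrow> N' = N))"

lemma noetherian_moduleD:
  assumes "noetherian_module R M" "\<F> \<noteq> {}" "\<And>N. N \<in> \<F> \<Longrightarrow> submodule N R M"
  obtains N where "N \<in> \<F>" "\<And>N'. N' \<in> \<F> \<Longrightarrow> N \<subseteq> N' \<Longrightarrow> N' = N"
proof -
  have "\<exists>N \<in> \<F>. \<forall>N' \<in> \<F>. N \<subseteq> N' \<longrightarrow> N' = N"
    using assms unfolding noetherian_module_def by blast
  with that show thesis by blast
qed

text \<open>In a noetherian ring a nonempty chain of ideals contains its own union, so Zorn's lemma
  applies to every nonempty family of ideals.\<close>

lemma (in noetherian_ring) ex_maximal_ideal_in:
  assumes "\<F> \<noteq> {}" "\<And>I. I \<in> \<F> \<Longrightarrow> ideal I R"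
  obtains I where "I \<in> \<F>" "\<And>J. J \<in> \<F> \<Longrightarrow> I \<subseteq> J \<Longrightarrow> J = I"
proof -
  have "\<exists>I \<in> \<F>. \<forall>J \<in> \<F>. I \<subseteq> J \<longrightarrow> J = I"
  proof (rule subset_Zorn_nonempty[OF assms(1)])
    fix C assume C: "C \<noteq> {}" "subset.chain \<F> C"
    then have "subset.chain {I. ideal I R} C"
      using assms(2) by (auto simp: pred_on.chain_def)
    then have "\<Union>C \<in> C" using ideal_chain_is_trivial[OF C(1)] by blast
    then show "\<Union>C \<in> \<F>" using C(2) by (auto simp: pred_on.chain_def)
  qed
  with that show thesis by blast
qed

section \<open>Ideals as submodules of the ring\<close>

lemma self_module_simps [simp]:
  "carrier (self_module R) = carrier R"
  "\<zero>\<^bsub>self_module R\<^esub> = \<zero>\<^bsub>R\<^esub>"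
  "x \<oplus>\<^bsub>self_module R\<^esub> y = x \<oplus>\<^bsub>R\<^esub> y"
  "x \<odot>\<^bsub>self_module R\<^esub> y = x \<otimes>\<^bsub>R\<^esub> y"
  by (simp_all add: self_module_def)

lemma (in cring) module_self_module: "module R (self_module R)"
proof (rule moduleI)
  show "abelian_group (self_module R)"
    by (rule abelian_groupI) (auto simp: a_ac intro: a_inv_closed l_neg)
qed (auto simp: l_distr r_distr m_assoc is_cring)

lemma (in module) submoduleI':
  assumes "H \<subseteq> carrier M" "\<zero>\<^bsub>M\<^esub> \<in> H"
    and "\<And>a b. a \<in> H \<Longrightarrow> b \<in> H \<Longrightarrow> a \<oplus>\<^bsub>M\<^esub> b \<in> H"
    and "\<And>a x. a \<in> carrier R \<Longrightarrow> x \<in> H \<Longrightarrow> a \<odot>\<^bsub>M\<^esub> x \<in> H"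
  shows "submodule H R M"
proof (rule submoduleI)
  fix a assume a: "a \<in> H"
  then have "(\<ominus> \<one>) \<odot>\<^bsub>M\<^esub> a \<in> H" by (intro assms(4)) auto
  then show "\<ominus>\<^bsub>M\<^esub> a \<in> H" using a assms(1) by (simp add: smult_l_minus subset_eq)
qed (use assms in auto)

lemma (in module) submodule_zero: "submodule N R M \<Longrightarrow> \<zero>\<^bsub>M\<^esub> \<in> N"
  by (metis all_not_in_conv smult_l_null submoduleE(1,2,4) R.zero_closed subsetD)

lemma (in cring) ideal_iff_submodule: "submodule I R (self_module R) \<longleftrightarrow> ideal I R"
proof
  interpret S: module R "self_module R" by (rule module_self_module)
  assume I: "submodule I R (self_module R)"
  note E = S.submoduleE[OF I, simplified] S.submodule_zero[OF I, simplified]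
  have neg: "\<ominus> a \<in> I" if "a \<in> I" for a
    using E(4)[of "\<ominus> \<one>" a] that E(1) by (auto simp: l_minus)
  show "ideal I R"
  proof (rule idealI[OF ring_axioms])
    show "subgroup I (add_monoid R)"
      using E neg by (intro add.subgroupI) (auto simp: a_inv_def)
    fix a x assume "a \<in> I" "x \<in> carrier R"
    then show "x \<otimes> a \<in> I" "a \<otimes> x \<in> I" using E(1,4) m_comm[of a x] by auto
  qed
next
  interpret S: module R "self_module R" by (rule module_self_module)
  assume "ideal I R"
  then interpret ideal I R .
  show "submodule I R (self_module R)"
    by (rule S.submoduleI') (auto simp: a_subset I_l_closed)
qed

lemma (in module) submodule_minus:
  assumes "submodule N R M" "x \<in> N" "y \<in> N"
  shows "x \<ominus>\<^bsub>M\<^esub> y \<in> N"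
  using submoduleE[OF assms(1)] assms by (simp add: a_minus_def)

lemma (in module) submodule_add_cancel:
  assumes "submodule N R M" "n \<in> N" "x \<in> carrier M" "x \<oplus>\<^bsub>M\<^esub> n \<in> N"
  shows "x \<in> N"
proof -
  have "n \<in> carrier M" using submoduleE(1)[OF assms(1)] assms(2) by auto
  then have "x = (x \<oplus>\<^bsub>M\<^esub> n) \<ominus>\<^bsub>M\<^esub> n"
    using assms(3) by (simp add: a_minus_def M.add.m_assoc M.r_neg)
  then show ?thesis using submodule_minus[OF assms(1) assms(4,2)] by simp
qed

text \<open>The annihilator of the class of \<open>x\<close> in \<open>M/N\<close>; when it is
  prime, it is an associated prime of \<open>M/N\<close>. This keeps quotient modules out of the
  development.\<close>

definition colon ::
    "('a, 'm) ring_scheme \<Rightarrow> ('a, 'b, 'n) module_scheme \<Rightarrow> 'b set \<Rightarrow> 'b \<Rightarrow> 'a set" where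
  "colon R M N x = {r \<in> carrier R. r \<odot>\<^bsub>M\<^esub> x \<in> N}"

lemma (in module) ideal_colon:
  assumes "submodule N R M" "x \<in> carrier M"
  shows "ideal (colon R M N x) R"
proof -
  interpret S: module R "self_module R" by (rule R.module_self_module)
  note E = submoduleE[OF assms(1)]
  have "submodule (colon R M N x) R (self_module R)"
    by (rule S.submoduleI')
      (use assms E submodule_zero[OF assms(1)] in
        \<open>auto simp: colon_def smult_l_distr smult_assoc1\<close>)
  then show ?thesis by (simp add: R.ideal_iff_submodule)
qed

section \<open>Adjoining an element, spans and noetherian modules\<close>

definition adjoin ::
    "('a, 'm) ring_scheme \<Rightarrow> ('a, 'b, 'n) module_scheme \<Rightarrow> 'b \<Rightarrow> 'b set \<Rightarrow> 'b set" where
  "adjoin R M x N = {a \<odot>\<^bsub>M\<^esub> x \<oplus>\<^bsub>M\<^esub> n | a n. a \<in> carrier R \<and> n \<in> N}"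

lemma (in module)
  assumes N: "submodule N R M" and x: "x \<in> carrier M"
  shows submodule_adjoin: "submodule (adjoin R M x N) R M"
    and subset_adjoin: "N \<subseteq> adjoin R M x N"
    and mem_adjoin: "x \<in> adjoin R M x N"
proof -
  note E = submoduleE[OF N] and z = submodule_zero[OF N]
  have E1: "n \<in> carrier M" if "n \<in> N" for n using E(1) that by auto
  show "submodule (adjoin R M x N) R M"
  proof (rule submoduleI')
    show "\<zero>\<^bsub>M\<^esub> \<in> adjoin R M x N"
      unfolding adjoin_def using z x
      by (intro CollectI exI[of _ \<zero>] exI[of _ "\<zero>\<^bsub>M\<^esub>"]) auto
  next
    fix u v assume "u \<in> adjoin R M x N" "v \<in> adjoin R M x N"
    then obtain a n b k where "u = a \<odot>\<^bsub>M\<^esub> x \<oplus>\<^bsub>M\<^esub> n" "v = b \<odot>\<^bsub>M\<^esub> x \<oplus>\<^bsub>M\<^esub> k"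
      "a \<in> carrier R" "b \<in> carrier R" "n \<in> N" "k \<in> N" unfolding adjoin_def by auto
    then have "u \<oplus>\<^bsub>M\<^esub> v = (a \<oplus> b) \<odot>\<^bsub>M\<^esub> x \<oplus>\<^bsub>M\<^esub> (n \<oplus>\<^bsub>M\<^esub> k) \<and> n \<oplus>\<^bsub>M\<^esub> k \<in> N \<and> a \<oplus> b \<in> carrier R"
      using x E1 E(5) by (simp add: smult_l_distr M.a_ac)
    then show "u \<oplus>\<^bsub>M\<^esub> v \<in> adjoin R M x N" unfolding adjoin_def by blast
  next
    fix c u assume c: "c \<in> carrier R" and "u \<in> adjoin R M x N"
    then obtain a n where "u = a \<odot>\<^bsub>M\<^esub> x \<oplus>\<^bsub>M\<^esub> n"
      "a \<in> carrier R" "n \<in> N" unfolding adjoin_def by auto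
    then have "c \<odot>\<^bsub>M\<^esub> u = (c \<otimes> a) \<odot>\<^bsub>M\<^esub> x \<oplus>\<^bsub>M\<^esub> (c \<odot>\<^bsub>M\<^esub> n) \<and> c \<odot>\<^bsub>M\<^esub> n \<in> N \<and> c \<otimes> a \<in> carrier R"
      using x c E1 E(4) by (simp add: smult_r_distr smult_assoc1)
    then show "c \<odot>\<^bsub>M\<^esub> u \<in> adjoin R M x N" unfolding adjoin_def by blast
  qed (use x E1 in \<open>auto simp: adjoin_def\<close>)
  show "N \<subseteq> adjoin R M x N"
  proof
    fix n assume "n \<in> N"
    then have "n = \<zero> \<odot>\<^bsub>M\<^esub> x \<oplus>\<^bsub>M\<^esub> n" using x E1 by simp
    with \<open>n \<in> N\<close> show "n \<in> adjoin R M x N" unfolding adjoin_def by blast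
  qed
  have "x = \<one> \<odot>\<^bsub>M\<^esub> x \<oplus>\<^bsub>M\<^esub> \<zero>\<^bsub>M\<^esub>" using x by simp
  then show "x \<in> adjoin R M x N" unfolding adjoin_def using z by blast
qed

lemma (in module)
  assumes X: "X \<subseteq> carrier M"
  shows submodule_submodule_span: "submodule (submodule_span R M X) R M"
    and subset_submodule_span: "X \<subseteq> submodule_span R M X"
proof -
  let ?F = "{N. submodule N R M \<and> X \<subseteq> N}"
  have c: "carrier M \<in> ?F" using X carrier_is_submodule by auto
  show "submodule (submodule_span R M X) R M"
    unfolding submodule_span_def
    by (rule submoduleI') (use c submodule_zero submoduleE(4,5) in \<open>fastforce+\<close>)
  show "X \<subseteq> submodule_span R M X" unfolding submodule_span_def by auto
qed

lemma submodule_span_least: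
  "submodule N R M \<Longrightarrow> X \<subseteq> N \<Longrightarrow> submodule_span R M X \<subseteq> N"
  unfolding submodule_span_def by auto

text \<open>Among the submodules \<open>N\<close> of \<open>\<langle>x, X\<rangle>\<close> one first maximizes the ideal of all \<open>r\<close> with
  \<open>r x \<in> N + \<langle>X\<rangle>\<close> and then \<open>N \<inter> \<langle>X\<rangle>\<close>.\<close>

lemma (in module) ex_maximal_submodule_of_span:
  assumes "noetherian_ring R" "finite X" "X \<subseteq> carrier M" "\<F> \<noteq> {}"
    "\<And>N. N \<in> \<F> \<Longrightarrow> submodule N R M \<and> N \<subseteq> submodule_span R M X"
  shows "\<exists>N \<in> \<F>. \<forall>N' \<in> \<F>. N \<subseteq> N' \<longrightarrow> N' = N"
  using assms(2-)
proof (induction X arbitrary: \<F> rule: finite_induct)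
  case empty
  have z: "submodule {\<zero>\<^bsub>M\<^esub>} R M" by (rule submoduleI') auto
  have "N = {\<zero>\<^bsub>M\<^esub>}" if "N \<in> \<F>" for N
    using that empty(3) submodule_span_least[OF z, of "{}"] submodule_zero by fast
  with empty show ?case by blast
next
  case (insert x X)
  interpret R': noetherian_ring R by fact
  have x: "x \<in> carrier M" and X: "X \<subseteq> carrier M" using insert.prems by auto
  let ?P = "submodule_span R M X"
  have P: "submodule ?P R M" by (rule submodule_submodule_span[OF X])
  note PE = submoduleE[OF P]
  have le: "submodule_span R M (insert x X) \<subseteq> adjoin R M x ?P"
    using submodule_adjoin[OF P x] subset_adjoin[OF P x] mem_adjoin[OF P x] subset_submodule_span[OF X]
    by (intro submodule_span_least) auto
  define I where "I N = {r \<in> carrier R. \<exists>n \<in> N. \<exists>y \<in> ?P. r \<odot>\<^bsub>M\<^esub> x = n \<oplus>\<^bsub>M\<^esub> y}" for N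
  have sub: "submodule N R M" "N \<subseteq> adjoin R M x ?P" if "N \<in> \<F>" for N
    using insert.prems(3)[OF that] le by auto
  interpret S: module R "self_module R" by (rule R.module_self_module)
  have idl: "ideal (I N) R" if "N \<in> \<F>" for N
  proof -
    note NE = submoduleE[OF sub(1)[OF that]] and Nz = submodule_zero[OF sub(1)[OF that]]
    have "submodule (I N) R (self_module R)"
    proof (rule S.submoduleI')
      show "\<zero>\<^bsub>self_module R\<^esub> \<in> I N"
        unfolding I_def using Nz submodule_zero[OF P] x
        by (auto intro!: bexI[of _ "\<zero>\<^bsub>M\<^esub>"])
    next
      fix a b assume "a \<in> I N" "b \<in> I N"
      then obtain n y k z where *: "a \<in> carrier R" "b \<in> carrier R" "n \<in> N" "k \<in> N"
        "y \<in> ?P" "z \<in> ?P" "a \<odot>\<^bsub>M\<^esub> x = n \<oplus>\<^bsub>M\<^esub> y" "b \<odot>\<^bsub>M\<^esub> x = k \<oplus>\<^bsub>M\<^esub> z"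
        unfolding I_def by blast
      then have "n \<in> carrier M" "k \<in> carrier M" "y \<in> carrier M" "z \<in> carrier M"
        using NE(1) PE(1) by auto
      with * have "(a \<oplus> b) \<odot>\<^bsub>M\<^esub> x = (n \<oplus>\<^bsub>M\<^esub> k) \<oplus>\<^bsub>M\<^esub> (y \<oplus>\<^bsub>M\<^esub> z)"
        using x by (simp add: smult_l_distr M.a_ac)
      moreover have "n \<oplus>\<^bsub>M\<^esub> k \<in> N" "y \<oplus>\<^bsub>M\<^esub> z \<in> ?P" "a \<oplus> b \<in> carrier R"
        using * NE(5) PE(5) by auto
      ultimately show "a \<oplus>\<^bsub>self_module R\<^esub> b \<in> I N"
        unfolding I_def self_module_simps by blast
    next
      fix c a assume c: "c \<in> carrier R" and "a \<in> I N"
      then obtain n y where *: "a \<in> carrier R" "n \<in> N" "y \<in> ?P" "a \<odot>\<^bsub>M\<^esub> x = n \<oplus>\<^bsub>M\<^esub> y"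
        unfolding I_def by blast
      then have "n \<in> carrier M" "y \<in> carrier M"
        using NE(1) PE(1) by auto
      with * c have "(c \<otimes> a) \<odot>\<^bsub>M\<^esub> x = c \<odot>\<^bsub>M\<^esub> n \<oplus>\<^bsub>M\<^esub> c \<odot>\<^bsub>M\<^esub> y"
        using x by (simp add: smult_assoc1 smult_r_distr)
      moreover have "c \<odot>\<^bsub>M\<^esub> n \<in> N" "c \<odot>\<^bsub>M\<^esub> y \<in> ?P" "c \<otimes> a \<in> carrier R"
        using * c NE(4) PE(4) by auto
      ultimately show "c \<odot>\<^bsub>self_module R\<^esub> a \<in> I N"
        unfolding I_def self_module_simps by blast
    qed (auto simp: I_def)
    then show ?thesis by (simp add: R.ideal_iff_submodule)
  qed
  obtain J where J: "J \<in> I ` \<F>" "\<And>J'. J' \<in> I ` \<F> \<Longrightarrow> J \<subseteq> J' \<Longrightarrow> J' = J"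
    by (rule R'.ex_maximal_ideal_in[of "I ` \<F>"]) (use insert.prems idl in auto)
  \<comment> \<open>Only the members with the maximal ideal \<open>J\<close> compete from here on,
    and the induction hypothesis sees them through their traces on the span of
    \<open>X\<close>.\<close>
  let ?G = "(\<lambda>N. N \<inter> ?P) ` {N \<in> \<F>. I N = J}"
  have G: "submodule K R M \<and> K \<subseteq> ?P" if "K \<in> ?G" for K
  proof -
    obtain N where N: "N \<in> \<F>" "K = N \<inter> ?P" using \<open>K \<in> ?G\<close> by auto
    note NE = submoduleE[OF sub(1)[OF N(1)]] and Nz = submodule_zero[OF sub(1)[OF N(1)]]
    show ?thesis
      using N NE PE Nz submodule_zero[OF P] by (auto intro!: submoduleI')
  qed
  have "?G \<noteq> {}" using J(1) by auto
  with insert.IH[OF X this G] obtain K where K: "K \<in> ?G" "\<forall>K'\<in>?G. K \<subseteq> K' \<longrightarrow> K' = K"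
    by blast
  then obtain N where N: "N \<in> \<F>" "I N = J" "K = N \<inter> ?P" by auto
  have "N' = N" if N': "N' \<in> \<F>" "N \<subseteq> N'" for N'
  proof -
    note NE = submoduleE[OF sub(1)[OF N(1)]] and N'E = submoduleE[OF sub(1)[OF N'(1)]]
    have "I N \<subseteq> I N'" using N'(2) unfolding I_def by blast
    then have IN': "I N' = J" using J(2) N N'(1) by auto
    have "N' \<inter> ?P \<in> ?G" using IN' N'(1) by auto
    moreover have "K \<subseteq> N' \<inter> ?P" using N'(2) N(3) by auto
    ultimately have KN': "N' \<inter> ?P = K" using K(2) by blast
    \<comment> \<open>\<open>N\<close> and \<open>N'\<close> allow the same coefficients of
      \<open>x\<close> modulo the span, so \<open>u\<close> differs from an element of
      \<open>N\<close> by an element of the span. That difference lies in \<open>N'\<close>, and the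
      traces of \<open>N\<close> and \<open>N'\<close> on the span agree.\<close>
    have "u \<in> N" if u: "u \<in> N'" for u
    proof -
      have uc: "u \<in> carrier M" using u N'E by auto
      obtain a y where ay: "u = a \<odot>\<^bsub>M\<^esub> x \<oplus>\<^bsub>M\<^esub> y" "a \<in> carrier R" "y \<in> ?P"
        using u sub(2)[OF N'(1)] unfolding adjoin_def by auto
      have yc: "y \<in> carrier M" using ay PE by auto
      have "a \<odot>\<^bsub>M\<^esub> x = u \<oplus>\<^bsub>M\<^esub> \<ominus>\<^bsub>M\<^esub> y"
        using ay x yc by (simp add: M.add.m_assoc M.r_neg)
      then have "a \<in> I N'" unfolding I_def using ay u PE(3) by blast
      then have "a \<in> I N" using IN' N(2) by simp
      then obtain n z where nz: "n \<in> N" "z \<in> ?P" "a \<odot>\<^bsub>M\<^esub> x = n \<oplus>\<^bsub>M\<^esub> z"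
        unfolding I_def by blast
      have c: "n \<in> carrier M" "z \<in> carrier M" using nz NE PE by auto
      have eq: "u = (z \<oplus>\<^bsub>M\<^esub> y) \<oplus>\<^bsub>M\<^esub> n" using ay nz c yc by (simp add: M.a_ac)
      then have "z \<oplus>\<^bsub>M\<^esub> y \<in> N'"
        using submodule_add_cancel[OF sub(1)[OF N'(1)], of n "z \<oplus>\<^bsub>M\<^esub> y"] u nz N'(2) c yc by auto
      then have "z \<oplus>\<^bsub>M\<^esub> y \<in> N" using KN' N(3) PE(5) nz ay by blast
      then show "u \<in> N" using eq NE(5) nz by auto
    qed
    then show "N' = N" using N'(2) by auto
  qed
  then show ?case using N(1) by blast
qed

lemma (in module) noetherian_moduleI:
  assumes "noetherian_ring R" "finitely_generated_module R M"
  shows "noetherian_module R M"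
  unfolding noetherian_module_def
proof (intro allI impI)
  fix \<F> assume F: "\<F> \<noteq> {}" "\<forall>N\<in>\<F>. submodule N R M"
  obtain X where X: "finite X" "X \<subseteq> carrier M" "submodule_span R M X = carrier M"
    using assms(2) unfolding finitely_generated_module_def by blast
  show "\<exists>N\<in>\<F>. \<forall>N'\<in>\<F>. N \<subseteq> N' \<longrightarrow> N' = N"
    by (rule ex_maximal_submodule_of_span[OF assms(1) X(1,2) F(1)])
      (use F X submoduleE(1) in auto)
qed

section \<open>Colon ideals and associated primes\<close>

text \<open>The usual proof that a maximal annihilator is prime, carried out among the annihilators
  disjoint from \<open>S\<close>. With \<open>S\<close> the complement of a prime p it finds an
  associated prime inside p; with \<open>S = {\<one>}\<close> it finds just some associated
  prime.\<close>

lemma (in module) ex_colon_prime: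
  assumes "noetherian_ring R" and U: "submodule U R M" and y: "y \<in> carrier M"
    and S: "S \<subseteq> carrier R" "\<one> \<in> S" "\<And>a b. a \<in> S \<Longrightarrow> b \<in> S \<Longrightarrow> a \<otimes> b \<in> S"
    and disj: "colon R M U y \<inter> S = {}"
  obtains r where "r \<in> carrier R" "primeideal (colon R M U (r \<odot>\<^bsub>M\<^esub> y)) R"
    "colon R M U (r \<odot>\<^bsub>M\<^esub> y) \<inter> S = {}"
proof -
  interpret R': noetherian_ring R by fact
  let ?c = "\<lambda>r. colon R M U (r \<odot>\<^bsub>M\<^esub> y)"
  note UE = submoduleE[OF U]
  let ?F = "?c ` {r \<in> carrier R. ?c r \<inter> S = {}}"
  have "?c \<one> \<in> ?F" using disj y by (intro imageI) simp
  then obtain I where I: "I \<in> ?F" "\<And>J. J \<in> ?F \<Longrightarrow> I \<subseteq> J \<Longrightarrow> J = I"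
    using R'.ex_maximal_ideal_in[of ?F] ideal_colon[OF U] y by (smt (verit) empty_iff imageE mem_Collect_eq smult_closed)
  then obtain r where r: "r \<in> carrier R" "?c r \<inter> S = {}" "I = ?c r" by auto
  have step: "colon R M U x \<subseteq> colon R M U (a \<odot>\<^bsub>M\<^esub> x)" if "a \<in> carrier R" "x \<in> carrier M" for a x
  proof -
    have "r \<odot>\<^bsub>M\<^esub> (a \<odot>\<^bsub>M\<^esub> x) = a \<odot>\<^bsub>M\<^esub> (r \<odot>\<^bsub>M\<^esub> x)" if "r \<in> carrier R" for r
      using that \<open>a \<in> carrier R\<close> \<open>x \<in> carrier M\<close> by (simp add: smult_assoc1[symmetric] m_comm)
    then show ?thesis using that UE(4) by (auto simp: colon_def)
  qed
  have max: "?c (a \<otimes> r) = ?c r" if "a \<in> carrier R" "?c (a \<otimes> r) \<inter> S = {}" for a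
  proof -
    have "?c (a \<otimes> r) \<in> ?F" using that r(1) by (intro imageI) simp
    moreover have "I \<subseteq> ?c (a \<otimes> r)"
      using step[of a "r \<odot>\<^bsub>M\<^esub> y"] that(1) r y by (simp add: smult_assoc1)
    ultimately show ?thesis using I(2) r(3) by simp
  qed
  have "primeideal (?c r) R"
  proof (rule primeidealI)
    show "ideal (?c r) R" using ideal_colon[OF U] r y by auto
    have "\<one> \<notin> ?c r" using r(2) S(2) by auto
    then show "carrier R \<noteq> ?c r" by auto
    fix a b assume ab: "a \<in> carrier R" "b \<in> carrier R" "a \<otimes> b \<in> ?c r"
    show "a \<in> ?c r \<or> b \<in> ?c r"
    proof (cases "?c (a \<otimes> r) \<inter> S = {}")
      case True
      have "b \<in> ?c (a \<otimes> r)" using ab r(1) y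
        by (simp add: colon_def smult_assoc1[symmetric] m_ac)
      with max[OF ab(1) True] show ?thesis by auto
    next
      case False
      then obtain t where t: "t \<in> S" "t \<in> ?c (a \<otimes> r)" by auto
      then have tc: "t \<in> carrier R" using S(1) by auto
      \<comment> \<open>Here \<open>t a r y\<close> lies in \<open>U\<close> for some
        \<open>t\<close> in \<open>S\<close>. Replacing \<open>r\<close> by
        \<open>t \<otimes> r\<close> keeps the colon ideal away from \<open>S\<close>, hence by
        maximality unchanged, and puts \<open>a\<close> into it.\<close>
      have "u \<otimes> t \<in> ?c r" if "u \<in> ?c (t \<otimes> r)" for u
        using that tc r(1) y by (simp add: colon_def smult_assoc1)
      then have "?c (t \<otimes> r) \<inter> S = {}" using r(2) S(3) t(1) by blast
      moreover have "a \<in> ?c (t \<otimes> r)" using t ab tc r(1) y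
        by (simp add: colon_def smult_assoc1[symmetric] m_ac)
      ultimately show ?thesis using max[OF tc] by auto
    qed
  qed (rule R.is_cring)
  then show thesis using r that by blast
qed

text \<open>\<open>N\<close> is maximal among the submodules containing \<open>U\<close> whose
  quotient is nonzero at \<open>p\<close>, that is, not killed by any one element outside
  \<open>p\<close>. Maximality makes \<open>(M/N)_p\<close> simple, hence a copy of the residue
  field, and \<open>M/N\<close> embeds into it. The class of \<open>x\<close> spans this line, and
  \<open>t\<close> is a denominator that serves all of \<open>M\<close> at once.\<close>

lemma (in module) ex_torsion_free_quotient:
  assumes noeth: "noetherian_module R M" and p: "primeideal p R" and U: "submodule U R M"
    and supp: "\<And>t. t \<in> carrier R - p \<Longrightarrow> \<exists>m \<in> carrier M. t \<odot>\<^bsub>M\<^esub> m \<notin> U"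
  obtains N x t where "submodule N R M" "U \<subseteq> N" "x \<in> carrier M" "t \<in> carrier R" "t \<notin> p"
    "colon R M N x = p"
    "\<And>m. m \<in> carrier M \<Longrightarrow>
       \<exists>a \<in> carrier R. \<exists>n \<in> N. t \<odot>\<^bsub>M\<^esub> m = a \<odot>\<^bsub>M\<^esub> x \<oplus>\<^bsub>M\<^esub> n"
proof -
  interpret p: primeideal p R by fact
  let ?T = "carrier R - p"
  let ?F = "{N. submodule N R M \<and> U \<subseteq> N \<and> (\<forall>t \<in> ?T. \<exists>m \<in> carrier M. t \<odot>\<^bsub>M\<^esub> m \<notin> N)}"
  have "U \<in> ?F" using U supp by auto
  then obtain N where N: "N \<in> ?F" and max: "\<And>N'. N' \<in> ?F \<Longrightarrow> N \<subseteq> N' \<Longrightarrow> N' = N"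
    by (rule_tac noetherian_moduleD[OF noeth, of ?F]) auto
  have Ns: "submodule N R M" using N by auto
  note NE = submoduleE[OF Ns]
  have Nc: "n \<in> carrier M" if "n \<in> N" for n using NE(1) that by auto
  have Tmult: "a \<otimes> b \<in> ?T" if "a \<in> ?T" "b \<in> ?T" for a b
    using that p.I_prime by auto
  have one: "\<one> \<in> ?T" using p.one_imp_carrier p.I_notcarr by auto
  \<comment> \<open>\<open>Rx + N\<close> is larger than \<open>N\<close>, so it has left the
    family: one element outside \<open>p\<close> multiplies all of \<open>M\<close> into it.\<close>
  have key: "\<exists>t \<in> ?T. \<forall>m \<in> carrier M. \<exists>a \<in> carrier R. \<exists>n \<in> N. t \<odot>\<^bsub>M\<^esub> m = a \<odot>\<^bsub>M\<^esub> x \<oplus>\<^bsub>M\<^esub> n"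
    if x: "x \<in> carrier M" "x \<notin> N" for x
  proof -
    have "adjoin R M x N \<notin> ?F"
      using max[of "adjoin R M x N"] subset_adjoin[OF Ns x(1)] mem_adjoin[OF Ns x(1)] x(2) by blast
    then show ?thesis
      using submodule_adjoin[OF Ns x(1)] subset_adjoin[OF Ns x(1)] N
      by (auto simp: adjoin_def) blast
  qed
  \<comment> \<open>\<open>M/N\<close> has no torsion by elements outside \<open>p\<close>:
    otherwise the product of \<open>t\<close> with the element \<open>t'\<close> that multiplies
    \<open>M\<close> into \<open>Rx + N\<close> would kill \<open>M/N\<close>.\<close>
  have tf: "x \<in> N" if x: "x \<in> carrier M" "t \<in> ?T" "t \<odot>\<^bsub>M\<^esub> x \<in> N" for x t
  proof (rule ccontr)
    assume "x \<notin> N"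
    then obtain t' where t': "t' \<in> ?T"
      "\<And>m. m \<in> carrier M \<Longrightarrow> \<exists>a \<in> carrier R. \<exists>n \<in> N. t' \<odot>\<^bsub>M\<^esub> m = a \<odot>\<^bsub>M\<^esub> x \<oplus>\<^bsub>M\<^esub> n"
      using key[OF x(1)] by blast
    obtain m where m: "m \<in> carrier M" "(t \<otimes> t') \<odot>\<^bsub>M\<^esub> m \<notin> N"
      using N Tmult[OF x(2) t'(1)] by auto
    have "(t \<otimes> t') \<odot>\<^bsub>M\<^esub> m \<in> N"
    proof -
      obtain a n where an: "a \<in> carrier R" "n \<in> N" "t' \<odot>\<^bsub>M\<^esub> m = a \<odot>\<^bsub>M\<^esub> x \<oplus>\<^bsub>M\<^esub> n"
        using t'(2)[OF m(1)] by blast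
      have "(t \<otimes> t') \<odot>\<^bsub>M\<^esub> m = a \<odot>\<^bsub>M\<^esub> (t \<odot>\<^bsub>M\<^esub> x) \<oplus>\<^bsub>M\<^esub> t \<odot>\<^bsub>M\<^esub> n"
        using an t' x m Nc
        by (simp add: smult_assoc1 smult_r_distr) (simp add: smult_assoc1[symmetric] m_comm)
      then show ?thesis using an x NE by auto
    qed
    with m(2) show False by contradiction
  qed
  have "\<forall>t \<in> ?T. \<exists>m \<in> carrier M. t \<odot>\<^bsub>M\<^esub> m \<notin> N" using N by simp
  then obtain x where "x \<in> carrier M" "\<one> \<odot>\<^bsub>M\<^esub> x \<notin> N" using one by (meson bspec)
  then have x: "x \<in> carrier M" "x \<notin> N" by simp_all
  obtain t where t: "t \<in> ?T"
    "\<And>m. m \<in> carrier M \<Longrightarrow> \<exists>a \<in> carrier R. \<exists>n \<in> N. t \<odot>\<^bsub>M\<^esub> m = a \<odot>\<^bsub>M\<^esub> x \<oplus>\<^bsub>M\<^esub> n"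
    using key[OF x] by blast
  \<comment> \<open>If \<open>q x\<close> were nonzero modulo \<open>N\<close>, it would generate a
    multiple \<open>s x\<close> with \<open>s\<close> outside \<open>p\<close>. Then
    \<open>s - a q\<close>, which is still outside \<open>p\<close>, would multiply \<open>x\<close>
    into \<open>N\<close>.\<close>
  have kill: "q \<odot>\<^bsub>M\<^esub> x \<in> N" if q: "q \<in> p" for q
  proof (rule ccontr)
    assume *: "q \<odot>\<^bsub>M\<^esub> x \<notin> N"
    have qc: "q \<in> carrier R" using q p.Icarr by auto
    obtain s a n where s: "s \<in> ?T" "a \<in> carrier R" "n \<in> N"
      "s \<odot>\<^bsub>M\<^esub> x = a \<odot>\<^bsub>M\<^esub> (q \<odot>\<^bsub>M\<^esub> x) \<oplus>\<^bsub>M\<^esub> n"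
      using key[OF smult_closed[OF qc x(1)] *] x(1) by blast
    have sc: "s \<in> carrier R" "s \<notin> p" using s(1) by auto
    have "(s \<ominus> a \<otimes> q) \<odot>\<^bsub>M\<^esub> x = s \<odot>\<^bsub>M\<^esub> x \<oplus>\<^bsub>M\<^esub> \<ominus>\<^bsub>M\<^esub> (a \<odot>\<^bsub>M\<^esub> (q \<odot>\<^bsub>M\<^esub> x))"
      using x(1) qc sc(1) s(2) by (simp add: a_minus_def smult_l_distr smult_l_minus smult_assoc1)
    also have "\<dots> = n"
      using x(1) qc s(2) Nc[OF s(3)] unfolding s(4) by (simp add: M.a_ac M.r_neg M.r_neg1 M.r_neg2)
    finally have "(s \<ominus> a \<otimes> q) \<odot>\<^bsub>M\<^esub> x = n" .
    moreover have "s \<ominus> a \<otimes> q \<in> ?T"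
    proof -
      have aq: "a \<otimes> q \<in> p" by (rule p.I_l_closed[OF q s(2)])
      have "(s \<ominus> a \<otimes> q) \<oplus> a \<otimes> q = s"
        using sc(1) s(2) qc by (simp add: a_minus_def R.a_assoc R.l_neg)
      then have "s \<ominus> a \<otimes> q \<notin> p" using p.a_closed[of "s \<ominus> a \<otimes> q", OF _ aq] sc(2) by auto
      then show ?thesis using sc(1) s(2) qc by simp
    qed
    ultimately have "x \<in> N" using tf[OF x(1), of "s \<ominus> a \<otimes> q"] s(3) by simp
    with x(2) show False by contradiction
  qed
  have "colon R M N x = p"
  proof
    show "colon R M N x \<subseteq> p"
      unfolding colon_def using tf[OF x(1)] x(2) by blast
    show "p \<subseteq> colon R M N x"
      unfolding colon_def using kill p.Icarr by blast
  qed
  moreover have "U \<subseteq> N" using N by simp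
  moreover have "t \<in> carrier R" "t \<notin> p" using t(1) by simp_all
  ultimately show thesis using that[OF Ns _ x(1) _ _ _ t(2)] by blast
qed

section \<open>Prime avoidance and nonzerodivisors\<close>

lemma (in cring) prime_avoid_one:
  assumes "finite A" and J: "ideal J R" and p: "primeideal p R"
    and A: "\<And>q. q \<in> A \<Longrightarrow> ideal q R \<and> \<not> q \<subseteq> p" and "\<not> J \<subseteq> p"
  shows "\<exists>w \<in> J - p. \<forall>q \<in> A. w \<in> q"
  using assms(1) A
proof (induction rule: finite_induct)
  case empty
  then show ?case using assms(5) by blast
next
  case (insert q A)
  then obtain w where w: "w \<in> J - p" "\<forall>q \<in> A. w \<in> q" by blast
  obtain z where z: "z \<in> q" "z \<notin> p" using insert.prems by auto
  have c: "w \<in> carrier R" "z \<in> carrier R"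
    using w z ideal.Icarr[OF J] insert.prems ideal.Icarr by (metis DiffD1, metis insertI1)
  \<comment> \<open>A product of elements outside the prime \<open>p\<close> stays outside it, and
    it lies in every ideal that contains one of the factors.\<close>
  have "w \<otimes> z \<in> J - p"
    using w z c ideal.I_r_closed[OF J] primeideal.I_prime[OF p] by blast
  moreover have "w \<otimes> z \<in> q'" if "q' \<in> insert q A" for q'
  proof (cases "q' = q")
    case True
    then show ?thesis using ideal.I_l_closed[of q R z w] insert.prems z c by auto
  next
    case False
    then show ?thesis using ideal.I_r_closed[of q' R w z] insert.prems w c that by auto
  qed
  ultimately show ?case by blast
qed

text \<open>If the element \<open>x\<close> that avoids the earlier primes falls into the new prime
  \<open>p\<close>, it is corrected by an element of \<open>J\<close> that lies in all earlier
  primes but not in \<open>p\<close>. Incomparability provides such an element.\<close>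

lemma (in cring) prime_avoidance:
  assumes "finite A" and J: "ideal J R"
    and A: "\<And>p. p \<in> A \<Longrightarrow> primeideal p R \<and> \<not> J \<subseteq> p"
    and incomp: "\<And>p q. p \<in> A \<Longrightarrow> q \<in> A \<Longrightarrow> p \<subseteq> q \<Longrightarrow> p = q"
  shows "\<exists>x \<in> J. \<forall>p \<in> A. x \<notin> p"
  using assms(1) A incomp
proof (induction rule: finite_induct)
  case empty
  then show ?case using additive_subgroup.zero_closed[OF ideal.axioms(1)[OF J]] by blast
next
  case (insert p A)
  have "\<exists>x \<in> J. \<forall>q \<in> A. x \<notin> q"
    using insert.prems by (intro insert.IH) auto
  then obtain x where x: "x \<in> J" "\<forall>q \<in> A. x \<notin> q" by blast
  show ?case
  proof (cases "x \<in> p")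
    case True
    have pr: "primeideal p R" and "\<not> J \<subseteq> p" using insert.prems by auto
    moreover have "ideal q R \<and> \<not> q \<subseteq> p" if "q \<in> A" for q
      using that insert primeideal.axioms(1) by (metis insertCI)
    ultimately obtain w where w: "w \<in> J - p" "\<forall>q \<in> A. w \<in> q"
      using prime_avoid_one[OF insert(1) J pr] by blast
    have c: "x \<in> carrier R" "w \<in> carrier R" using x w ideal.Icarr[OF J] by auto
    have J': "x \<oplus> w \<in> J" using x w additive_subgroup.a_closed[OF ideal.axioms(1)[OF J]] by auto
    have canc: "a \<in> q" if "a \<oplus> b \<in> q" "b \<in> q" "a \<in> carrier R" "ideal q R" for a b q
    proof -
      interpret module R "self_module R" by (rule module_self_module)
      show ?thesis
        using submodule_add_cancel[of q b a] that by (simp add: ideal_iff_submodule)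
    qed
    have "x \<oplus> w \<notin> p"
      using canc[of w x p] True w c primeideal.axioms(1)[OF pr] a_comm by auto
    moreover have "x \<oplus> w \<notin> q" if "q \<in> A" for q
      using canc[of x w q] x w c that insert.prems primeideal.axioms(1) by (metis insertCI)
    ultimately show ?thesis using J' by auto
  qed (use x in auto)
qed

definition annih :: "('a, 'm) ring_scheme \<Rightarrow> 'a \<Rightarrow> 'a set" where
  "annih R s = {r \<in> carrier R. r \<otimes>\<^bsub>R\<^esub> s = \<zero>\<^bsub>R\<^esub>}"

text \<open>Distinct maximal annihilators are incomparable primes, and there are only finitely many of
  them: if \<open>A\<close> is a finite set of them with \<open>(0 : \<Inter>A)\<close> as large as possible, then \<open>\<Inter>A\<close> is contained
  in every maximal annihilator.\<close>

lemma (in cring) ex_regular_element: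
  assumes "noetherian_ring R" and J: "ideal J R"
    and avoid: "\<And>s. s \<in> carrier R \<Longrightarrow> primeideal (annih R s) R \<Longrightarrow> \<not> J \<subseteq> annih R s"
  obtains x where "x \<in> J" "\<And>r. r \<in> carrier R \<Longrightarrow> r \<otimes> x = \<zero> \<Longrightarrow> r = \<zero>"
proof -
  interpret R': noetherian_ring R by fact
  interpret S: module R "self_module R" by (rule module_self_module)
  have zero: "submodule {\<zero>} R (self_module R)"
    by (rule S.submoduleI') auto
  have annih: "annih R s = colon R (self_module R) {\<zero>} s" for s
    by (simp add: annih_def colon_def)
  have idl: "ideal (annih R s) R" if "s \<in> carrier R" for s
    unfolding annih using S.ideal_colon[OF zero] that by simp
  let ?A = "annih R ` {s \<in> carrier R. s \<noteq> \<zero>}"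
  define Mx where "Mx = {p \<in> ?A. \<forall>q \<in> ?A. p \<subseteq> q \<longrightarrow> q = p}"
  have prime: "primeideal p R" if pM: "p \<in> Mx" for p
  proof -
    obtain s where s: "s \<in> carrier R" "s \<noteq> \<zero>" "p = annih R s" and m: "\<forall>q \<in> ?A. p \<subseteq> q \<longrightarrow> q = p"
      using pM unfolding Mx_def by auto
    have "primeideal (annih R s) R"
    proof (rule primeidealI)
      show "carrier R \<noteq> annih R s" using s by (auto simp: annih_def dest!: equalityD1 subsetD[of _ _ \<one>])
      fix a b assume ab: "a \<in> carrier R" "b \<in> carrier R" "a \<otimes> b \<in> annih R s"
      show "a \<in> annih R s \<or> b \<in> annih R s"
      proof (rule disjCI)
        assume "b \<notin> annih R s"
        then have "b \<otimes> s \<noteq> \<zero>" using ab by (auto simp: annih_def)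
        \<comment> \<open>Passing from \<open>s\<close> to \<open>b \<otimes> s\<close> can only
          enlarge the annihilator, so maximality forces equality.\<close>
        then have "annih R (b \<otimes> s) \<in> ?A" using ab s by auto
        moreover have "annih R s \<subseteq> annih R (b \<otimes> s)"
          using ab s(1) by (auto simp: annih_def m_lcomm[of _ b s])
        ultimately have "annih R (b \<otimes> s) = annih R s" using m s(3) by auto
        moreover have "a \<in> annih R (b \<otimes> s)" using ab s by (auto simp: annih_def m_assoc)
        ultimately show "a \<in> annih R s" by simp
      qed
    qed (use s idl is_cring in auto)
    then show ?thesis using s by simp
  qed
  have below: "\<exists>p \<in> Mx. annih R s \<subseteq> p" if s: "s \<in> carrier R" "s \<noteq> \<zero>" for s
  proof -
    let ?F = "{q \<in> ?A. annih R s \<subseteq> q}"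
    have "annih R s \<in> ?F" using s by auto
    then obtain p where p: "p \<in> ?F" "\<And>q. q \<in> ?F \<Longrightarrow> p \<subseteq> q \<Longrightarrow> q = p"
      by (rule_tac R'.ex_maximal_ideal_in[of ?F]) (use idl in auto)
    have "p \<in> Mx" unfolding Mx_def
    proof (intro CollectI conjI ballI impI)
      fix q assume "q \<in> ?A" "p \<subseteq> q"
      then show "q = p" using p(1) by (intro p(2)) auto
    qed (use p in auto)
    then show ?thesis using p by auto
  qed
  \<comment> \<open>\<open>Z A\<close> is the annihilator of the intersection of the primes in
    \<open>A\<close>. It grows with \<open>A\<close>, starting at \<open>Z {}\<close>, the
    annihilator of \<open>R\<close>.\<close>
  define Z where "Z A = {r \<in> carrier R. \<forall>a \<in> carrier R. (\<forall>p \<in> A. a \<in> p) \<longrightarrow> r \<otimes> a = \<zero>}" for A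
  have Zid: "ideal (Z A) R" for A
  proof -
    have "submodule (Z A) R (self_module R)"
      by (rule S.submoduleI') (auto simp: Z_def l_distr m_assoc)
    then show ?thesis by (simp add: ideal_iff_submodule)
  qed
  let ?G = "Z ` {A. finite A \<and> A \<subseteq> Mx}"
  have "Z {} \<in> ?G" by auto
  then obtain K where K: "K \<in> ?G" "\<And>K'. K' \<in> ?G \<Longrightarrow> K \<subseteq> K' \<Longrightarrow> K' = K"
    by (rule_tac R'.ex_maximal_ideal_in[of ?G]) (use Zid in auto)
  then obtain A where A: "finite A" "A \<subseteq> Mx" "K = Z A" by auto
  have incomp: "p = q" if "p \<in> Mx" "q \<in> Mx" "p \<subseteq> q" for p q
    using that unfolding Mx_def by blast
  have all: "Mx \<subseteq> A"
  proof
    fix p assume p: "p \<in> Mx"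
    obtain s where s: "s \<in> carrier R" "p = annih R s" using p unfolding Mx_def by auto
    have "Z (insert p A) = Z A"
      unfolding A(3)[symmetric]
    proof (rule K(2))
      show "Z (insert p A) \<in> ?G" using A p by (intro imageI) auto
      show "K \<subseteq> Z (insert p A)" unfolding A(3) by (auto simp: Z_def)
    qed
    \<comment> \<open>\<open>s\<close> kills \<open>p\<close>, so by the stability of
      \<open>Z\<close> it kills the intersection over \<open>A\<close>, which therefore lies in
      \<open>annih R s = p\<close>.\<close>
    moreover have "s \<in> Z (insert p A)" using s by (auto simp: Z_def annih_def m_comm)
    ultimately have sZ: "s \<in> Z A" by simp
    have sub: "a \<in> p" if "a \<in> carrier R" "\<forall>q \<in> A. a \<in> q" for a
      using sZ that s by (auto simp: Z_def annih_def m_comm)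
    show "p \<in> A"
    \<comment> \<open>If \<open>p\<close> were not in \<open>A\<close>, incomparability would keep
      every prime of \<open>A\<close> from lying inside \<open>p\<close>, and then the intersection
      over \<open>A\<close> would have an element outside \<open>p\<close>.\<close>
    proof (rule ccontr)
      assume "p \<notin> A"
      then have "\<And>q. q \<in> A \<Longrightarrow> ideal q R \<and> \<not> q \<subseteq> p"
        using incomp p A(2) prime primeideal.axioms(1) by blast
      moreover have "\<not> carrier R \<subseteq> p"
        using primeideal.I_notcarr[OF prime[OF p]] ideal.Icarr[OF primeideal.axioms(1)[OF prime[OF p]]] by blast
      ultimately obtain w where "w \<in> carrier R - p" "\<forall>q \<in> A. w \<in> q"
        using prime_avoid_one[OF A(1) oneideal prime[OF p]] by blast
      then show False using sub by blast
    qed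
  qed
  then have "A = Mx" using A(2) by auto
  have "\<exists>x \<in> J. \<forall>p \<in> Mx. x \<notin> p"
  proof (rule prime_avoidance)
    show "finite Mx" using A \<open>A = Mx\<close> by simp
    fix p assume "p \<in> Mx"
    then show "primeideal p R \<and> \<not> J \<subseteq> p"
      using prime[of p] avoid unfolding Mx_def by auto
  qed (use J incomp in auto)
  then obtain x where x: "x \<in> J" "\<forall>p \<in> Mx. x \<notin> p" by blast
  have "r = \<zero>" if r: "r \<in> carrier R" "r \<otimes> x = \<zero>" for r
  proof (rule ccontr)
    assume "r \<noteq> \<zero>"
    then obtain p where "p \<in> Mx" "annih R r \<subseteq> p" using below r by blast
    moreover have "x \<in> annih R r" using r x ideal.Icarr[OF J] by (auto simp: annih_def m_comm)
    ultimately show False using x by auto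
  qed
  with x that show thesis by blast
qed

section \<open>Linear maps, dual modules and finite bases\<close>

text \<open>Unlike the elements of \<open>hom_module\<close>, these maps need not be extensional, so
  the functionals constructed below qualify without \<open>restrict\<close>.\<close>

definition linear_map ::
    "('a, 'm) ring_scheme \<Rightarrow> ('a, 'b, 'n) module_scheme \<Rightarrow> ('a, 'c, 'k) module_scheme
      \<Rightarrow> ('b \<Rightarrow> 'c) \<Rightarrow> bool" where
  "linear_map R M N h \<longleftrightarrow>
     h \<in> carrier M \<rightarrow> carrier N \<and>
     (\<forall>x \<in> carrier M. \<forall>y \<in> carrier M. h (x \<oplus>\<^bsub>M\<^esub> y) = h x \<oplus>\<^bsub>N\<^esub> h y) \<and>
     (\<forall>a \<in> carrier R. \<forall>x \<in> carrier M. h (a \<odot>\<^bsub>M\<^esub> x) = a \<odot>\<^bsub>N\<^esub> h x)"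

lemma linear_map_closed: "linear_map R M N h \<Longrightarrow> x \<in> carrier M \<Longrightarrow> h x \<in> carrier N"
  by (auto simp: linear_map_def)

lemma linear_map_add:
  "linear_map R M N h \<Longrightarrow> x \<in> carrier M \<Longrightarrow> y \<in> carrier M \<Longrightarrow> h (x \<oplus>\<^bsub>M\<^esub> y) = h x \<oplus>\<^bsub>N\<^esub> h y"
  by (auto simp: linear_map_def)

lemma linear_map_smult:
  "linear_map R M N h \<Longrightarrow> a \<in> carrier R \<Longrightarrow> x \<in> carrier M \<Longrightarrow> h (a \<odot>\<^bsub>M\<^esub> x) = a \<odot>\<^bsub>N\<^esub> h x"
  by (auto simp: linear_map_def)

lemma linear_map_zero:
  assumes "module R M" "module R N" "linear_map R M N h"
  shows "h \<zero>\<^bsub>M\<^esub> = \<zero>\<^bsub>N\<^esub>"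
proof -
  interpret M: module R M by fact
  interpret N: module R N by fact
  have "h (\<zero>\<^bsub>R\<^esub> \<odot>\<^bsub>M\<^esub> \<zero>\<^bsub>M\<^esub>) = \<zero>\<^bsub>R\<^esub> \<odot>\<^bsub>N\<^esub> h \<zero>\<^bsub>M\<^esub>"
    by (intro linear_map_smult[OF assms(3)]) auto
  then show ?thesis using linear_map_closed[OF assms(3), of "\<zero>\<^bsub>M\<^esub>"] by simp
qed

lemma linear_map_finsum:
  assumes "module R M" "module R N" "linear_map R M N h" "finite A" "f \<in> A \<rightarrow> carrier M"
  shows "h (\<Oplus>\<^bsub>M\<^esub> i \<in> A. f i) = (\<Oplus>\<^bsub>N\<^esub> i \<in> A. h (f i))"
proof -
  interpret M: module R M by fact
  interpret N: module R N by fact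
  show ?thesis
    using assms(4,5)
  proof (induction rule: finite_induct)
    case empty
    then show ?case using linear_map_zero[OF assms(1-3)] by simp
  next
    case (insert a A)
    then have "f a \<in> carrier M" "f \<in> A \<rightarrow> carrier M" by auto
    then show ?case
      using insert linear_map_add[OF assms(3)] linear_map_closed[OF assms(3)]
      by (simp add: Pi_iff)
  qed
qed

lemma submodule_image:
  assumes "module R M" "module R N" "linear_map R M N h" "submodule U R M"
  shows "submodule (h ` U) R N"
proof -
  interpret M: module R M by fact
  interpret N: module R N by fact
  note E = M.submoduleE[OF assms(4)]
  have c: "u \<in> carrier M" if "u \<in> U" for u using E(1) that by auto
  show ?thesis
  proof (rule N.submoduleI')
    show "h ` U \<subseteq> carrier N" using c linear_map_closed[OF assms(3)] by auto
    show "\<zero>\<^bsub>N\<^esub> \<in> h ` U"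
      using M.submodule_zero[OF assms(4)] linear_map_zero[OF assms(1-3)] by (metis imageI)
  next
    fix a b assume "a \<in> h ` U" "b \<in> h ` U"
    then obtain u v where "a = h u" "b = h v" "u \<in> U" "v \<in> U" by auto
    then show "a \<oplus>\<^bsub>N\<^esub> b \<in> h ` U"
      using E(5)[of u v] c linear_map_add[OF assms(3), of u v] by (metis imageI)
  next
    fix r a assume "r \<in> carrier R" "a \<in> h ` U"
    then obtain u where "a = h u" "u \<in> U" "r \<in> carrier R" by auto
    then show "r \<odot>\<^bsub>N\<^esub> a \<in> h ` U"
      using E(4)[of r u] c linear_map_smult[OF assms(3), of r u] by (metis imageI)
  qed
qed

lemma noetherian_module_inj:
  assumes "module R M" "module R N" "linear_map R M N h" "inj_on h (carrier M)"
    and "noetherian_module R N"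
  shows "noetherian_module R M"
  unfolding noetherian_module_def
proof (intro allI impI)
  interpret M: module R M by fact
  fix \<F> assume F: "\<F> \<noteq> {}" "\<forall>U \<in> \<F>. submodule U R M"
  have "(`) h ` \<F> \<noteq> {}" using F by auto
  then obtain V where V: "V \<in> (`) h ` \<F>" "\<And>W. W \<in> (`) h ` \<F> \<Longrightarrow> V \<subseteq> W \<Longrightarrow> W = V"
    by (rule_tac noetherian_moduleD[OF assms(5), of "(`) h ` \<F>"])
      (use F(2) submodule_image[OF assms(1-3)] in auto)
  then obtain U where U: "U \<in> \<F>" "V = h ` U" by auto
  have "U' = U" if U': "U' \<in> \<F>" "U \<subseteq> U'" for U'
  proof -
    have "h ` U' = h ` U" using V(2)[of "h ` U'"] U U' by auto
    moreover have "U \<subseteq> carrier M" "U' \<subseteq> carrier M"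
      using F(2) U U' M.submoduleE(1) by auto
    ultimately show ?thesis using inj_on_image_eq_iff[OF assms(4)] by metis
  qed
  then show "\<exists>U \<in> \<F>. \<forall>U' \<in> \<F>. U \<subseteq> U' \<longrightarrow> U' = U" using U(1) by auto
qed

text \<open>The direct product of copies of \<open>R\<close>, which for finite \<open>B\<close> is
  free on the unit vectors. Its index sets will be a set of generators of \<open>M\<close> and a
  basis of the dual.\<close>

definition fun_module :: "('a, 'm) ring_scheme \<Rightarrow> 'c set \<Rightarrow> ('a, 'c \<Rightarrow> 'a) module" where
  "fun_module R B =
     \<lparr>carrier = B \<rightarrow>\<^sub>E carrier R, monoid.mult = undefined, one = undefined,
      ring.zero = (\<lambda>b \<in> B. \<zero>\<^bsub>R\<^esub>),
      ring.add = (\<lambda>v w. \<lambda>b \<in> B. v b \<oplus>\<^bsub>R\<^esub> w b),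
      smult = (\<lambda>a v. \<lambda>b \<in> B. a \<otimes>\<^bsub>R\<^esub> v b)\<rparr>"

lemma fun_module_simps [simp]:
  "carrier (fun_module R B) = B \<rightarrow>\<^sub>E carrier R"
  "\<zero>\<^bsub>fun_module R B\<^esub> = (\<lambda>b \<in> B. \<zero>\<^bsub>R\<^esub>)"
  "v \<oplus>\<^bsub>fun_module R B\<^esub> w = (\<lambda>b \<in> B. v b \<oplus>\<^bsub>R\<^esub> w b)"
  "a \<odot>\<^bsub>fun_module R B\<^esub> v = (\<lambda>b \<in> B. a \<otimes>\<^bsub>R\<^esub> v b)"
  by (simp_all add: fun_module_def)

lemma (in cring) module_fun_module: "module R (fun_module R B)"
proof (rule moduleI)
  let ?F = "fun_module R B"
  have mem: "v b \<in> carrier R" if "v \<in> carrier ?F" "b \<in> B" for v b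
    using that by auto
  have ext: "v = w" if "v \<in> carrier ?F" "w \<in> carrier ?F" "\<And>b. b \<in> B \<Longrightarrow> v b = w b" for v w
    using that by (auto intro: PiE_ext)
  have add: "v \<oplus>\<^bsub>?F\<^esub> w \<in> carrier ?F" if "v \<in> carrier ?F" "w \<in> carrier ?F" for v w
    using that mem by simp
  have zero: "\<zero>\<^bsub>?F\<^esub> \<in> carrier ?F" by simp
  have sm: "a \<odot>\<^bsub>?F\<^esub> v \<in> carrier ?F" if "a \<in> carrier R" "v \<in> carrier ?F" for a v
    using that mem by simp
  show "abelian_group ?F"
  proof (rule abelian_groupI)
    fix v assume v: "v \<in> carrier ?F"
    have "(\<lambda>b \<in> B. \<ominus> v b) \<oplus>\<^bsub>?F\<^esub> v = \<zero>\<^bsub>?F\<^esub>"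
      using mem[OF v] by (auto simp: l_neg intro!: restrict_ext)
    moreover have "(\<lambda>b \<in> B. \<ominus> v b) \<in> carrier ?F" using mem[OF v] by simp
    ultimately show "\<exists>w \<in> carrier ?F. w \<oplus>\<^bsub>?F\<^esub> v = \<zero>\<^bsub>?F\<^esub>" by blast
    show "\<zero>\<^bsub>?F\<^esub> \<oplus>\<^bsub>?F\<^esub> v = v"
      by (rule ext[OF add[OF zero v] v]) (simp add: mem[OF v])
  next
    fix u v w assume H: "u \<in> carrier ?F" "v \<in> carrier ?F" "w \<in> carrier ?F"
    show "u \<oplus>\<^bsub>?F\<^esub> v \<oplus>\<^bsub>?F\<^esub> w = u \<oplus>\<^bsub>?F\<^esub> (v \<oplus>\<^bsub>?F\<^esub> w)"
      using H[THEN mem] by (auto simp: a_assoc intro!: restrict_ext)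
  next
    fix v w assume H: "v \<in> carrier ?F" "w \<in> carrier ?F"
    show "v \<oplus>\<^bsub>?F\<^esub> w = w \<oplus>\<^bsub>?F\<^esub> v"
      using H[THEN mem] by (auto simp: a_comm intro!: restrict_ext)
  qed (use add zero in auto)
  fix a v assume H: "a \<in> carrier R" "v \<in> carrier ?F"
  show "a \<odot>\<^bsub>?F\<^esub> v \<in> carrier ?F" by (rule sm[OF H])
  fix b w assume H': "b \<in> carrier R" "w \<in> carrier ?F"
  show "(a \<oplus> b) \<odot>\<^bsub>?F\<^esub> v = a \<odot>\<^bsub>?F\<^esub> v \<oplus>\<^bsub>?F\<^esub> b \<odot>\<^bsub>?F\<^esub> v"
    using H(1) H'(1) mem[OF H(2)] by (auto simp: l_distr intro!: restrict_ext)
  show "a \<odot>\<^bsub>?F\<^esub> (v \<oplus>\<^bsub>?F\<^esub> w) = a \<odot>\<^bsub>?F\<^esub> v \<oplus>\<^bsub>?F\<^esub> a \<odot>\<^bsub>?F\<^esub> w"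
    using H(1) mem[OF H(2)] mem[OF H'(2)] by (auto simp: r_distr intro!: restrict_ext)
  show "(a \<otimes> b) \<odot>\<^bsub>?F\<^esub> v = a \<odot>\<^bsub>?F\<^esub> (b \<odot>\<^bsub>?F\<^esub> v)"
    using H(1) H'(1) mem[OF H(2)] by (auto simp: m_assoc intro!: restrict_ext)
next
  let ?F = "fun_module R B"
  fix v assume v: "v \<in> carrier ?F"
  show "\<one> \<odot>\<^bsub>?F\<^esub> v = v"
  proof
    fix b show "(\<one> \<odot>\<^bsub>?F\<^esub> v) b = v b"
      using v by (cases "b \<in> B") (auto simp: PiE_def extensional_def Pi_iff)
  qed
qed (rule is_cring)

lemma (in cring) submodule_fun_module_units:
  assumes "finite B" and N: "submodule N R (fun_module R B)"
    and units: "\<And>b. b \<in> B \<Longrightarrow> (\<lambda>b' \<in> B. if b' = b then t else \<zero>) \<in> N"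
    and t: "t \<in> carrier R" and v: "v \<in> B \<rightarrow>\<^sub>E carrier R"
  shows "t \<odot>\<^bsub>fun_module R B\<^esub> v \<in> N"
proof -
  interpret F: module R "fun_module R B" by (rule module_fun_module)
  have vc: "v b \<in> carrier R" if "b \<in> B" for b using v that by (rule PiE_mem)
  have "(\<lambda>b \<in> B. if b \<in> A then t \<otimes> v b else \<zero>) \<in> N" if "A \<subseteq> B" for A
    using finite_subset[OF that assms(1)] that
  proof (induction A rule: finite_induct)
    case empty
    then show ?case using F.submodule_zero[OF N] by (simp add: restrict_def)
  next
    case (insert a A)
    have va: "v a \<in> carrier R" and aB: "a \<in> B" using insert.prems vc by auto
    let ?w = "\<lambda>b \<in> B. if b \<in> A then t \<otimes> v b else \<zero>"
    let ?u = "v a \<odot>\<^bsub>fun_module R B\<^esub> (\<lambda>b' \<in> B. if b' = a then t else \<zero>)"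
    have "?u \<oplus>\<^bsub>fun_module R B\<^esub> ?w \<in> N"
    proof (rule F.submoduleE(5)[OF N F.submoduleE(4)[OF N va units[OF aB]]])
      show "?w \<in> N" using insert.IH insert.prems by blast
    qed
    moreover have "?u \<oplus>\<^bsub>fun_module R B\<^esub> ?w = (\<lambda>b \<in> B. if b \<in> insert a A then t \<otimes> v b else \<zero>)"
    proof
      fix b
      show "(?u \<oplus>\<^bsub>fun_module R B\<^esub> ?w) b = (\<lambda>b \<in> B. if b \<in> insert a A then t \<otimes> v b else \<zero>) b"
        using insert(2) t va vc[of b] by (auto simp: m_comm)
    qed
    ultimately show ?case by (simp only:)
  qed
  then have "(\<lambda>b \<in> B. if b \<in> B then t \<otimes> v b else \<zero>) \<in> N" by blast
  moreover have "(\<lambda>b \<in> B. if b \<in> B then t \<otimes> v b else \<zero>) = t \<odot>\<^bsub>fun_module R B\<^esub> v"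
    by (auto intro!: restrict_ext)
  ultimately show ?thesis by (simp only:)
qed

lemma (in cring) finitely_generated_fun_module:
  assumes "finite B"
  shows "finitely_generated_module R (fun_module R B)"
  unfolding finitely_generated_module_def
proof (intro exI conjI)
  interpret F: module R "fun_module R B" by (rule module_fun_module)
  let ?X = "(\<lambda>b. \<lambda>b' \<in> B. if b' = b then \<one> else \<zero>) ` B"
  show "finite ?X" using assms by simp
  show X: "?X \<subseteq> carrier (fun_module R B)" by auto
  note S = F.submodule_submodule_span[OF X]
  show "submodule_span R (fun_module R B) ?X = carrier (fun_module R B)"
  proof
    show "submodule_span R (fun_module R B) ?X \<subseteq> carrier (fun_module R B)"
      by (rule F.submoduleE(1)[OF S])
    show "carrier (fun_module R B) \<subseteq> submodule_span R (fun_module R B) ?X"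
    proof
      fix v assume v: "v \<in> carrier (fun_module R B)"
      have "\<one> \<odot>\<^bsub>fun_module R B\<^esub> v \<in> submodule_span R (fun_module R B) ?X"
        using v F.subset_submodule_span[OF X]
        by (intro submodule_fun_module_units[OF assms S]) auto
      then show "v \<in> submodule_span R (fun_module R B) ?X" using F.smult_one[OF v] by simp
    qed
  qed
qed

section \<open>Dual modules\<close>

lemma carrier_dual_module:
  "f \<in> carrier (dual_module R M) \<longleftrightarrow>
     f \<in> extensional (carrier M) \<and> linear_map R M (self_module R) f"
  by (auto simp: dual_module_def hom_module_def linear_map_def PiE_def)

lemma dual_module_simps [simp]:
  "\<zero>\<^bsub>dual_module R M\<^esub> = (\<lambda>x \<in> carrier M. \<zero>\<^bsub>R\<^esub>)"
  "f \<oplus>\<^bsub>dual_module R M\<^esub> g = (\<lambda>x \<in> carrier M. f x \<oplus>\<^bsub>R\<^esub> g x)"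
  "a \<odot>\<^bsub>dual_module R M\<^esub> f = (\<lambda>x \<in> carrier M. a \<otimes>\<^bsub>R\<^esub> f x)"
  by (simp_all add: dual_module_def hom_module_def)

lemma linear_functionalD:
  assumes "linear_map R M (self_module R) f"
  shows "x \<in> carrier M \<Longrightarrow> f x \<in> carrier R"
    "x \<in> carrier M \<Longrightarrow> y \<in> carrier M \<Longrightarrow> f (x \<oplus>\<^bsub>M\<^esub> y) = f x \<oplus>\<^bsub>R\<^esub> f y"
    "a \<in> carrier R \<Longrightarrow> x \<in> carrier M \<Longrightarrow> f (a \<odot>\<^bsub>M\<^esub> x) = a \<otimes>\<^bsub>R\<^esub> f x"
  using assms by (auto simp: linear_map_def)

lemma (in module) restrict_in_dual_module:
  assumes "\<And>x. x \<in> carrier M \<Longrightarrow> f x \<in> carrier R"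
    "\<And>x y. x \<in> carrier M \<Longrightarrow> y \<in> carrier M \<Longrightarrow> f (x \<oplus>\<^bsub>M\<^esub> y) = f x \<oplus> f y"
    "\<And>a x. a \<in> carrier R \<Longrightarrow> x \<in> carrier M \<Longrightarrow> f (a \<odot>\<^bsub>M\<^esub> x) = a \<otimes> f x"
  shows "(\<lambda>x \<in> carrier M. f x) \<in> carrier (dual_module R M)"
  unfolding carrier_dual_module linear_map_def by (auto simp: assms)

lemma (in module) module_dual_module: "module R (dual_module R M)"
proof (rule moduleI)
  let ?D = "dual_module R M"
  note fD = linear_functionalD
  have ext: "f = g" if "f \<in> carrier ?D" "g \<in> carrier ?D" "\<And>x. x \<in> carrier M \<Longrightarrow> f x = g x" for f g
    using that unfolding carrier_dual_module by (metis extensionalityI)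
  have lin: "linear_map R M (self_module R) f" if "f \<in> carrier ?D" for f
    using that unfolding carrier_dual_module by simp
  note c = fD(1)[OF lin]
  have add: "f \<oplus>\<^bsub>?D\<^esub> g \<in> carrier ?D" if "f \<in> carrier ?D" "g \<in> carrier ?D" for f g
    unfolding dual_module_simps
    by (rule restrict_in_dual_module)
      (use that in \<open>simp_all add: c fD(2,3)[OF lin] R.a_ac R.r_distr\<close>)
  have sm: "a \<odot>\<^bsub>?D\<^esub> f \<in> carrier ?D" if "a \<in> carrier R" "f \<in> carrier ?D" for a f
    unfolding dual_module_simps
    by (rule restrict_in_dual_module)
      (use that in \<open>simp_all add: c fD(2,3)[OF lin] R.m_ac R.r_distr\<close>)
  have z: "\<zero>\<^bsub>?D\<^esub> \<in> carrier ?D"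
    unfolding dual_module_simps by (rule restrict_in_dual_module) auto
  show "abelian_group ?D"
  proof (rule abelian_groupI)
    fix f g h assume H: "f \<in> carrier ?D" "g \<in> carrier ?D" "h \<in> carrier ?D"
    show "f \<oplus>\<^bsub>?D\<^esub> g \<oplus>\<^bsub>?D\<^esub> h = f \<oplus>\<^bsub>?D\<^esub> (g \<oplus>\<^bsub>?D\<^esub> h)"
      by (rule ext) (use H add in \<open>auto simp: c R.a_ac simp del: dual_module_simps\<close>,
        simp add: c R.a_ac)
  next
    fix f g assume H: "f \<in> carrier ?D" "g \<in> carrier ?D"
    show "f \<oplus>\<^bsub>?D\<^esub> g = g \<oplus>\<^bsub>?D\<^esub> f"
      using H by (auto simp: c R.a_comm intro!: restrict_ext)
  next
    fix f assume H: "f \<in> carrier ?D"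
    show "\<zero>\<^bsub>?D\<^esub> \<oplus>\<^bsub>?D\<^esub> f = f"
      by (rule ext[OF add[OF z H] H]) (simp add: c H)
    have "(\<ominus> \<one>) \<odot>\<^bsub>?D\<^esub> f \<oplus>\<^bsub>?D\<^esub> f = \<zero>\<^bsub>?D\<^esub>"
      by (auto simp: c[OF H] R.l_minus R.l_neg intro!: restrict_ext)
    then show "\<exists>g \<in> carrier ?D. g \<oplus>\<^bsub>?D\<^esub> f = \<zero>\<^bsub>?D\<^esub>"
      using sm[OF _ H, of "\<ominus> \<one>"] by blast
  qed (use add z in auto)
  fix a f assume H: "a \<in> carrier R" "f \<in> carrier ?D"
  show "a \<odot>\<^bsub>?D\<^esub> f \<in> carrier ?D" by (rule sm[OF H])
  fix b g assume H': "b \<in> carrier R" "g \<in> carrier ?D"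
  show "(a \<oplus> b) \<odot>\<^bsub>?D\<^esub> f = a \<odot>\<^bsub>?D\<^esub> f \<oplus>\<^bsub>?D\<^esub> b \<odot>\<^bsub>?D\<^esub> f"
    using H(1) H'(1) c[OF H(2)] by (auto simp: R.l_distr intro!: restrict_ext)
  show "a \<odot>\<^bsub>?D\<^esub> (f \<oplus>\<^bsub>?D\<^esub> g) = a \<odot>\<^bsub>?D\<^esub> f \<oplus>\<^bsub>?D\<^esub> a \<odot>\<^bsub>?D\<^esub> g"
    using H(1) c[OF H(2)] c[OF H'(2)] by (auto simp: R.r_distr intro!: restrict_ext)
  show "(a \<otimes> b) \<odot>\<^bsub>?D\<^esub> f = a \<odot>\<^bsub>?D\<^esub> (b \<odot>\<^bsub>?D\<^esub> f)"
    using H(1) H'(1) c[OF H(2)] by (auto simp: R.m_assoc intro!: restrict_ext)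
next
  let ?D = "dual_module R M"
  fix f assume f: "f \<in> carrier ?D"
  show "\<one> \<odot>\<^bsub>?D\<^esub> f = f"
  proof
    fix x show "(\<one> \<odot>\<^bsub>?D\<^esub> f) x = f x"
      using f by (cases "x \<in> carrier M")
        (auto simp: carrier_dual_module extensional_def linear_functionalD(1))
  qed
qed (rule R.is_cring)

text \<open>A functional is determined by its values on the finite generating set \<open>X\<close>,
  so the dual embeds into \<open>R^X\<close>. This later forces a basis of the dual to be
  finite.\<close>

lemma (in module) noetherian_dual_module:
  assumes "noetherian_ring R" "finitely_generated_module R M"
  shows "noetherian_module R (dual_module R M)"
proof -
  obtain X where X: "finite X" "X \<subseteq> carrier M" "submodule_span R M X = carrier M"
    using assms(2) unfolding finitely_generated_module_def by blast
  interpret F: module R "fun_module R X" by (rule R.module_fun_module)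
  let ?D = "dual_module R M" and ?h = "\<lambda>f. restrict f X"
  have lin: "linear_map R M (self_module R) f" if "f \<in> carrier ?D" for f
    using that unfolding carrier_dual_module by simp
  have xc: "x \<in> carrier M" if "x \<in> X" for x using X that by auto
  have "linear_map R ?D (fun_module R X) ?h"
    unfolding linear_map_def
    by (auto simp: xc linear_functionalD(1)[OF lin] intro!: restrict_ext)
  moreover have "inj_on ?h (carrier ?D)"
  proof (rule inj_onI)
    fix f g assume fg: "f \<in> carrier ?D" "g \<in> carrier ?D" "?h f = ?h g"
    have "submodule {x \<in> carrier M. f x = g x} R M"
      by (rule submoduleI')
        (use fg in \<open>auto simp: linear_functionalD[OF lin] linear_map_zero[OF module_axioms R.module_self_module lin, simplified]\<close>)
    moreover have "X \<subseteq> {x \<in> carrier M. f x = g x}"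
      using fg(3) xc by (auto simp: fun_eq_iff restrict_def split: if_splits)
    ultimately have "carrier M \<subseteq> {x \<in> carrier M. f x = g x}"
      using submodule_span_least X(3) by blast
    then show "f = g"
      using fg(1,2) unfolding carrier_dual_module by (auto intro: extensionalityI)
  qed
  ultimately show ?thesis
    using noetherian_module_inj[OF module_dual_module R.module_fun_module]
      F.noetherian_moduleI[OF assms(1) R.finitely_generated_fun_module[OF X(1)]]
    by blast
qed

section \<open>Bases of noetherian modules are finite\<close>

lemma (in module) finsum_support:
  assumes "finite A" "c \<in> A \<rightarrow> carrier R" "A \<subseteq> carrier M"
  shows "(\<Oplus>\<^bsub>M\<^esub> b \<in> {b \<in> A. c b \<noteq> \<zero>}. c b \<odot>\<^bsub>M\<^esub> b) = (\<Oplus>\<^bsub>M\<^esub> b \<in> A. c b \<odot>\<^bsub>M\<^esub> b)"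
  using assms by (intro M.add.finprod_mono_neutral_cong_left) auto

lemma (in module) module_basis_finite_iff:
  assumes "finite B" "B \<subseteq> carrier M"
  shows "module_basis R M B \<longleftrightarrow>
    (\<forall>x \<in> carrier M. \<exists>!c. c \<in> B \<rightarrow>\<^sub>E carrier R \<and> x = (\<Oplus>\<^bsub>M\<^esub> b \<in> B. c b \<odot>\<^bsub>M\<^esub> b))"
proof -
  have "c \<in> B \<rightarrow>\<^sub>E carrier R \<and> finite {b \<in> B. c b \<noteq> \<zero>} \<and>
        x = (\<Oplus>\<^bsub>M\<^esub> b \<in> {b \<in> B. c b \<noteq> \<zero>}. c b \<odot>\<^bsub>M\<^esub> b) \<longleftrightarrow>
      c \<in> B \<rightarrow>\<^sub>E carrier R \<and> x = (\<Oplus>\<^bsub>M\<^esub> b \<in> B. c b \<odot>\<^bsub>M\<^esub> b)" for c x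
    using finsum_support[OF assms(1) _ assms(2), of c] assms(1) by (auto simp: PiE_def)
  then show ?thesis using assms(2) unfolding module_basis_def by simp
qed

text \<open>The spans \<open>L A\<close> of finite subsets \<open>A\<close> of \<open>B\<close> have
  a maximal member. A basis element outside such an \<open>A\<close> would already lie in the span
  and so have two coefficient families.\<close>

lemma (in module) finite_module_basis:
  assumes noeth: "noetherian_module R M" and B: "module_basis R M B" and one: "\<one> \<noteq> \<zero>"
  shows "finite B"
proof -
  have Bc: "b \<in> carrier M" if "b \<in> B" for b using B that by (auto simp: module_basis_def)
  define L where "L A = {(\<Oplus>\<^bsub>M\<^esub> a \<in> A. c a \<odot>\<^bsub>M\<^esub> a) | c. c \<in> A \<rightarrow> carrier R}" for A
  have Lsub: "submodule (L A) R M" if A: "finite A" "A \<subseteq> B" for A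
  proof (rule submoduleI')
    have Ac: "a \<in> carrier M" if "a \<in> A" for a using that A Bc by auto
    show "L A \<subseteq> carrier M" using Ac by (auto simp: L_def intro!: M.finsum_closed)
    have "(\<Oplus>\<^bsub>M\<^esub> a \<in> A. \<zero> \<odot>\<^bsub>M\<^esub> a) = \<zero>\<^bsub>M\<^esub>"
      using Ac by (simp add: M.add.finprod_one_eqI)
    then show "\<zero>\<^bsub>M\<^esub> \<in> L A" unfolding L_def by (auto intro!: exI[of _ "\<lambda>_. \<zero>"])
  next
    fix u v assume "u \<in> L A" "v \<in> L A"
    then obtain c d where cd: "u = (\<Oplus>\<^bsub>M\<^esub> a \<in> A. c a \<odot>\<^bsub>M\<^esub> a)" "v = (\<Oplus>\<^bsub>M\<^esub> a \<in> A. d a \<odot>\<^bsub>M\<^esub> a)"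
      "c \<in> A \<rightarrow> carrier R" "d \<in> A \<rightarrow> carrier R" unfolding L_def by auto
    have Ac: "a \<in> carrier M" if "a \<in> A" for a using that A Bc by auto
    have "u \<oplus>\<^bsub>M\<^esub> v = (\<Oplus>\<^bsub>M\<^esub> a \<in> A. c a \<odot>\<^bsub>M\<^esub> a \<oplus>\<^bsub>M\<^esub> d a \<odot>\<^bsub>M\<^esub> a)"
      using cd Ac by (simp add: M.finsum_addf Pi_iff)
    also have "\<dots> = (\<Oplus>\<^bsub>M\<^esub> a \<in> A. (c a \<oplus> d a) \<odot>\<^bsub>M\<^esub> a)"
      using cd Ac by (intro M.finsum_cong') (auto simp: smult_l_distr Pi_iff)
    finally show "u \<oplus>\<^bsub>M\<^esub> v \<in> L A" unfolding L_def using cd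
      by (intro CollectI exI[of _ "\<lambda>a. c a \<oplus> d a"]) auto
  next
    fix r u assume r: "r \<in> carrier R" and "u \<in> L A"
    then obtain c where cd: "u = (\<Oplus>\<^bsub>M\<^esub> a \<in> A. c a \<odot>\<^bsub>M\<^esub> a)"
      "c \<in> A \<rightarrow> carrier R" unfolding L_def by auto
    have Ac: "a \<in> carrier M" if "a \<in> A" for a using that A Bc by auto
    have "r \<odot>\<^bsub>M\<^esub> u = (\<Oplus>\<^bsub>M\<^esub> a \<in> A. r \<odot>\<^bsub>M\<^esub> (c a \<odot>\<^bsub>M\<^esub> a))"
      using cd Ac r A by (simp add: finsum_smult_ldistr Pi_iff)
    also have "\<dots> = (\<Oplus>\<^bsub>M\<^esub> a \<in> A. (r \<otimes> c a) \<odot>\<^bsub>M\<^esub> a)"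
      using cd Ac r by (intro M.finsum_cong') (auto simp: smult_assoc1 Pi_iff)
    finally show "r \<odot>\<^bsub>M\<^esub> u \<in> L A" unfolding L_def using cd r
      by (intro CollectI exI[of _ "\<lambda>a. r \<otimes> c a"]) auto
  qed
  let ?F = "L ` {A. finite A \<and> A \<subseteq> B}"
  have "L {} \<in> ?F" by auto
  then obtain N where N: "N \<in> ?F" "\<And>N'. N' \<in> ?F \<Longrightarrow> N \<subseteq> N' \<Longrightarrow> N' = N"
    by (rule_tac noetherian_moduleD[OF noeth, of ?F]) (use Lsub in auto)
  then obtain A where A: "finite A" "A \<subseteq> B" "N = L A" by auto
  have "b \<in> A" if b: "b \<in> B" for b
  proof (rule ccontr)
    assume nb: "b \<notin> A"
    have Ac: "a \<in> carrier M" if "a \<in> A" for a using that A Bc by auto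
    have ins: "(\<Oplus>\<^bsub>M\<^esub> a \<in> insert b A. (c(b := r)) a \<odot>\<^bsub>M\<^esub> a) = r \<odot>\<^bsub>M\<^esub> b \<oplus>\<^bsub>M\<^esub> (\<Oplus>\<^bsub>M\<^esub> a \<in> A. c a \<odot>\<^bsub>M\<^esub> a)"
      if "c \<in> A \<rightarrow> carrier R" "r \<in> carrier R" for c r
    proof -
      have "(\<Oplus>\<^bsub>M\<^esub> a \<in> insert b A. (c(b := r)) a \<odot>\<^bsub>M\<^esub> a)
          = r \<odot>\<^bsub>M\<^esub> b \<oplus>\<^bsub>M\<^esub> (\<Oplus>\<^bsub>M\<^esub> a \<in> A. (c(b := r)) a \<odot>\<^bsub>M\<^esub> a)"
        using that A nb Ac Bc[OF b] by (subst M.finsum_insert) (auto simp: Pi_iff)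
      moreover have "(\<Oplus>\<^bsub>M\<^esub> a \<in> A. (c(b := r)) a \<odot>\<^bsub>M\<^esub> a) = (\<Oplus>\<^bsub>M\<^esub> a \<in> A. c a \<odot>\<^bsub>M\<^esub> a)"
        using that nb Ac by (intro M.finsum_cong') (auto simp: Pi_iff)
      ultimately show ?thesis by simp
    qed
    have "L A \<subseteq> L (insert b A)"
    proof
      fix u assume "u \<in> L A"
      then obtain c where c: "u = (\<Oplus>\<^bsub>M\<^esub> a \<in> A. c a \<odot>\<^bsub>M\<^esub> a)" "c \<in> A \<rightarrow> carrier R"
        unfolding L_def by auto
      then have "u = (\<Oplus>\<^bsub>M\<^esub> a \<in> insert b A. (c(b := \<zero>)) a \<odot>\<^bsub>M\<^esub> a)"
        using ins[OF c(2), of \<zero>] Ac Bc[OF b] by (simp add: Pi_iff)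
      then show "u \<in> L (insert b A)" unfolding L_def using c(2)
        by (intro CollectI exI[of _ "c(b := \<zero>)"]) auto
    qed
    moreover have "L (insert b A) \<in> ?F" using A b by auto
    ultimately have eq: "L (insert b A) = L A" using N(2) A(3) by auto
    have "b = (\<Oplus>\<^bsub>M\<^esub> a \<in> insert b A. ((\<lambda>_. \<zero>)(b := \<one>)) a \<odot>\<^bsub>M\<^esub> a)"
      using ins[of "\<lambda>_. \<zero>" \<one>] Ac Bc[OF b] by (simp add: M.add.finprod_one_eqI)
    then have "b \<in> L (insert b A)" unfolding L_def
      by (intro CollectI exI[of _ "(\<lambda>_. \<zero>)(b := \<one>)"]) auto
    then obtain c where c: "b = (\<Oplus>\<^bsub>M\<^esub> a \<in> A. c a \<odot>\<^bsub>M\<^esub> a)" "c \<in> A \<rightarrow> carrier R"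
      unfolding eq unfolding L_def by auto
    \<comment> \<open>\<open>c1\<close> represents \<open>b\<close> by itself and \<open>c2\<close>
      represents it by elements of \<open>A\<close>; at \<open>b\<close> their values are
      \<open>\<one>\<close> and \<open>\<zero>\<close>.\<close>
    define c1 where "c1 = (\<lambda>x \<in> B. if x = b then \<one> else \<zero>)"
    define c2 where "c2 = (\<lambda>x \<in> B. if x \<in> A then c x else \<zero>)"
    have ex1: "\<exists>!c. c \<in> B \<rightarrow>\<^sub>E carrier R \<and> finite {b \<in> B. c b \<noteq> \<zero>} \<and>
        b = (\<Oplus>\<^bsub>M\<^esub> b \<in> {b \<in> B. c b \<noteq> \<zero>}. c b \<odot>\<^bsub>M\<^esub> b)"
      using B Bc[OF b] unfolding module_basis_def by blast
    have s1: "{x \<in> B. c1 x \<noteq> \<zero>} = {b}" using one b by (auto simp: c1_def)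
    have r1: "c1 \<in> B \<rightarrow>\<^sub>E carrier R \<and> finite {b \<in> B. c1 b \<noteq> \<zero>} \<and>
        b = (\<Oplus>\<^bsub>M\<^esub> b \<in> {b \<in> B. c1 b \<noteq> \<zero>}. c1 b \<odot>\<^bsub>M\<^esub> b)"
      unfolding s1 using b Bc[OF b] by (auto simp: c1_def)
    have s2: "{x \<in> B. c2 x \<noteq> \<zero>} = {x \<in> A. c x \<noteq> \<zero>}" using A(2) by (auto simp: c2_def)
    have "(\<Oplus>\<^bsub>M\<^esub> b \<in> {b \<in> A. c b \<noteq> \<zero>}. c2 b \<odot>\<^bsub>M\<^esub> b) = (\<Oplus>\<^bsub>M\<^esub> b \<in> {b \<in> A. c b \<noteq> \<zero>}. c b \<odot>\<^bsub>M\<^esub> b)"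
      using A(2) c(2) Ac by (intro M.finsum_cong') (auto simp: c2_def)
    also have "\<dots> = b" using finsum_support[OF A(1) c(2)] Ac c(1) by auto
    finally have r2: "c2 \<in> B \<rightarrow>\<^sub>E carrier R \<and> finite {b \<in> B. c2 b \<noteq> \<zero>} \<and>
        b = (\<Oplus>\<^bsub>M\<^esub> b \<in> {b \<in> B. c2 b \<noteq> \<zero>}. c2 b \<odot>\<^bsub>M\<^esub> b)"
      unfolding s2 using A c(2) by (auto simp: c2_def)
    have "c1 = c2" using ex1 r1 r2 by blast
    then have "c1 b = c2 b" by simp
    then show False using one b nb by (simp add: c1_def c2_def)
  qed
  then show ?thesis using A(1) by (meson finite_subset subsetI)
qed

section \<open>Localization\<close>

locale localization = module R M for R (structure) and M (structure) +
  fixes S :: "'a set"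
  assumes S_subset: "S \<subseteq> carrier R" and S_one: "\<one>\<^bsub>R\<^esub> \<in> S"
    and S_mult: "s \<in> S \<Longrightarrow> t \<in> S \<Longrightarrow> s \<otimes>\<^bsub>R\<^esub> t \<in> S"
begin

lemma S_carrier: "s \<in> S \<Longrightarrow> s \<in> carrier R"
  using S_subset by auto

lemma equiv_frac_rel: "equiv (carrier M \<times> S) (frac_rel S M)"
proof (rule equivI)
  show "frac_rel S M \<subseteq> (carrier M \<times> S) \<times> (carrier M \<times> S)"
    by (auto simp: frac_rel_def)
  show "refl_on (carrier M \<times> S) (frac_rel S M)"
    by (rule refl_onI) (use S_one in \<open>auto simp: frac_rel_def\<close>)
  show "sym (frac_rel S M)"
    by (rule symI) (auto simp: frac_rel_def intro: sym)
  show "trans (frac_rel S M)"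
  proof (rule transI)
    fix x y z assume xy: "(x, y) \<in> frac_rel S M" and yz: "(y, z) \<in> frac_rel S M"
    obtain m s n t k w where eq: "x = (m, s)" "y = (n, t)" "z = (k, w)" by (metis surj_pair)
    obtain u where u: "u \<in> S" "u \<odot>\<^bsub>M\<^esub> (t \<odot>\<^bsub>M\<^esub> m) = u \<odot>\<^bsub>M\<^esub> (s \<odot>\<^bsub>M\<^esub> n)"
      using xy unfolding eq frac_rel_def by auto
    obtain v where v: "v \<in> S" "v \<odot>\<^bsub>M\<^esub> (w \<odot>\<^bsub>M\<^esub> n) = v \<odot>\<^bsub>M\<^esub> (t \<odot>\<^bsub>M\<^esub> k)"
      using yz unfolding eq frac_rel_def by auto
    have c: "m \<in> carrier M" "s \<in> S" "n \<in> carrier M" "t \<in> S" "k \<in> carrier M" "w \<in> S"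
      using xy yz unfolding eq frac_rel_def by auto
    note cS = c(2,4,6)[THEN S_carrier] u(1)[THEN S_carrier] v(1)[THEN S_carrier]
    note norm = smult_assoc1[symmetric] R.m_ac
    \<comment> \<open>The middle denominator \<open>t\<close> has to be cleared too, so it joins
      \<open>u\<close> and \<open>v\<close> in the witness.\<close>
    have "(u \<otimes>\<^bsub>R\<^esub> v \<otimes>\<^bsub>R\<^esub> t) \<odot>\<^bsub>M\<^esub> (w \<odot>\<^bsub>M\<^esub> m) = (v \<otimes>\<^bsub>R\<^esub> w) \<odot>\<^bsub>M\<^esub> (u \<odot>\<^bsub>M\<^esub> (t \<odot>\<^bsub>M\<^esub> m))"
      using c cS by (simp add: norm)
    also have "\<dots> = (u \<otimes>\<^bsub>R\<^esub> s) \<odot>\<^bsub>M\<^esub> (v \<odot>\<^bsub>M\<^esub> (w \<odot>\<^bsub>M\<^esub> n))"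
      unfolding u(2) using c cS by (simp add: norm)
    also have "\<dots> = (u \<otimes>\<^bsub>R\<^esub> v \<otimes>\<^bsub>R\<^esub> t) \<odot>\<^bsub>M\<^esub> (s \<odot>\<^bsub>M\<^esub> k)"
      unfolding v(2) using c cS by (simp add: norm)
    finally show "(x, z) \<in> frac_rel S M"
      using c S_mult u(1) v(1) unfolding eq frac_rel_def by blast
  qed
qed

abbreviation frac :: "'c \<Rightarrow> 'a \<Rightarrow> ('c \<times> 'a) set" where
  "frac m s \<equiv> loc_frac S M m s"

abbreviation rfrac :: "'a \<Rightarrow> 'a \<Rightarrow> ('a \<times> 'a) set" where
  "rfrac a s \<equiv> loc_frac S (self_module R) a s"

lemma mem_frac_iff:
  assumes "m \<in> carrier M" "s \<in> S"
  shows "(n, t) \<in> frac m s \<longleftrightarrow>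
    n \<in> carrier M \<and> t \<in> S \<and> (\<exists>u \<in> S. u \<odot>\<^bsub>M\<^esub> (t \<odot>\<^bsub>M\<^esub> m) = u \<odot>\<^bsub>M\<^esub> (s \<odot>\<^bsub>M\<^esub> n))"
  using assms by (auto simp: loc_frac_def frac_rel_def)

lemma frac_eq_iff:
  assumes "m \<in> carrier M" "s \<in> S" "n \<in> carrier M" "t \<in> S"
  shows "frac m s = frac n t \<longleftrightarrow> (\<exists>u \<in> S. u \<odot>\<^bsub>M\<^esub> (t \<odot>\<^bsub>M\<^esub> m) = u \<odot>\<^bsub>M\<^esub> (s \<odot>\<^bsub>M\<^esub> n))"
  using eq_equiv_class_iff[OF equiv_frac_rel, of "(m, s)" "(n, t)"] assms
  by (auto simp: loc_frac_def frac_rel_def)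

lemma frac_eqI:
  assumes "m \<in> carrier M" "s \<in> S" "n \<in> carrier M" "t \<in> S" "t \<odot>\<^bsub>M\<^esub> m = s \<odot>\<^bsub>M\<^esub> n"
  shows "frac m s = frac n t"
  using assms S_one by (subst frac_eq_iff) auto

lemma frac_closed [simp, intro]:
  "m \<in> carrier M \<Longrightarrow> s \<in> S \<Longrightarrow> frac m s \<in> carrier (loc_module R S M)"
  by (auto simp: loc_module_def loc_frac_def intro: quotientI)

lemma fracE:
  assumes "X \<in> carrier (loc_module R S M)"
  obtains m s where "m \<in> carrier M" "s \<in> S" "X = frac m s"
  using assms by (auto simp: loc_module_def loc_frac_def elim!: quotientE)

lemma zero_loc_module: "\<zero>\<^bsub>loc_module R S M\<^esub> = frac \<zero>\<^bsub>M\<^esub> \<one>\<^bsub>R\<^esub>"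
  by (simp add: loc_module_def)

lemma frac_self_mem: "m \<in> carrier M \<Longrightarrow> s \<in> S \<Longrightarrow> (m, s) \<in> frac m s"
  using S_one by (auto simp: mem_frac_iff)

text \<open>The operations on fractions are unions over all representatives. Once the result does
  not depend on the representative, the union collapses to it, since a class contains its own
  representative and is not empty.\<close>

lemma UN_frac_const:
  assumes "m \<in> carrier M" "s \<in> S" "\<And>n t. (n, t) \<in> frac m s \<Longrightarrow> F n t = C"
  shows "(\<Union>(n, t) \<in> frac m s. F n t) = C"
  using assms(3) frac_self_mem[OF assms(1,2)] by fastforce

lemma add_frac:
  assumes "m \<in> carrier M" "s \<in> S" "n \<in> carrier M" "t \<in> S"
  shows "frac m s \<oplus>\<^bsub>loc_module R S M\<^esub> frac n t = frac (t \<odot>\<^bsub>M\<^esub> m \<oplus>\<^bsub>M\<^esub> s \<odot>\<^bsub>M\<^esub> n) (s \<otimes>\<^bsub>R\<^esub> t)"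
proof -
  have "frac (t' \<odot>\<^bsub>M\<^esub> m' \<oplus>\<^bsub>M\<^esub> s' \<odot>\<^bsub>M\<^esub> n') (s' \<otimes>\<^bsub>R\<^esub> t') = frac (t \<odot>\<^bsub>M\<^esub> m \<oplus>\<^bsub>M\<^esub> s \<odot>\<^bsub>M\<^esub> n) (s \<otimes>\<^bsub>R\<^esub> t)"
    if H: "(m', s') \<in> frac m s" "(n', t') \<in> frac n t" for m' s' n' t'
  proof -
    have c: "m' \<in> carrier M" "s' \<in> S" "n' \<in> carrier M" "t' \<in> S"
      using H assms by (auto simp: mem_frac_iff)
    obtain u where u: "u \<in> S" "u \<odot>\<^bsub>M\<^esub> (s' \<odot>\<^bsub>M\<^esub> m) = u \<odot>\<^bsub>M\<^esub> (s \<odot>\<^bsub>M\<^esub> m')"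
      using H(1) assms by (auto simp: mem_frac_iff)
    obtain v where v: "v \<in> S" "v \<odot>\<^bsub>M\<^esub> (t' \<odot>\<^bsub>M\<^esub> n) = v \<odot>\<^bsub>M\<^esub> (t \<odot>\<^bsub>M\<^esub> n')"
      using H(2) assms by (auto simp: mem_frac_iff)
    note cS = assms(2,4)[THEN S_carrier] c(2,4)[THEN S_carrier] u(1)[THEN S_carrier] v(1)[THEN S_carrier]
    note norm = smult_r_distr smult_assoc1[symmetric] R.m_ac
    have "(u \<otimes>\<^bsub>R\<^esub> v) \<odot>\<^bsub>M\<^esub> ((s \<otimes>\<^bsub>R\<^esub> t) \<odot>\<^bsub>M\<^esub> (t' \<odot>\<^bsub>M\<^esub> m' \<oplus>\<^bsub>M\<^esub> s' \<odot>\<^bsub>M\<^esub> n')) =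
        (v \<otimes>\<^bsub>R\<^esub> t \<otimes>\<^bsub>R\<^esub> t') \<odot>\<^bsub>M\<^esub> (u \<odot>\<^bsub>M\<^esub> (s \<odot>\<^bsub>M\<^esub> m')) \<oplus>\<^bsub>M\<^esub> (u \<otimes>\<^bsub>R\<^esub> s \<otimes>\<^bsub>R\<^esub> s') \<odot>\<^bsub>M\<^esub> (v \<odot>\<^bsub>M\<^esub> (t \<odot>\<^bsub>M\<^esub> n'))"
      using assms c cS by (simp add: norm)
    also have "\<dots> = (u \<otimes>\<^bsub>R\<^esub> v) \<odot>\<^bsub>M\<^esub> ((s' \<otimes>\<^bsub>R\<^esub> t') \<odot>\<^bsub>M\<^esub> (t \<odot>\<^bsub>M\<^esub> m \<oplus>\<^bsub>M\<^esub> s \<odot>\<^bsub>M\<^esub> n))"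
      unfolding u(2)[symmetric] v(2)[symmetric] using assms c cS by (simp add: norm)
    finally show ?thesis
      using assms c cS S_mult u(1) v(1) by (subst frac_eq_iff) auto
  qed
  then show ?thesis
    using assms by (simp add: loc_module_def UN_frac_const)
qed

end

text \<open>The product of the witnesses for the equality of the scalars and of the vectors is a
  witness for the products.\<close>

lemma (in module) smult_frac_aux:
  assumes "u \<in> carrier R" "v \<in> carrier R" "r \<in> carrier R" "r' \<in> carrier R" "s \<in> carrier R"
    "s' \<in> carrier R" "a \<in> carrier R" "a' \<in> carrier R" "m \<in> carrier M" "m' \<in> carrier M"
    and u: "u \<otimes>\<^bsub>R\<^esub> (r' \<otimes>\<^bsub>R\<^esub> a) = u \<otimes>\<^bsub>R\<^esub> (r \<otimes>\<^bsub>R\<^esub> a')"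
    and v: "v \<odot>\<^bsub>M\<^esub> (s' \<odot>\<^bsub>M\<^esub> m) = v \<odot>\<^bsub>M\<^esub> (s \<odot>\<^bsub>M\<^esub> m')"
  shows "(u \<otimes>\<^bsub>R\<^esub> v) \<odot>\<^bsub>M\<^esub> ((r \<otimes>\<^bsub>R\<^esub> s) \<odot>\<^bsub>M\<^esub> (a' \<odot>\<^bsub>M\<^esub> m')) =
    (u \<otimes>\<^bsub>R\<^esub> v) \<odot>\<^bsub>M\<^esub> ((r' \<otimes>\<^bsub>R\<^esub> s') \<odot>\<^bsub>M\<^esub> (a \<odot>\<^bsub>M\<^esub> m))"
proof -
  note norm = smult_assoc1[symmetric] R.m_ac
  have "(u \<otimes>\<^bsub>R\<^esub> v) \<odot>\<^bsub>M\<^esub> ((r \<otimes>\<^bsub>R\<^esub> s) \<odot>\<^bsub>M\<^esub> (a' \<odot>\<^bsub>M\<^esub> m')) =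
      (u \<otimes>\<^bsub>R\<^esub> (r \<otimes>\<^bsub>R\<^esub> a')) \<odot>\<^bsub>M\<^esub> (v \<odot>\<^bsub>M\<^esub> (s \<odot>\<^bsub>M\<^esub> m'))"
    using assms(1-10) by (simp add: norm)
  also have "\<dots> = (u \<otimes>\<^bsub>R\<^esub> v) \<odot>\<^bsub>M\<^esub> ((r' \<otimes>\<^bsub>R\<^esub> s') \<odot>\<^bsub>M\<^esub> (a \<odot>\<^bsub>M\<^esub> m))"
    unfolding u[symmetric] v[symmetric] using assms(1-10) by (simp add: norm)
  finally show ?thesis .
qed

lemma (in localization) localization_self: "localization R (self_module R) S"
  by (intro localization.intro localization_axioms.intro R.module_self_module)
    (use S_subset S_one S_mult in auto)

sublocale localization \<subseteq> self: localization R "self_module R" S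
  by (rule localization_self)

context localization begin

lemma smult_frac:
  assumes "a \<in> carrier R" "r \<in> S" "m \<in> carrier M" "s \<in> S"
  shows "rfrac a r \<odot>\<^bsub>loc_module R S M\<^esub> frac m s = frac (a \<odot>\<^bsub>M\<^esub> m) (r \<otimes>\<^bsub>R\<^esub> s)"
proof -
  have "frac (a' \<odot>\<^bsub>M\<^esub> m') (r' \<otimes>\<^bsub>R\<^esub> s') = frac (a \<odot>\<^bsub>M\<^esub> m) (r \<otimes>\<^bsub>R\<^esub> s)"
    if H: "(a', r') \<in> rfrac a r" "(m', s') \<in> frac m s" for a' r' m' s'
  proof -
    have c: "a' \<in> carrier R" "r' \<in> S" "m' \<in> carrier M" "s' \<in> S"
      using H assms by (auto simp: mem_frac_iff self.mem_frac_iff)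
    obtain u where u: "u \<in> S" "u \<otimes>\<^bsub>R\<^esub> (r' \<otimes>\<^bsub>R\<^esub> a) = u \<otimes>\<^bsub>R\<^esub> (r \<otimes>\<^bsub>R\<^esub> a')"
      using H(1) assms by (auto simp: self.mem_frac_iff)
    obtain v where v: "v \<in> S" "v \<odot>\<^bsub>M\<^esub> (s' \<odot>\<^bsub>M\<^esub> m) = v \<odot>\<^bsub>M\<^esub> (s \<odot>\<^bsub>M\<^esub> m')"
      using H(2) assms by (auto simp: mem_frac_iff)
    have "(u \<otimes>\<^bsub>R\<^esub> v) \<odot>\<^bsub>M\<^esub> ((r \<otimes>\<^bsub>R\<^esub> s) \<odot>\<^bsub>M\<^esub> (a' \<odot>\<^bsub>M\<^esub> m')) =
        (u \<otimes>\<^bsub>R\<^esub> v) \<odot>\<^bsub>M\<^esub> ((r' \<otimes>\<^bsub>R\<^esub> s') \<odot>\<^bsub>M\<^esub> (a \<odot>\<^bsub>M\<^esub> m))"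
      by (rule smult_frac_aux) (use assms c u v S_carrier in auto)
    then show ?thesis
      using assms c S_carrier S_mult u(1) v(1) by (subst frac_eq_iff) auto
  qed
  then show ?thesis
    using assms by (simp add: loc_module_def UN_frac_const self.UN_frac_const)
qed

end

section \<open>Axioms for rings and modules of fractions\<close>

context localization begin

lemma zero_frac: "s \<in> S \<Longrightarrow> frac \<zero>\<^bsub>M\<^esub> s = \<zero>\<^bsub>loc_module R S M\<^esub>"
  unfolding zero_loc_module using S_one S_carrier by (intro frac_eqI) auto

lemma abelian_group_loc_module: "abelian_group (loc_module R S M)"
proof (rule abelian_groupI)
  let ?L = "loc_module R S M"
  note [simp] = S_carrier S_mult S_one add_frac
  show "\<zero>\<^bsub>?L\<^esub> \<in> carrier ?L" by (simp add: zero_loc_module)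
  fix X assume X: "X \<in> carrier ?L"
  then obtain m s where ms: "m \<in> carrier M" "s \<in> S" "X = frac m s" by (rule fracE)
  show "\<zero>\<^bsub>?L\<^esub> \<oplus>\<^bsub>?L\<^esub> X = X" using ms by (simp add: zero_loc_module)
  have "frac (\<ominus>\<^bsub>M\<^esub> m) s \<oplus>\<^bsub>?L\<^esub> X = \<zero>\<^bsub>?L\<^esub>"
    using ms by (simp add: smult_r_minus M.l_neg zero_frac)
  then show "\<exists>Y \<in> carrier ?L. Y \<oplus>\<^bsub>?L\<^esub> X = \<zero>\<^bsub>?L\<^esub>"
    using ms by (intro bexI[of _ "frac (\<ominus>\<^bsub>M\<^esub> m) s"]) auto
  fix Y assume Y: "Y \<in> carrier ?L"
  then obtain n t where nt: "n \<in> carrier M" "t \<in> S" "Y = frac n t" by (rule fracE)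
  show "X \<oplus>\<^bsub>?L\<^esub> Y \<in> carrier ?L" using ms nt by simp
  show "X \<oplus>\<^bsub>?L\<^esub> Y = Y \<oplus>\<^bsub>?L\<^esub> X" using ms nt by (simp add: M.a_comm R.m_comm)
  fix Z assume Z: "Z \<in> carrier ?L"
  then obtain k u where ku: "k \<in> carrier M" "u \<in> S" "Z = frac k u" by (rule fracE)
  show "X \<oplus>\<^bsub>?L\<^esub> Y \<oplus>\<^bsub>?L\<^esub> Z = X \<oplus>\<^bsub>?L\<^esub> (Y \<oplus>\<^bsub>?L\<^esub> Z)"
    using ms nt ku
    by (simp add: smult_r_distr smult_assoc1[symmetric] R.m_ac M.a_ac)
qed

text \<open>The ring of fractions is the module of fractions of \<open>R\<close> over itself with
  its scalar multiplication as product, so most ring laws become instances of the module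
  laws.\<close>

lemma loc_ring_simps:
  "carrier (loc_ring R S) = carrier (loc_module R S (self_module R))"
  "X \<oplus>\<^bsub>loc_ring R S\<^esub> Y = X \<oplus>\<^bsub>loc_module R S (self_module R)\<^esub> Y"
  "X \<otimes>\<^bsub>loc_ring R S\<^esub> Y = X \<odot>\<^bsub>loc_module R S (self_module R)\<^esub> Y"
  "\<zero>\<^bsub>loc_ring R S\<^esub> = \<zero>\<^bsub>loc_module R S (self_module R)\<^esub>"
  "\<one>\<^bsub>loc_ring R S\<^esub> = rfrac \<one>\<^bsub>R\<^esub> \<one>\<^bsub>R\<^esub>"
  by (simp_all add: loc_ring_def loc_module_def)

lemma rfracE:
  assumes "A \<in> carrier (loc_ring R S)"
  obtains a r where "a \<in> carrier R" "r \<in> S" "A = rfrac a r"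
  using self.fracE[of A] assms unfolding loc_ring_simps by auto

lemma smult_loc_module:
  assumes "A \<in> carrier (loc_ring R S)" "B \<in> carrier (loc_ring R S)"
    "X \<in> carrier (loc_module R S M)" "Y \<in> carrier (loc_module R S M)"
  shows "A \<odot>\<^bsub>loc_module R S M\<^esub> X \<in> carrier (loc_module R S M)"
    and "(A \<oplus>\<^bsub>loc_ring R S\<^esub> B) \<odot>\<^bsub>loc_module R S M\<^esub> X =
      A \<odot>\<^bsub>loc_module R S M\<^esub> X \<oplus>\<^bsub>loc_module R S M\<^esub> B \<odot>\<^bsub>loc_module R S M\<^esub> X"
    and "A \<odot>\<^bsub>loc_module R S M\<^esub> (X \<oplus>\<^bsub>loc_module R S M\<^esub> Y) =
      A \<odot>\<^bsub>loc_module R S M\<^esub> X \<oplus>\<^bsub>loc_module R S M\<^esub> A \<odot>\<^bsub>loc_module R S M\<^esub> Y"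
    and "(A \<otimes>\<^bsub>loc_ring R S\<^esub> B) \<odot>\<^bsub>loc_module R S M\<^esub> X =
      A \<odot>\<^bsub>loc_module R S M\<^esub> (B \<odot>\<^bsub>loc_module R S M\<^esub> X)"
    and "\<one>\<^bsub>loc_ring R S\<^esub> \<odot>\<^bsub>loc_module R S M\<^esub> X = X"
proof -
  note [simp] = S_carrier S_mult S_one smult_frac add_frac self.add_frac[simplified] self.smult_frac[simplified]
    loc_ring_simps(2-)
  note norm = smult_r_distr smult_l_distr smult_assoc1[symmetric] R.m_ac
  obtain a r where ar: "a \<in> carrier R" "r \<in> S" "A = rfrac a r" using assms(1) by (rule rfracE)
  obtain b t where bt: "b \<in> carrier R" "t \<in> S" "B = rfrac b t" using assms(2) by (rule rfracE)
  obtain m s where ms: "m \<in> carrier M" "s \<in> S" "X = frac m s" using assms(3) by (rule fracE)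
  obtain n u where nu: "n \<in> carrier M" "u \<in> S" "Y = frac n u" using assms(4) by (rule fracE)
  show "A \<odot>\<^bsub>loc_module R S M\<^esub> X \<in> carrier (loc_module R S M)" using ar ms by simp
  show "(A \<otimes>\<^bsub>loc_ring R S\<^esub> B) \<odot>\<^bsub>loc_module R S M\<^esub> X =
      A \<odot>\<^bsub>loc_module R S M\<^esub> (B \<odot>\<^bsub>loc_module R S M\<^esub> X)"
    using ar bt ms by (simp add: smult_assoc1 R.m_assoc)
  show "\<one>\<^bsub>loc_ring R S\<^esub> \<odot>\<^bsub>loc_module R S M\<^esub> X = X" using ms by simp
  show "(A \<oplus>\<^bsub>loc_ring R S\<^esub> B) \<odot>\<^bsub>loc_module R S M\<^esub> X =
      A \<odot>\<^bsub>loc_module R S M\<^esub> X \<oplus>\<^bsub>loc_module R S M\<^esub> B \<odot>\<^bsub>loc_module R S M\<^esub> X"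
    using ar bt ms by simp (rule frac_eqI, auto simp: norm)
  show "A \<odot>\<^bsub>loc_module R S M\<^esub> (X \<oplus>\<^bsub>loc_module R S M\<^esub> Y) =
      A \<odot>\<^bsub>loc_module R S M\<^esub> X \<oplus>\<^bsub>loc_module R S M\<^esub> A \<odot>\<^bsub>loc_module R S M\<^esub> Y"
    using ar nu ms by simp (rule frac_eqI, auto simp: norm)
qed

end

context localization begin

lemma cring_loc_ring: "cring (loc_ring R S)"
proof (rule cringI)
  interpret A: abelian_group "loc_module R S (self_module R)" by (rule self.abelian_group_loc_module)
  show "abelian_group (loc_ring R S)"
    by (rule abelian_groupI)
      (auto simp: loc_ring_simps A.a_ac dest: abelian_groupE(6)[OF A.abelian_group_axioms])
  have comm: "X \<otimes>\<^bsub>loc_ring R S\<^esub> Y = Y \<otimes>\<^bsub>loc_ring R S\<^esub> X"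
    if XY: "X \<in> carrier (loc_ring R S)" "Y \<in> carrier (loc_ring R S)" for X Y
  proof -
    obtain a r where ar: "a \<in> carrier R" "r \<in> S" "X = rfrac a r" using XY(1) by (rule rfracE)
    obtain b t where bt: "b \<in> carrier R" "t \<in> S" "Y = rfrac b t" using XY(2) by (rule rfracE)
    show ?thesis using ar bt S_carrier by (simp add: loc_ring_simps self.smult_frac R.m_comm)
  qed
  note sm = self.smult_loc_module[folded loc_ring_simps]
  show "comm_monoid (loc_ring R S)"
  proof (rule comm_monoidI)
    show one: "\<one>\<^bsub>loc_ring R S\<^esub> \<in> carrier (loc_ring R S)"
      using S_one by (auto simp: loc_ring_simps)
    fix X Y Z assume "X \<in> carrier (loc_ring R S)" "Y \<in> carrier (loc_ring R S)" "Z \<in> carrier (loc_ring R S)"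
    then show "X \<otimes>\<^bsub>loc_ring R S\<^esub> Y \<otimes>\<^bsub>loc_ring R S\<^esub> Z = X \<otimes>\<^bsub>loc_ring R S\<^esub> (Y \<otimes>\<^bsub>loc_ring R S\<^esub> Z)"
      using sm(4)[of X Y Z Z] by simp
  next
    fix X assume "X \<in> carrier (loc_ring R S)"
    then show "\<one>\<^bsub>loc_ring R S\<^esub> \<otimes>\<^bsub>loc_ring R S\<^esub> X = X"
      using sm(5)[of X X X X] by simp
  next
    fix X Y assume "X \<in> carrier (loc_ring R S)" "Y \<in> carrier (loc_ring R S)"
    then show "X \<otimes>\<^bsub>loc_ring R S\<^esub> Y \<in> carrier (loc_ring R S)"
      using sm(1)[of X X Y Y] by simp
  qed (rule comm)
  show "(X \<oplus>\<^bsub>loc_ring R S\<^esub> Y) \<otimes>\<^bsub>loc_ring R S\<^esub> Z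
      = X \<otimes>\<^bsub>loc_ring R S\<^esub> Z \<oplus>\<^bsub>loc_ring R S\<^esub> Y \<otimes>\<^bsub>loc_ring R S\<^esub> Z"
    if "X \<in> carrier (loc_ring R S)" "Y \<in> carrier (loc_ring R S)" "Z \<in> carrier (loc_ring R S)" for X Y Z
    using sm(2)[OF that that(3)] .
qed

lemma module_loc_module: "module (loc_ring R S) (loc_module R S M)"
proof (rule moduleI[OF cring_loc_ring abelian_group_loc_module])
  have one: "\<one>\<^bsub>loc_ring R S\<^esub> \<in> carrier (loc_ring R S)"
    using S_one by (auto simp: loc_ring_simps)
  fix X assume "X \<in> carrier (loc_module R S M)"
  then show "\<one>\<^bsub>loc_ring R S\<^esub> \<odot>\<^bsub>loc_module R S M\<^esub> X = X"
    using smult_loc_module(5)[OF one one] by blast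
next
  fix A B X assume *: "A \<in> carrier (loc_ring R S)" "B \<in> carrier (loc_ring R S)"
    "X \<in> carrier (loc_module R S M)"
  show "(A \<oplus>\<^bsub>loc_ring R S\<^esub> B) \<odot>\<^bsub>loc_module R S M\<^esub> X =
      A \<odot>\<^bsub>loc_module R S M\<^esub> X \<oplus>\<^bsub>loc_module R S M\<^esub> B \<odot>\<^bsub>loc_module R S M\<^esub> X"
    and "(A \<otimes>\<^bsub>loc_ring R S\<^esub> B) \<odot>\<^bsub>loc_module R S M\<^esub> X =
      A \<odot>\<^bsub>loc_module R S M\<^esub> (B \<odot>\<^bsub>loc_module R S M\<^esub> X)"
    using smult_loc_module(2,4)[OF * *(3)] .
next
  fix A X Y assume *: "A \<in> carrier (loc_ring R S)"
    "X \<in> carrier (loc_module R S M)" "Y \<in> carrier (loc_module R S M)"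
  show "A \<odot>\<^bsub>loc_module R S M\<^esub> (X \<oplus>\<^bsub>loc_module R S M\<^esub> Y) =
      A \<odot>\<^bsub>loc_module R S M\<^esub> X \<oplus>\<^bsub>loc_module R S M\<^esub> A \<odot>\<^bsub>loc_module R S M\<^esub> Y"
    by (rule smult_loc_module(3)[OF *(1) *])
next
  fix A X assume *: "A \<in> carrier (loc_ring R S)" "X \<in> carrier (loc_module R S M)"
  show "A \<odot>\<^bsub>loc_module R S M\<^esub> X \<in> carrier (loc_module R S M)"
    by (rule smult_loc_module(1)[OF *(1,1) *(2,2)])
qed

end

section \<open>Serre's condition without fractions\<close>

lemma (in module) localization_at_prime:
  assumes "primeideal p R"
  shows "localization R M (carrier R - p)"
proof -
  interpret p: primeideal p R by fact
  show ?thesis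
    by (intro localization.intro localization_axioms.intro module_axioms)
      (use p.one_imp_carrier p.I_notcarr p.I_prime in auto)
qed

text \<open>\<open>max_ideal\<close> is a definite description, so the fractions with numerator in
  \<open>p\<close> have to be shown to form the only maximal ideal. An ideal not contained in it has
  a fraction \<open>a/s\<close> with \<open>a\<close> outside \<open>p\<close>, whose inverse is
  \<open>s/a\<close>.\<close>

lemma (in module) max_ideal_loc_ring:
  assumes p: "primeideal p R" and X: "X \<in> max_ideal (loc_ring_at R p)"
  obtains a s where "a \<in> p" "s \<in> carrier R - p"
    "X = loc_frac (carrier R - p) (self_module R) a s"
proof -
  let ?S = "carrier R - p"
  let ?Q = "loc_ring R ?S"
  interpret p: primeideal p R by fact
  interpret L: localization R M ?S by (rule localization_at_prime[OF p])
  interpret Q: cring ?Q by (rule L.cring_loc_ring)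
  interpret QS: module ?Q "self_module ?Q" by (rule Q.module_self_module)
  define P where "P = {L.rfrac a s | a s. a \<in> p \<and> s \<in> ?S}"
  note [simp] = L.S_mult L.self.add_frac L.self.smult_frac
  have Pc: "P \<subseteq> carrier ?Q" unfolding P_def L.loc_ring_simps using p.Icarr by auto
  have "submodule P ?Q (self_module ?Q)"
  proof (rule QS.submoduleI')
    show "\<zero>\<^bsub>self_module ?Q\<^esub> \<in> P"
      unfolding self_module_simps L.loc_ring_simps L.self.zero_loc_module P_def
      using L.S_one p.zero_closed by blast
  next
    fix A B assume "A \<in> P" "B \<in> P"
    then obtain a s b t where ab: "A = L.rfrac a s" "B = L.rfrac b t" "a \<in> p" "b \<in> p" "s \<in> ?S" "t \<in> ?S"
      unfolding P_def by auto
    have "A \<oplus>\<^bsub>self_module ?Q\<^esub> B = L.rfrac (t \<otimes> a \<oplus> s \<otimes> b) (s \<otimes> t)"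
      unfolding self_module_simps L.loc_ring_simps ab(1,2) using ab(3-) p.Icarr by (subst L.self.add_frac) auto
    moreover have "t \<otimes> a \<oplus> s \<otimes> b \<in> p" using ab(3-) p.I_l_closed by auto
    moreover have "s \<otimes> t \<in> ?S" using ab L.S_mult by blast
    ultimately show "A \<oplus>\<^bsub>self_module ?Q\<^esub> B \<in> P" unfolding P_def by blast
  next
    fix A B assume A: "A \<in> carrier ?Q" and "B \<in> P"
    then obtain b t where b: "B = L.rfrac b t" "b \<in> p" "t \<in> ?S"
      unfolding P_def by auto
    obtain a s where a: "a \<in> carrier R" "s \<in> ?S" "A = L.rfrac a s" using A by (rule L.rfracE)
    have "A \<odot>\<^bsub>self_module ?Q\<^esub> B = L.rfrac (a \<otimes> b) (s \<otimes> t)"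
      unfolding self_module_simps L.loc_ring_simps a(3) b(1) using a(1,2) b(2-) p.Icarr
      by (subst L.self.smult_frac) auto
    moreover have "a \<otimes> b \<in> p" using a b p.I_l_closed by auto
    moreover have "s \<otimes> t \<in> ?S" using a b L.S_mult by blast
    ultimately show "A \<odot>\<^bsub>self_module ?Q\<^esub> B \<in> P" unfolding P_def by blast
  qed (use Pc in auto)
  then have Pid: "ideal P ?Q" by (simp add: Q.ideal_iff_submodule)
  have one: "\<one>\<^bsub>?Q\<^esub> \<notin> P"
  proof
    assume "\<one>\<^bsub>?Q\<^esub> \<in> P"
    then obtain a s where as: "L.rfrac \<one> \<one> = L.rfrac a s" "a \<in> p" "s \<in> ?S"
      unfolding P_def L.loc_ring_simps by auto
    have ac: "a \<in> carrier R" using as p.Icarr by auto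
    obtain u where u: "u \<in> ?S" "u \<otimes> (s \<otimes> \<one>) = u \<otimes> (\<one> \<otimes> a)"
      using as(1) L.self.frac_eq_iff[of \<one> \<one> a s] L.S_one as(3) ac by auto
    have "u \<otimes> s \<in> p" using u as ac p.I_l_closed[of a u] by auto
    then show False using L.S_mult[OF u(1) as(3)] by blast
  qed
  have big: "J = carrier ?Q" if J: "ideal J ?Q" "\<not> J \<subseteq> P" for J
  proof -
    interpret J: ideal J ?Q by fact
    obtain A where A: "A \<in> J" "A \<notin> P" using J(2) by auto
    then obtain a s where a: "a \<in> carrier R" "s \<in> ?S" "A = L.rfrac a s"
      using L.rfracE[OF J.Icarr] by blast
    have "a \<notin> p" using a A(2) unfolding P_def by blast
    then have aS: "a \<in> ?S" using a(1) by simp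
    have "L.rfrac s a \<otimes>\<^bsub>?Q\<^esub> A \<in> J"
      by (rule J.I_l_closed[OF A(1)]) (use a aS in \<open>auto simp: L.loc_ring_simps\<close>)
    also have "L.rfrac s a \<otimes>\<^bsub>?Q\<^esub> A = L.rfrac (s \<otimes> a) (a \<otimes> s)"
      unfolding L.loc_ring_simps a(3) using a aS by (subst L.self.smult_frac) auto
    also have "\<dots> = \<one>\<^bsub>?Q\<^esub>"
      unfolding L.loc_ring_simps
      by (rule L.self.frac_eqI) (use a aS L.S_mult L.S_one in \<open>auto simp: R.m_comm\<close>)
    finally show ?thesis by (rule J.one_imp_carrier)
  qed
  have "maximalideal P ?Q"
  proof (rule maximalidealI[OF Pid])
    show "carrier ?Q \<noteq> P" using one Q.one_closed by blast
    fix J assume "ideal J ?Q" "P \<subseteq> J"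
    then show "J = P \<or> J = carrier ?Q" using big by blast
  qed
  moreover have "I = P" if "maximalideal I ?Q" for I
  proof -
    interpret I: maximalideal I ?Q by fact
    have "I \<subseteq> P" using big[OF I.is_ideal] I.I_notcarr by auto
    then have "P = I \<or> P = carrier ?Q" by (rule I.I_maximal[OF Pid _ Pc])
    then show ?thesis using one Q.one_closed by blast
  qed
  ultimately have "max_ideal ?Q = P" unfolding max_ideal_def by (rule the_equality)
  then show thesis using X that unfolding P_def by auto
qed

section \<open>Sequences of length at most one, and height\<close>

lemma (in module) seq_submodule_Nil: "seq_submodule R M [] = {\<zero>\<^bsub>M\<^esub>}"
proof -
  have z: "submodule {\<zero>\<^bsub>M\<^esub>} R M" by (rule submoduleI') auto
  have "seq_submodule R M [] = submodule_span R M {}"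
    by (simp add: seq_submodule_def)
  moreover have "submodule_span R M {} \<subseteq> {\<zero>\<^bsub>M\<^esub>}"
    by (rule submodule_span_least[OF z]) auto
  moreover have "\<zero>\<^bsub>M\<^esub> \<in> submodule_span R M {}"
    by (rule submodule_zero[OF submodule_submodule_span]) auto
  ultimately show ?thesis by auto
qed

lemma (in module) seq_submodule_singleton:
  assumes a: "a \<in> carrier R"
  shows "seq_submodule R M [a] = {a \<odot>\<^bsub>M\<^esub> m | m. m \<in> carrier M}"
proof -
  let ?N = "{a \<odot>\<^bsub>M\<^esub> m | m. m \<in> carrier M}"
  have "submodule ?N R M"
  proof (rule submoduleI')
    have "\<zero>\<^bsub>M\<^esub> = a \<odot>\<^bsub>M\<^esub> \<zero>\<^bsub>M\<^esub>" using a by simp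
    then show "\<zero>\<^bsub>M\<^esub> \<in> ?N" by blast
    fix x y assume "x \<in> ?N" "y \<in> ?N"
    then obtain m n where "x = a \<odot>\<^bsub>M\<^esub> m" "y = a \<odot>\<^bsub>M\<^esub> n" "m \<in> carrier M" "n \<in> carrier M" by auto
    then show "x \<oplus>\<^bsub>M\<^esub> y \<in> ?N"
      using a by (intro CollectI exI[of _ "m \<oplus>\<^bsub>M\<^esub> n"]) (simp add: smult_r_distr)
  next
    fix r x assume r: "r \<in> carrier R" and "x \<in> ?N"
    then obtain m where "x = a \<odot>\<^bsub>M\<^esub> m" "m \<in> carrier M" by auto
    then show "r \<odot>\<^bsub>M\<^esub> x \<in> ?N"
      using a r by (intro CollectI exI[of _ "r \<odot>\<^bsub>M\<^esub> m"]) (simp add: smult_assoc1[symmetric] R.m_comm)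
  qed (use a in auto)
  moreover have "submodule_span R M ?N = ?N" if "submodule ?N R M"
    using submodule_span_least[OF that, of ?N] subset_submodule_span[of ?N] a by auto
  ultimately show ?thesis by (simp add: seq_submodule_def)
qed

lemma height_geI:
  assumes "\<And>i. i \<le> n \<Longrightarrow> primeideal (P i) R" "\<And>i. i < n \<Longrightarrow> P i \<subset> P (Suc i)" "P n = p"
  shows "enat n \<le> height R p"
  unfolding height_def by (rule Sup_upper) (use assms in blast)

text \<open>The element \<open>x/1\<close> of \<open>M_p\<close> is nonzero and killed by the
  maximal ideal, so no nonempty regular sequence exists and the depth of \<open>M_p\<close> is 0. A
  prime strictly inside \<open>p\<close> would make the height at least 1.\<close>

lemma (in module) serre_condition_associated_prime:
  assumes serre: "serre_condition i R M" and "i \<ge> 1"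
    and p: "primeideal p R" and x: "x \<in> carrier M" and xp: "colon R M {\<zero>\<^bsub>M\<^esub>} x = p"
    and q: "primeideal q R" "q \<subseteq> p"
  shows "q = p"
proof (rule ccontr)
  assume "q \<noteq> p"
  have "enat 1 \<le> height R p"
    by (rule height_geI[of 1 "\<lambda>i. if i = 0 then q else p"]) (use p q \<open>q \<noteq> p\<close> in auto)
  let ?S = "carrier R - p"
  let ?Q = "loc_ring R ?S" and ?L = "loc_module R ?S M"
  interpret p: primeideal p R by fact
  interpret L: localization R M ?S by (rule localization_at_prime[OF p])
  interpret QL: module ?Q ?L by (rule L.module_loc_module)
  let ?X = "L.frac x \<one>"
  have Xc: "?X \<in> carrier ?L" using x L.S_one by simp
  have X0: "?X \<noteq> \<zero>\<^bsub>?L\<^esub>"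
  proof
    assume "?X = \<zero>\<^bsub>?L\<^esub>"
    then obtain u where "u \<in> ?S" "u \<odot>\<^bsub>M\<^esub> x = \<zero>\<^bsub>M\<^esub>"
      unfolding L.zero_loc_module using L.frac_eq_iff[of x \<one> "\<zero>\<^bsub>M\<^esub>" \<one>] x L.S_one by auto
    then show False using xp by (auto simp: colon_def)
  qed
  have "enat (length xs) \<le> 0"
    if xs: "set xs \<subseteq> max_ideal ?Q" "regular_sequence ?Q ?L xs" for xs
  proof (rule ccontr)
    assume "\<not> enat (length xs) \<le> 0"
    then have len: "0 < length xs" by (cases xs) (auto simp: zero_enat_def)
    then have "xs ! 0 \<in> max_ideal ?Q" using xs(1) by auto
    then obtain a s where a: "a \<in> p" "s \<in> ?S" "xs ! 0 = L.rfrac a s"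
      by (rule max_ideal_loc_ring[OF p])
    have ax: "a \<odot>\<^bsub>M\<^esub> x = \<zero>\<^bsub>M\<^esub>" using a(1) xp by (auto simp: colon_def)
    have "(xs ! 0) \<odot>\<^bsub>?L\<^esub> ?X = \<zero>\<^bsub>?L\<^esub>"
      using a x ax p.Icarr L.S_one L.zero_frac[of "s \<otimes> \<one>"] by (simp add: L.smult_frac)
    then have "(xs ! 0) \<odot>\<^bsub>?L\<^esub> ?X \<in> seq_submodule ?Q ?L (take 0 xs)"
      by (simp add: QL.seq_submodule_Nil)
    then have "?X \<in> seq_submodule ?Q ?L (take 0 xs)"
      using xs(2) len Xc unfolding regular_sequence_def by blast
    then show False using X0 by (simp add: QL.seq_submodule_Nil)
  qed
  then have "Sup {enat (length xs) | xs. set xs \<subseteq> max_ideal ?Q \<and> regular_sequence ?Q ?L xs} \<le> 0"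
    by (intro Sup_least) blast
  \<comment> \<open>\<open>M_p\<close> is nonzero, so \<open>depth\<close> is the supremum and not
    the default value \<open>\<infinity>\<close>.\<close>
  moreover have "carrier ?L \<noteq> {\<zero>\<^bsub>?L\<^esub>}" using Xc X0 by blast
  ultimately have "depth ?Q ?L \<le> 0" unfolding depth_def by (simp only: if_False)
  moreover have "min (enat i) (height R p) \<le> depth ?Q ?L"
    using serre p unfolding serre_condition_def by blast
  moreover have "enat 1 \<le> min (enat i) (height R p)"
    using \<open>i \<ge> 1\<close> \<open>enat 1 \<le> height R p\<close> by simp
  ultimately have "enat 1 \<le> 0" by (meson order_trans)
  then show False by (simp add: zero_enat_def)
qed

text \<open>This says that \<open>a/1\<close> and \<open>b/1\<close> satisfy the injectivity conditions of a regular sequence on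
  \<open>M\<^sub>q\<close>, which also holds when \<open>M\<^sub>q = 0\<close>.\<close>

definition locally_regular_pair ::
    "('a, 'm) ring_scheme \<Rightarrow> ('a, 'b, 'n) module_scheme \<Rightarrow> 'a set \<Rightarrow> 'a \<Rightarrow> 'a \<Rightarrow> bool" where
  "locally_regular_pair R M q a b \<longleftrightarrow> a \<in> q \<and> b \<in> q \<and>
    (\<forall>m \<in> carrier M. a \<odot>\<^bsub>M\<^esub> m = \<zero>\<^bsub>M\<^esub> \<longrightarrow> (\<exists>u \<in> carrier R - q. u \<odot>\<^bsub>M\<^esub> m = \<zero>\<^bsub>M\<^esub>)) \<and>
    (\<forall>m \<in> carrier M. \<forall>m' \<in> carrier M. b \<odot>\<^bsub>M\<^esub> m = a \<odot>\<^bsub>M\<^esub> m' \<longrightarrow>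
      (\<exists>u \<in> carrier R - q. \<exists>n \<in> carrier M. u \<odot>\<^bsub>M\<^esub> m = a \<odot>\<^bsub>M\<^esub> n))"

text \<open>The first two terms of a regular sequence on \<open>M_q\<close> have the form
  \<open>a/s\<close> and \<open>b/t\<close>. Denominators are units, so \<open>a\<close> and
  \<open>b\<close> serve as well, and the two injectivity conditions can be read back in
  \<open>M\<close> up to a factor \<open>u\<close> outside \<open>q\<close>.\<close>

lemma (in module) serre_condition_two:
  assumes serre: "serre_condition 2 R M" and ht: "enat 2 \<le> height R q"
    and q: "primeideal q R"
  shows "\<exists>a b. locally_regular_pair R M q a b"
proof -
  let ?S = "carrier R - q"
  let ?Q = "loc_ring R ?S" and ?L = "loc_module R ?S M"
  interpret q: primeideal q R by fact
  interpret L: localization R M ?S by (rule localization_at_prime[OF q])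
  interpret QL: module ?Q ?L by (rule L.module_loc_module)
  have zero: "\<exists>u \<in> ?S. u \<odot>\<^bsub>M\<^esub> m = \<zero>\<^bsub>M\<^esub>" if "m \<in> carrier M" "L.frac m \<one> = \<zero>\<^bsub>?L\<^esub>" for m
    using that L.frac_eq_iff[of m \<one> "\<zero>\<^bsub>M\<^esub>" \<one>] L.S_one unfolding L.zero_loc_module by auto
  have le: "enat 2 \<le> depth ?Q ?L"
  proof -
    have "min (enat 2) (height R q) \<le> depth ?Q ?L"
      using serre q unfolding serre_condition_def by blast
    then show ?thesis using ht by (simp add: min_absorb1)
  qed
  show ?thesis
  proof (cases "carrier ?L = {\<zero>\<^bsub>?L\<^esub>}")
    case True
    have kill: "\<exists>u \<in> ?S. u \<odot>\<^bsub>M\<^esub> m = \<zero>\<^bsub>M\<^esub>" if "m \<in> carrier M" for m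
      using zero[OF that] L.frac_closed[OF that L.S_one] True by auto
    show ?thesis
      unfolding locally_regular_pair_def
    \<comment> \<open>When \<open>M_q = 0\<close>, the infinite depth says nothing about sequences;
      but every element of \<open>M\<close> is then killed by an element outside \<open>q\<close>,
      and \<open>\<zero>\<close> can be taken for both \<open>a\<close> and
      \<open>b\<close>.\<close>
    proof (intro exI[of _ \<zero>] conjI ballI impI)
      fix m m' assume "m \<in> carrier M"
      then obtain u where u: "u \<in> ?S" "u \<odot>\<^bsub>M\<^esub> m = \<zero>\<^bsub>M\<^esub>" using kill by blast
      have "u \<odot>\<^bsub>M\<^esub> m = \<zero> \<odot>\<^bsub>M\<^esub> \<zero>\<^bsub>M\<^esub>" using u(2) by simp
      then show "\<exists>u \<in> ?S. \<exists>n \<in> carrier M. u \<odot>\<^bsub>M\<^esub> m = \<zero> \<odot>\<^bsub>M\<^esub> n"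
        using u(1) M.zero_closed by blast
    qed (use kill q.zero_closed in blast)+
  next
    case False
    have "\<exists>xs. set xs \<subseteq> max_ideal ?Q \<and> regular_sequence ?Q ?L xs \<and> 2 \<le> length xs"
    \<comment> \<open>\<open>depth\<close> is a supremum: if all these sequences had length at most
      1, so would the depth be at most 1.\<close>
    proof (rule ccontr)
      assume no: "\<not> ?thesis"
      have "enat (length xs) \<le> enat 1"
        if "set xs \<subseteq> max_ideal ?Q" "regular_sequence ?Q ?L xs" for xs
        using no that by fastforce
      then have "Sup {enat (length xs) | xs. set xs \<subseteq> max_ideal ?Q \<and> regular_sequence ?Q ?L xs} \<le> enat 1"
        by (intro Sup_least) blast
      then have "depth ?Q ?L \<le> enat 1" unfolding depth_def using False by (simp only: if_False)
      then have "enat 2 \<le> enat 1" using le by (meson order_trans)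
      then show False by simp
    qed
    then obtain xs where xs: "set xs \<subseteq> max_ideal ?Q" "regular_sequence ?Q ?L xs" "2 \<le> length xs"
      by blast
    have reg: "Y \<in> seq_submodule ?Q ?L (take i xs)"
      if "i < length xs" "Y \<in> carrier ?L" "(xs ! i) \<odot>\<^bsub>?L\<^esub> Y \<in> seq_submodule ?Q ?L (take i xs)" for i Y
      using xs(2) that unfolding regular_sequence_def by blast
    have len: "0 < length xs" "1 < length xs" using xs(3) by auto
    have mem: "xs ! 0 \<in> max_ideal ?Q" "xs ! 1 \<in> max_ideal ?Q"
      using xs(1) len by (meson nth_mem subsetD)+
    obtain a s where a: "a \<in> q" "s \<in> ?S" "xs ! 0 = L.rfrac a s"
      using max_ideal_loc_ring[OF q mem(1)] .
    obtain b t where b: "b \<in> q" "t \<in> ?S" "xs ! 1 = L.rfrac b t"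
      using max_ideal_loc_ring[OF q mem(2)] .
    have c: "a \<in> carrier R" "b \<in> carrier R" "s \<in> carrier R" "t \<in> carrier R"
      using a b q.Icarr by auto
    have take1: "take 1 xs = [L.rfrac a s]" using len a(3) by (cases xs) auto
    have Ac: "L.rfrac a s \<in> carrier ?Q" using a c by (auto simp: L.loc_ring_simps)
    have fc: "L.frac m \<one> \<in> carrier ?L" if "m \<in> carrier M" for m using that L.S_one by simp
    have "\<exists>u \<in> ?S. u \<odot>\<^bsub>M\<^esub> m = \<zero>\<^bsub>M\<^esub>" if m: "m \<in> carrier M" "a \<odot>\<^bsub>M\<^esub> m = \<zero>\<^bsub>M\<^esub>" for m
    proof -
      have "(xs ! 0) \<odot>\<^bsub>?L\<^esub> L.frac m \<one> = \<zero>\<^bsub>?L\<^esub>"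
        unfolding a(3) using a(2) c m L.S_one L.zero_frac[of "s \<otimes> \<one>"] by (simp add: L.smult_frac)
      then have "L.frac m \<one> \<in> seq_submodule ?Q ?L (take 0 xs)"
        using reg[OF len(1) fc[OF m(1)]] by (simp add: QL.seq_submodule_Nil)
      then show ?thesis using zero[OF m(1)] by (simp add: QL.seq_submodule_Nil)
    qed
    moreover have "\<exists>u \<in> ?S. \<exists>n \<in> carrier M. u \<odot>\<^bsub>M\<^esub> m = a \<odot>\<^bsub>M\<^esub> n"
      if m: "m \<in> carrier M" "m' \<in> carrier M" "b \<odot>\<^bsub>M\<^esub> m = a \<odot>\<^bsub>M\<^esub> m'" for m m'
    proof -
      have st: "s \<otimes> t \<in> ?S" using L.S_mult a(2) b(2) by blast
      have "(xs ! 1) \<odot>\<^bsub>?L\<^esub> L.frac m \<one> = L.frac (a \<odot>\<^bsub>M\<^esub> m') t"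
        unfolding b(3) using b(2) c m L.S_one by (simp add: L.smult_frac)
      \<comment> \<open>Expanding by \<open>s\<close> exhibits the fraction as a multiple of
        \<open>a/s\<close>, which is the actual first term of the sequence.\<close>
      also have "\<dots> = L.frac (a \<odot>\<^bsub>M\<^esub> (s \<odot>\<^bsub>M\<^esub> m')) (s \<otimes> t)"
        by (rule L.frac_eqI) (use st b(2) c m in \<open>simp_all add: smult_assoc1[symmetric] R.m_ac\<close>)
      also have "\<dots> = L.rfrac a s \<odot>\<^bsub>?L\<^esub> L.frac (s \<odot>\<^bsub>M\<^esub> m') t"
        using a(2) b(2) c m by (subst L.smult_frac) auto
      also have "\<dots> \<in> seq_submodule ?Q ?L (take 1 xs)"
        unfolding take1 QL.seq_submodule_singleton[OF Ac] using b(2) c m by auto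
      finally have "L.frac m \<one> \<in> seq_submodule ?Q ?L (take 1 xs)"
        by (rule reg[OF len(2) fc[OF m(1)]])
      then obtain Y where Y: "Y \<in> carrier ?L" "L.frac m \<one> = L.rfrac a s \<odot>\<^bsub>?L\<^esub> Y"
        unfolding take1 QL.seq_submodule_singleton[OF Ac] by auto
      obtain n r where n: "n \<in> carrier M" "r \<in> ?S" "Y = L.frac n r" using Y(1) by (rule L.fracE)
      have sr: "s \<otimes> r \<in> ?S" using L.S_mult a(2) n(2) by blast
      have "L.frac m \<one> = L.frac (a \<odot>\<^bsub>M\<^esub> n) (s \<otimes> r)"
        using Y(2) a(2) c n by (simp add: L.smult_frac)
      then obtain u where u: "u \<in> ?S" "u \<odot>\<^bsub>M\<^esub> ((s \<otimes> r) \<odot>\<^bsub>M\<^esub> m) = u \<odot>\<^bsub>M\<^esub> (\<one> \<odot>\<^bsub>M\<^esub> (a \<odot>\<^bsub>M\<^esub> n))"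
        using L.frac_eq_iff[OF m(1) L.S_one _ sr, of "a \<odot>\<^bsub>M\<^esub> n"] c n by auto
      have uc: "u \<in> carrier R" "r \<in> carrier R" using u n by auto
      have "(u \<otimes> (s \<otimes> r)) \<odot>\<^bsub>M\<^esub> m = u \<odot>\<^bsub>M\<^esub> ((s \<otimes> r) \<odot>\<^bsub>M\<^esub> m)"
        using uc c m by (intro smult_assoc1) auto
      also have "\<dots> = a \<odot>\<^bsub>M\<^esub> (u \<odot>\<^bsub>M\<^esub> n)"
        unfolding u(2) using uc c n by (simp add: smult_assoc1[symmetric] R.m_comm)
      finally show ?thesis using L.S_mult[OF u(1) sr] n(1) uc by blast
    qed
    ultimately have "locally_regular_pair R M q a b"
      unfolding locally_regular_pair_def using a(1) b(1) by simp
    then show ?thesis by blast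
  qed
qed

section \<open>Functionals on finite free modules\<close>

definition pairing :: "('a, 'm) ring_scheme \<Rightarrow> 'c set \<Rightarrow> ('c \<Rightarrow> 'a) \<Rightarrow> ('c \<Rightarrow> 'a) \<Rightarrow> 'a" where
  "pairing R B c v = (\<Oplus>\<^bsub>R\<^esub> b \<in> B. c b \<otimes>\<^bsub>R\<^esub> v b)"

abbreviation unit_vector :: "('a, 'm) ring_scheme \<Rightarrow> 'c set \<Rightarrow> 'a \<Rightarrow> 'c \<Rightarrow> 'c \<Rightarrow> 'a" where
  "unit_vector R B t b \<equiv> \<lambda>b' \<in> B. if b' = b then t else \<zero>\<^bsub>R\<^esub>"

context cring begin

lemma pairing_cong:
  "c \<in> B \<rightarrow> carrier R \<Longrightarrow> v \<in> B \<rightarrow> carrier R \<Longrightarrow> (\<And>b. b \<in> B \<Longrightarrow> c b = c' b) \<Longrightarrow>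
    (\<And>b. b \<in> B \<Longrightarrow> v b = v' b) \<Longrightarrow> pairing R B c v = pairing R B c' v'"
  unfolding pairing_def by (rule finsum_cong') (auto simp: Pi_iff)

lemma pairing_closed:
  "c \<in> B \<rightarrow> carrier R \<Longrightarrow> v \<in> B \<rightarrow> carrier R \<Longrightarrow> pairing R B c v \<in> carrier R"
  unfolding pairing_def by (rule finsum_closed) auto

lemma pairing_commute:
  "c \<in> B \<rightarrow> carrier R \<Longrightarrow> v \<in> B \<rightarrow> carrier R \<Longrightarrow> pairing R B c v = pairing R B v c"
  unfolding pairing_def by (rule finsum_cong') (auto simp: Pi_iff m_comm)

lemma pairing_add_right:
  assumes "c \<in> B \<rightarrow> carrier R" "v \<in> B \<rightarrow> carrier R" "w \<in> B \<rightarrow> carrier R"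
  shows "pairing R B c (\<lambda>b. v b \<oplus> w b) = pairing R B c v \<oplus> pairing R B c w"
proof -
  have "pairing R B c (\<lambda>b. v b \<oplus> w b) = (\<Oplus>b \<in> B. c b \<otimes> v b \<oplus> c b \<otimes> w b)"
    unfolding pairing_def by (rule finsum_cong') (use assms in \<open>auto simp: Pi_iff r_distr\<close>)
  also have "\<dots> = pairing R B c v \<oplus> pairing R B c w"
    unfolding pairing_def by (rule finsum_addf) (use assms in auto)
  finally show ?thesis .
qed

lemma pairing_smult_right:
  assumes "finite B" "c \<in> B \<rightarrow> carrier R" "v \<in> B \<rightarrow> carrier R" "a \<in> carrier R"
  shows "pairing R B c (\<lambda>b. a \<otimes> v b) = a \<otimes> pairing R B c v"
proof -
  have "pairing R B c (\<lambda>b. a \<otimes> v b) = (\<Oplus>b \<in> B. a \<otimes> (c b \<otimes> v b))"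
    unfolding pairing_def by (rule finsum_cong') (use assms in \<open>auto simp: Pi_iff m_lcomm\<close>)
  also have "\<dots> = a \<otimes> pairing R B c v"
    unfolding pairing_def by (rule finsum_rdistr[symmetric]) (use assms in auto)
  finally show ?thesis .
qed

lemma linear_map_pairing:
  assumes "finite B" "c \<in> B \<rightarrow> carrier R"
  shows "linear_map R (fun_module R B) (self_module R) (pairing R B c)"
  unfolding linear_map_def
proof (intro conjI ballI funcsetI)
  fix v assume v: "v \<in> carrier (fun_module R B)"
  then show "pairing R B c v \<in> carrier (self_module R)"
    using assms by (auto intro!: pairing_closed)
  fix w assume w: "w \<in> carrier (fun_module R B)"
  have "pairing R B c (v \<oplus>\<^bsub>fun_module R B\<^esub> w) = pairing R B c (\<lambda>b. v b \<oplus> w b)"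
    using assms v w by (intro pairing_cong) (auto simp: Pi_iff)
  also have "\<dots> = pairing R B c v \<oplus> pairing R B c w"
    by (rule pairing_add_right) (use assms v w in auto)
  finally show "pairing R B c (v \<oplus>\<^bsub>fun_module R B\<^esub> w)
      = pairing R B c v \<oplus>\<^bsub>self_module R\<^esub> pairing R B c w"
    by simp
next
  fix a v assume a: "a \<in> carrier R" and v: "v \<in> carrier (fun_module R B)"
  have "pairing R B c (a \<odot>\<^bsub>fun_module R B\<^esub> v) = pairing R B c (\<lambda>b. a \<otimes> v b)"
    using assms v a by (intro pairing_cong) (auto simp: Pi_iff)
  also have "\<dots> = a \<otimes> pairing R B c v"
    by (rule pairing_smult_right) (use assms v a in auto)
  finally show "pairing R B c (a \<odot>\<^bsub>fun_module R B\<^esub> v) = a \<odot>\<^bsub>self_module R\<^esub> pairing R B c v"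
    by simp
qed

lemma pairing_unit_vector:
  assumes "finite B" "c \<in> B \<rightarrow> carrier R" "t \<in> carrier R" "b \<in> B"
  shows "pairing R B c (unit_vector R B t b) = c b \<otimes> t"
proof -
  have "pairing R B c (unit_vector R B t b) = (\<Oplus>b' \<in> B. if b = b' then c b' \<otimes> t else \<zero>)"
    unfolding pairing_def by (rule finsum_cong') (use assms in \<open>auto simp: Pi_iff\<close>)
  also have "\<dots> = c b \<otimes> t" by (rule finsum_singleton) (use assms in auto)
  finally show ?thesis .
qed

lemma submodule_fun_module_eq_carrier:
  assumes "finite B" "submodule N R (fun_module R B)"
    and "\<And>b. b \<in> B \<Longrightarrow> unit_vector R B \<one> b \<in> N" and v: "v \<in> carrier (fun_module R B)"
  shows "v \<in> N"
proof -
  interpret F: module R "fun_module R B" by (rule module_fun_module)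
  have "\<one> \<odot>\<^bsub>fun_module R B\<^esub> v \<in> N"
    using v by (intro submodule_fun_module_units[OF assms(1,2)] assms(3)) auto
  then show ?thesis using F.smult_one[OF v] by simp
qed

text \<open>When \<open>p = (I : s)\<close>, multiplication by \<open>s\<close> embeds \<open>R/p\<close> into \<open>R/I\<close>.\<close>

lemma ex_separating_functional:
  assumes "noetherian_ring R" "finite B" and U: "submodule U R (fun_module R B)"
    and p: "primeideal p R" and s: "s \<in> carrier R" and I: "ideal I R"
    and ps: "\<And>r. r \<in> carrier R \<Longrightarrow> r \<in> p \<longleftrightarrow> r \<otimes> s \<in> I"
    and supp: "\<And>t. t \<in> carrier R - p \<Longrightarrow>
      \<exists>v \<in> carrier (fun_module R B). t \<odot>\<^bsub>fun_module R B\<^esub> v \<notin> U"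
  obtains c where "c \<in> B \<rightarrow> carrier R" "\<And>v. v \<in> U \<Longrightarrow> pairing R B c v \<in> I" "\<exists>b \<in> B. c b \<notin> I"
proof -
  let ?F = "fun_module R B"
  interpret F: module R ?F by (rule module_fun_module)
  interpret p: primeideal p R by fact
  interpret I: ideal I R by fact
  have noeth: "noetherian_module R ?F"
    by (rule F.noetherian_moduleI[OF assms(1) finitely_generated_fun_module[OF assms(2)]])
  obtain N x t where N: "submodule N R ?F" "U \<subseteq> N" and x: "x \<in> carrier ?F"
    and t: "t \<in> carrier R" "t \<notin> p" and col: "colon R ?F N x = p"
    and dec: "\<And>m. m \<in> carrier ?F \<Longrightarrow>
       \<exists>a \<in> carrier R. \<exists>n \<in> N. t \<odot>\<^bsub>?F\<^esub> m = a \<odot>\<^bsub>?F\<^esub> x \<oplus>\<^bsub>?F\<^esub> n"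
    by (rule F.ex_torsion_free_quotient[OF noeth p U supp]) blast+
  note NE = F.submoduleE[OF N(1)]
  have Nc: "n \<in> carrier ?F" if "n \<in> N" for n using NE(1) that by blast
  have unit: "unit_vector R B \<one> b \<in> carrier ?F" for b by simp
  \<comment> \<open>\<open>a b\<close> is the \<open>x\<close>-coordinate, modulo \<open>N\<close>,
    of \<open>t\<close> times a unit vector. It is determined only modulo \<open>p\<close>, but on a
    free module any choice defines a functional.\<close>
  have "\<forall>b \<in> B. \<exists>a. a \<in> carrier R \<and>
      (\<exists>n \<in> N. t \<odot>\<^bsub>?F\<^esub> unit_vector R B \<one> b = a \<odot>\<^bsub>?F\<^esub> x \<oplus>\<^bsub>?F\<^esub> n)"
    using dec[OF unit] by blast
  then obtain a where a: "\<And>b. b \<in> B \<Longrightarrow> a b \<in> carrier R"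
    "\<And>b. b \<in> B \<Longrightarrow> \<exists>n \<in> N. t \<odot>\<^bsub>?F\<^esub> unit_vector R B \<one> b = a b \<odot>\<^bsub>?F\<^esub> x \<oplus>\<^bsub>?F\<^esub> n"
    by metis
  have aB: "a \<in> B \<rightarrow> carrier R" using a by auto
  note lin = linear_map_pairing[OF assms(2) aB]
  note lD = linear_functionalD[OF lin]
  \<comment> \<open>The vectors \<open>v\<close> for which the pairing with \<open>a\<close> really
    gives the \<open>x\<close>-coordinate of \<open>t v\<close> modulo \<open>N\<close>. They form a
    submodule containing the unit vectors.\<close>
  let ?V = "{v \<in> carrier ?F. \<exists>n \<in> N. t \<odot>\<^bsub>?F\<^esub> v = pairing R B a v \<odot>\<^bsub>?F\<^esub> x \<oplus>\<^bsub>?F\<^esub> n}"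
  have "submodule ?V R ?F"
  proof (rule F.submoduleI')
    have "t \<odot>\<^bsub>?F\<^esub> \<zero>\<^bsub>?F\<^esub> = pairing R B a \<zero>\<^bsub>?F\<^esub> \<odot>\<^bsub>?F\<^esub> x \<oplus>\<^bsub>?F\<^esub> \<zero>\<^bsub>?F\<^esub>"
      using t(1) x linear_map_zero[OF F.module_axioms module_self_module lin]
      by (simp del: fun_module_simps)
    then show "\<zero>\<^bsub>?F\<^esub> \<in> ?V" using F.submodule_zero[OF N(1)] by blast
  next
    fix v w assume "v \<in> ?V" "w \<in> ?V"
    then obtain n k where *: "v \<in> carrier ?F" "w \<in> carrier ?F" "n \<in> N" "k \<in> N"
      "t \<odot>\<^bsub>?F\<^esub> v = pairing R B a v \<odot>\<^bsub>?F\<^esub> x \<oplus>\<^bsub>?F\<^esub> n" "t \<odot>\<^bsub>?F\<^esub> w = pairing R B a w \<odot>\<^bsub>?F\<^esub> x \<oplus>\<^bsub>?F\<^esub> k"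
      by blast
    have "t \<odot>\<^bsub>?F\<^esub> (v \<oplus>\<^bsub>?F\<^esub> w) = pairing R B a (v \<oplus>\<^bsub>?F\<^esub> w) \<odot>\<^bsub>?F\<^esub> x \<oplus>\<^bsub>?F\<^esub> (n \<oplus>\<^bsub>?F\<^esub> k)"
      using * t(1) x lD(1)[OF *(1)] lD(1)[OF *(2)] lD(2)[OF *(1,2)] Nc[OF *(3)] Nc[OF *(4)]
      by (simp add: F.smult_r_distr F.smult_l_distr F.M.a_ac del: fun_module_simps)
    then show "v \<oplus>\<^bsub>?F\<^esub> w \<in> ?V" using NE(5)[OF *(3,4)] F.M.a_closed[OF *(1,2)] by blast
  next
    fix r v assume r: "r \<in> carrier R" and "v \<in> ?V"
    then obtain n where *: "v \<in> carrier ?F" "n \<in> N"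
      "t \<odot>\<^bsub>?F\<^esub> v = pairing R B a v \<odot>\<^bsub>?F\<^esub> x \<oplus>\<^bsub>?F\<^esub> n"
      by blast
    have "t \<odot>\<^bsub>?F\<^esub> (r \<odot>\<^bsub>?F\<^esub> v) = r \<odot>\<^bsub>?F\<^esub> (t \<odot>\<^bsub>?F\<^esub> v)"
      using *(1) t(1) r by (simp add: F.smult_assoc1[symmetric] m_comm del: fun_module_simps)
    also have "\<dots> = pairing R B a (r \<odot>\<^bsub>?F\<^esub> v) \<odot>\<^bsub>?F\<^esub> x \<oplus>\<^bsub>?F\<^esub> r \<odot>\<^bsub>?F\<^esub> n"
      unfolding *(3) using * r x lD(1)[OF *(1)] lD(3)[OF r *(1)] Nc[OF *(2)]
      by (simp add: F.smult_r_distr F.smult_assoc1 del: fun_module_simps)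
    finally show "r \<odot>\<^bsub>?F\<^esub> v \<in> ?V" using NE(4)[OF r *(2)] F.smult_closed[OF r *(1)] by blast
  qed blast
  moreover have "unit_vector R B \<one> b \<in> ?V" if "b \<in> B" for b
    using a(2)[OF that] pairing_unit_vector[OF assms(2) aB one_closed that] a(1)[OF that] unit
    by (simp del: fun_module_simps)
  ultimately have V: "v \<in> ?V" if "v \<in> carrier ?F" for v
    using submodule_fun_module_eq_carrier[OF assms(2) _ _ that] by blast
  \<comment> \<open>Composition with the embedding of \<open>R/p\<close> into \<open>R/I\<close>
    given by \<open>s\<close>.\<close>
  let ?c = "\<lambda>b. s \<otimes> a b"
  have cB: "?c \<in> B \<rightarrow> carrier R" using a s by auto
  have pc: "pairing R B ?c v = pairing R B a v \<otimes> s" if v: "v \<in> carrier ?F" for v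
  proof -
    have vB: "v \<in> B \<rightarrow> carrier R" using v by auto
    have "pairing R B ?c v = s \<otimes> pairing R B v a"
      using pairing_commute[OF cB vB] pairing_smult_right[OF assms(2) vB aB s] by simp
    then show ?thesis using pairing_commute[OF aB vB] lD(1)[OF v] s m_comm by simp
  qed
  show thesis
  proof (rule that[OF cB])
    fix v assume vU: "v \<in> U"
    then have v: "v \<in> carrier ?F" using F.submoduleE(1)[OF U] by blast
    obtain n where n: "n \<in> N" "t \<odot>\<^bsub>?F\<^esub> v = pairing R B a v \<odot>\<^bsub>?F\<^esub> x \<oplus>\<^bsub>?F\<^esub> n"
      using V[OF v] by blast
    \<comment> \<open>For \<open>v\<close> in \<open>U \<subseteq> N\<close> the coordinate
      multiplies \<open>x\<close> into \<open>N\<close>, so it lies in \<open>p\<close>.\<close>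
    have "t \<odot>\<^bsub>?F\<^esub> v \<in> N" using NE(4)[OF t(1)] vU N(2) by blast
    then have "pairing R B a v \<odot>\<^bsub>?F\<^esub> x \<in> N"
      unfolding n(2) by (rule F.submodule_add_cancel[OF N(1) n(1) F.smult_closed[OF lD(1)[OF v] x]])
    then have "pairing R B a v \<in> p" unfolding col[symmetric] colon_def using lD(1)[OF v] by blast
    then show "pairing R B ?c v \<in> I" using ps[OF lD(1)[OF v]] pc[OF v] by simp
  next
    show "\<exists>b \<in> B. s \<otimes> a b \<notin> I"
    proof (rule ccontr)
      assume "\<not> ?thesis"
      then have allI: "b \<in> B \<Longrightarrow> ?c b \<in> I" for b by blast
      note lin' = linear_map_pairing[OF assms(2) cB]
      note lD' = linear_functionalD[OF lin']
      \<comment> \<open>If all coefficients were in \<open>I\<close>, so would be the value at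
        \<open>x\<close>. Then the coordinate of \<open>t x\<close> would lie in \<open>p\<close>,
        so \<open>t x\<close> would lie in \<open>N\<close>, contrary to \<open>t\<close> being
        outside \<open>p = (N : x)\<close>.\<close>
      let ?W = "{v \<in> carrier ?F. pairing R B ?c v \<in> I}"
      have "submodule ?W R ?F"
      proof (rule F.submoduleI')
        show "\<zero>\<^bsub>?F\<^esub> \<in> ?W"
          using linear_map_zero[OF F.module_axioms module_self_module lin'] I.zero_closed F.M.zero_closed
          by (simp del: fun_module_simps)
      next
        fix v w assume "v \<in> ?W" "w \<in> ?W"
        then show "v \<oplus>\<^bsub>?F\<^esub> w \<in> ?W"
          using lD'(2) I.a_closed F.M.a_closed by (simp del: fun_module_simps)
      next
        fix r v assume "r \<in> carrier R" "v \<in> ?W"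
        then show "r \<odot>\<^bsub>?F\<^esub> v \<in> ?W"
          using lD'(3) I.I_l_closed F.smult_closed by (simp del: fun_module_simps)
      qed blast
      moreover have "unit_vector R B \<one> b \<in> ?W" if "b \<in> B" for b
        using pairing_unit_vector[OF assms(2) cB one_closed that] allI[OF that] unit a(1)[OF that] s
        by (simp del: fun_module_simps)
      ultimately have "x \<in> ?W"
        using submodule_fun_module_eq_carrier[OF assms(2) _ _ x] by blast
      then have "pairing R B a x \<in> p" using pc[OF x] ps[OF lD(1)[OF x]] by simp
      then have "pairing R B a x \<odot>\<^bsub>?F\<^esub> x \<in> N" unfolding col[symmetric] colon_def by blast
      moreover obtain n where n: "n \<in> N" "t \<odot>\<^bsub>?F\<^esub> x = pairing R B a x \<odot>\<^bsub>?F\<^esub> x \<oplus>\<^bsub>?F\<^esub> n"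
        using V[OF x] by blast
      ultimately have "t \<odot>\<^bsub>?F\<^esub> x \<in> N" using NE(5) by (simp del: fun_module_simps)
      then have "t \<in> p" unfolding col[symmetric] colon_def using t(1) by blast
      with t(2) show False by contradiction
    qed
  qed
qed

end

section \<open>The evaluation map of a dual basis\<close>

text \<open>Lifts of \<open>t\<close> times the unit vectors combine to a section of
  \<open>h\<close> up to the factor \<open>t\<close>. With \<open>t = \<one>\<close> this serves to
  build a basis, with other \<open>t\<close> to split off a free part at a minimal prime.\<close>

lemma (in module) linear_combination_of_preimages:
  assumes B: "finite B" and h: "linear_map R M (fun_module R B) h" and t: "t \<in> carrier R"
    and e: "\<And>b. b \<in> B \<Longrightarrow> e b \<in> carrier M" "\<And>b. b \<in> B \<Longrightarrow> h (e b) = unit_vector R B t b"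
    and v: "v \<in> carrier (fun_module R B)"
  shows "h (\<Oplus>\<^bsub>M\<^esub> b \<in> B. v b \<odot>\<^bsub>M\<^esub> e b) = t \<odot>\<^bsub>fun_module R B\<^esub> v"
proof -
  let ?F = "fun_module R B"
  have vc: "v b \<in> carrier R" if "b \<in> B" for b using v that by auto
  let ?x = "\<Oplus>\<^bsub>M\<^esub> b \<in> B. v b \<odot>\<^bsub>M\<^esub> e b"
  have xc: "?x \<in> carrier M" using vc e(1) by (auto intro!: M.finsum_closed)
  have hx: "h ?x \<in> carrier ?F" by (rule linear_map_closed[OF h xc])
  have "h ?x b = (t \<odot>\<^bsub>?F\<^esub> v) b" if b: "b \<in> B" for b
  proof -
    have hb: "h m b \<in> carrier R" if "m \<in> carrier M" for m
      using linear_map_closed[OF h that] b by auto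
    have "linear_map R M (self_module R) (\<lambda>m. h m b)"
      unfolding linear_map_def
      using hb b by (auto simp: linear_map_add[OF h] linear_map_smult[OF h])
    then have "h ?x b = (\<Oplus>\<^bsub>self_module R\<^esub> b' \<in> B. h (v b' \<odot>\<^bsub>M\<^esub> e b') b)"
      by (rule linear_map_finsum[OF module_axioms R.module_self_module _ B]) (use vc e(1) in auto)
    \<comment> \<open>Finite sums see only the carrier, zero and addition, which
      \<open>self_module R\<close> shares with \<open>R\<close>.\<close>
    also have "\<dots> = (\<Oplus>b' \<in> B. h (v b' \<odot>\<^bsub>M\<^esub> e b') b)"
      by (simp add: finsum_def finprod_def self_module_def)
    also have "\<dots> = (\<Oplus>b' \<in> B. if b = b' then t \<otimes> v b' else \<zero>)"
      using vc e b t by (intro R.finsum_cong') (auto simp: linear_map_smult[OF h] R.m_comm)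
    also have "\<dots> = t \<otimes> v b" by (rule R.finsum_singleton) (use b B vc t in auto)
    finally show ?thesis using b by simp
  qed
  moreover have "t \<odot>\<^bsub>?F\<^esub> v \<in> carrier ?F" using t vc by auto
  ultimately show ?thesis using hx unfolding fun_module_simps(1) by (intro PiE_ext)
qed

text \<open>The preimages \<open>e b\<close> of the unit vectors are a basis. A basis is a set here,
  so they must be distinct, which is where \<open>\<one> \<noteq> \<zero>\<close> enters.\<close>

lemma (in module) free_module_if_bij_betw:
  assumes B: "finite B" and one: "\<one> \<noteq> \<zero>" and h: "linear_map R M (fun_module R B) h"
    and bij: "bij_betw h (carrier M) (carrier (fun_module R B))"
  shows "free_module R M"
proof -
  let ?F = "fun_module R B"
  have "\<forall>b \<in> B. \<exists>m \<in> carrier M. h m = unit_vector R B \<one> b"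
  proof
    fix b
    have "unit_vector R B \<one> b \<in> h ` carrier M" using bij by (auto simp: bij_betw_def)
    then show "\<exists>m \<in> carrier M. h m = unit_vector R B \<one> b" by auto
  qed
  then obtain e where e: "\<And>b. b \<in> B \<Longrightarrow> e b \<in> carrier M" "\<And>b. b \<in> B \<Longrightarrow> h (e b) = unit_vector R B \<one> b"
    by metis
  have inj: "inj_on e B"
  proof (rule inj_onI)
    fix b b' assume bb: "b \<in> B" "b' \<in> B" "e b = e b'"
    then have "unit_vector R B \<one> b = unit_vector R B \<one> b'" using e(2) by metis
    then have "unit_vector R B \<one> b b = unit_vector R B \<one> b' b" by (rule fun_cong)
    then show "b = b'" using one bb by (auto split: if_splits)
  qed
  have hc: "h (\<Oplus>\<^bsub>M\<^esub> x \<in> e ` B. c x \<odot>\<^bsub>M\<^esub> x) = (\<lambda>b \<in> B. c (e b))" if c: "c \<in> e ` B \<rightarrow> carrier R" for c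
  proof -
    have ce: "c (e b) \<in> carrier R" if "b \<in> B" for b using c that by auto
    have "(\<Oplus>\<^bsub>M\<^esub> x \<in> e ` B. c x \<odot>\<^bsub>M\<^esub> x) = (\<Oplus>\<^bsub>M\<^esub> b \<in> B. c (e b) \<odot>\<^bsub>M\<^esub> e b)"
      by (rule M.finsum_reindex) (use ce e(1) inj in auto)
    also have "\<dots> = (\<Oplus>\<^bsub>M\<^esub> b \<in> B. (\<lambda>b \<in> B. c (e b)) b \<odot>\<^bsub>M\<^esub> e b)"
      by (rule M.finsum_cong') (use ce e(1) in auto)
    finally have "h (\<Oplus>\<^bsub>M\<^esub> x \<in> e ` B. c x \<odot>\<^bsub>M\<^esub> x) = \<one> \<odot>\<^bsub>?F\<^esub> (\<lambda>b \<in> B. c (e b))"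
      using linear_combination_of_preimages[OF B h R.one_closed e, of "\<lambda>b \<in> B. c (e b)"] ce
      by (simp del: fun_module_simps(4))
    then show ?thesis using ce by (auto intro!: restrict_ext)
  qed
  have eB: "finite (e ` B)" "e ` B \<subseteq> carrier M" using B e(1) by auto
  have "module_basis R M (e ` B)"
    unfolding module_basis_finite_iff[OF eB]
  proof
    fix x assume x: "x \<in> carrier M"
    have hx: "h x \<in> carrier ?F" by (rule linear_map_closed[OF h x])
    \<comment> \<open>The coefficients of \<open>x\<close> are the coordinates of
      \<open>h x\<close>, carried over along the bijection \<open>e\<close>.\<close>
    define c where "c = (\<lambda>y \<in> e ` B. h x (inv_into B e y))"
    have ce: "c (e b) = h x b" if "b \<in> B" for b
      using that inj by (simp add: c_def inv_into_f_f)
    have hxc: "h x b \<in> carrier R" if "b \<in> B" for b using hx that by auto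
    have cc: "c \<in> e ` B \<rightarrow>\<^sub>E carrier R"
      using ce hxc by (auto simp: c_def inj inv_into_f_f)
    have sc: "(\<Oplus>\<^bsub>M\<^esub> y \<in> e ` B. d y \<odot>\<^bsub>M\<^esub> y) \<in> carrier M" if "d \<in> e ` B \<rightarrow> carrier R" for d
      using that e(1) by (intro M.finsum_closed) auto
    show "\<exists>!c. c \<in> e ` B \<rightarrow>\<^sub>E carrier R \<and> x = (\<Oplus>\<^bsub>M\<^esub> b \<in> e ` B. c b \<odot>\<^bsub>M\<^esub> b)"
    proof (rule ex1I[of _ c], intro conjI)
      have c': "c \<in> e ` B \<rightarrow> carrier R" using cc by auto
      have "h (\<Oplus>\<^bsub>M\<^esub> y \<in> e ` B. c y \<odot>\<^bsub>M\<^esub> y) = (\<lambda>b \<in> B. h x b)"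
        unfolding hc[OF c'] using ce by (auto intro!: restrict_ext)
      also have "\<dots> = h x" using hx by (auto simp: PiE_def extensional_restrict)
      finally have "h (\<Oplus>\<^bsub>M\<^esub> y \<in> e ` B. c y \<odot>\<^bsub>M\<^esub> y) = h x" .
      then show "x = (\<Oplus>\<^bsub>M\<^esub> y \<in> e ` B. c y \<odot>\<^bsub>M\<^esub> y)"
        using bij sc[OF c'] x unfolding bij_betw_def by (metis inj_onD)
    next
      fix d assume d: "d \<in> e ` B \<rightarrow>\<^sub>E carrier R \<and> x = (\<Oplus>\<^bsub>M\<^esub> y \<in> e ` B. d y \<odot>\<^bsub>M\<^esub> y)"
      then have "d \<in> e ` B \<rightarrow> carrier R" by auto
      from hc[OF this] have "h x = (\<lambda>b \<in> B. d (e b))" using d by simp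
      then have "d (e b) = c (e b)" if "b \<in> B" for b using ce[OF that] that by simp
      then show "d = c" using d cc by (auto intro!: PiE_ext[of d "e ` B" _ c])
    qed (rule cc)
  qed
  then show ?thesis unfolding free_module_def by blast
qed

abbreviation evaluation :: "('b \<Rightarrow> 'a) set \<Rightarrow> 'b \<Rightarrow> ('b \<Rightarrow> 'a) \<Rightarrow> 'a" where
  "evaluation B m \<equiv> \<lambda>b \<in> B. b m"

text \<open>\<open>B_generate\<close> and \<open>B_independent\<close> say that pulling functionals
  on \<open>R^B\<close> back along the evaluation map is a bijection onto the functionals on
  \<open>M\<close>. This is the only form in which the freeness of the dual is used. Below,
  \<open>U\<close> is the image of the evaluation map and \<open>F/U\<close> its cokernel.\<close>

locale dual_basis = module R M for R (structure) and M (structure) +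
  fixes B
  assumes noetherian_ring: "noetherian_ring R"
    and noetherian_module: "noetherian_module R M"
    and finite_B: "finite B"
    and B_linear: "b \<in> B \<Longrightarrow> linear_map R M (self_module R) b"
    and B_generate: "linear_map R M (self_module R) g \<Longrightarrow>
      \<exists>c \<in> B \<rightarrow> carrier R. \<forall>m \<in> carrier M. g m = pairing R B c (evaluation B m)"
    and B_independent: "c \<in> B \<rightarrow> carrier R \<Longrightarrow>
      (\<And>m. m \<in> carrier M \<Longrightarrow> pairing R B c (evaluation B m) = \<zero>\<^bsub>R\<^esub>) \<Longrightarrow> b \<in> B \<Longrightarrow> c b = \<zero>\<^bsub>R\<^esub>"
begin

abbreviation F where "F \<equiv> fun_module R B"
abbreviation U where "U \<equiv> evaluation B ` carrier M"

sublocale F: module R F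
  by (rule R.module_fun_module)

sublocale S: module R "self_module R"
  by (rule R.module_self_module)

section \<open>The evaluation map, its kernel and its cokernel\<close>

lemma linear_evaluation: "linear_map R M F (evaluation B)"
proof -
  note D = linear_functionalD[OF B_linear]
  show ?thesis
    unfolding linear_map_def fun_module_simps
  proof (intro conjI ballI funcsetI)
    fix m n assume m: "m \<in> carrier M"
    show "evaluation B m \<in> B \<rightarrow>\<^sub>E carrier R" using D(1) m by auto
    assume "n \<in> carrier M"
    then show "evaluation B (m \<oplus>\<^bsub>M\<^esub> n) = (\<lambda>b \<in> B. evaluation B m b \<oplus> evaluation B n b)"
      using D(2) m by (intro restrict_ext) simp
  next
    fix a m assume "a \<in> carrier R" "m \<in> carrier M"
    then show "evaluation B (a \<odot>\<^bsub>M\<^esub> m) = (\<lambda>b \<in> B. a \<otimes> evaluation B m b)"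
      using D(3) by (intro restrict_ext) simp
  qed
qed

lemma evaluation_closed: "m \<in> carrier M \<Longrightarrow> evaluation B m \<in> carrier F"
  by (rule linear_map_closed[OF linear_evaluation])

lemma evaluation_add:
  "m \<in> carrier M \<Longrightarrow> n \<in> carrier M \<Longrightarrow>
    evaluation B (m \<oplus>\<^bsub>M\<^esub> n) = evaluation B m \<oplus>\<^bsub>F\<^esub> evaluation B n"
  by (rule linear_map_add[OF linear_evaluation])

lemma evaluation_smult:
  "a \<in> carrier R \<Longrightarrow> m \<in> carrier M \<Longrightarrow>
    evaluation B (a \<odot>\<^bsub>M\<^esub> m) = a \<odot>\<^bsub>F\<^esub> evaluation B m"
  by (rule linear_map_smult[OF linear_evaluation])

lemma submodule_U: "submodule U R F"
  by (rule submodule_image[OF module_axioms F.module_axioms linear_evaluation carrier_is_submodule])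

lemma zero_vector_iff: "v \<in> carrier F \<Longrightarrow> v = \<zero>\<^bsub>F\<^esub> \<longleftrightarrow> (\<forall>b \<in> B. v b = \<zero>)"
  using PiE_ext[of v B "\<lambda>_. carrier R" "\<lambda>b \<in> B. \<zero>"] by auto

text \<open>\<open>B_independent\<close> excludes a nonzero functional on \<open>R^B\<close> that
  vanishes on \<open>U\<close>, so the support hypothesis of \<open>ex_separating_functional\<close>
  with \<open>I = {\<zero>}\<close> must fail.\<close>

lemma image_contains_multiples:
  assumes s: "s \<in> carrier R" and p: "primeideal (annih R s) R"
  obtains t where "t \<in> carrier R" "t \<notin> annih R s" "\<And>v. v \<in> carrier F \<Longrightarrow> t \<odot>\<^bsub>F\<^esub> v \<in> U"
proof -
  have "\<exists>t \<in> carrier R - annih R s. \<forall>v \<in> carrier F. t \<odot>\<^bsub>F\<^esub> v \<in> U"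
  proof (rule ccontr)
    assume no: "\<not> ?thesis"
    have zero: "ideal {\<zero>} R" by (rule R.zeroideal)
    have supp: "\<exists>v \<in> carrier F. t \<odot>\<^bsub>F\<^esub> v \<notin> U" if "t \<in> carrier R - annih R s" for t
      using no that by blast
    have eq: "r \<in> annih R s \<longleftrightarrow> r \<otimes> s \<in> {\<zero>}" if "r \<in> carrier R" for r
      using that by (simp add: annih_def)
    obtain c where c: "c \<in> B \<rightarrow> carrier R" "\<And>v. v \<in> U \<Longrightarrow> pairing R B c v \<in> {\<zero>}"
      "\<exists>b \<in> B. c b \<notin> {\<zero>}"
      by (rule R.ex_separating_functional[OF noetherian_ring finite_B submodule_U p s zero eq supp]) blast+
    have "c b = \<zero>" if "b \<in> B" for b
      by (rule B_independent[OF c(1) _ that]) (use c(2) in blast)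
    then show False using c(3) by blast
  qed
  then show thesis using that by blast
qed

end

context dual_basis begin

lemma annih_eq_colon: "annih R s = colon R (self_module R) {\<zero>} s"
  by (simp add: annih_def colon_def)

text \<open>For a prime minimal over \<open>I\<close> the colon ideal found is that prime itself, so
  minimal primes are associated to \<open>R/I\<close>. The uses are the zero ideal and the principal
  ideal of a regular element.\<close>

lemma ex_associated_prime_of_ring:
  assumes I: "ideal I R" and p: "primeideal p R" and "I \<subseteq> p"
  obtains s where "s \<in> carrier R" "primeideal (colon R (self_module R) I s) R"
    "colon R (self_module R) I s \<subseteq> p"
proof -
  interpret p: primeideal p R by fact
  let ?T = "carrier R - p"
  have Is: "submodule I R (self_module R)" using I by (simp add: R.ideal_iff_submodule)
  have T: "\<one> \<in> ?T" "\<And>a b. a \<in> ?T \<Longrightarrow> b \<in> ?T \<Longrightarrow> a \<otimes> b \<in> ?T"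
    using p.one_imp_carrier p.I_notcarr p.I_prime by auto
  have "colon R (self_module R) I \<one> \<inter> ?T = {}"
    using \<open>I \<subseteq> p\<close> by (auto simp: colon_def)
  then obtain r where r: "r \<in> carrier R"
    "primeideal (colon R (self_module R) I (r \<odot>\<^bsub>self_module R\<^esub> \<one>)) R"
    "colon R (self_module R) I (r \<odot>\<^bsub>self_module R\<^esub> \<one>) \<inter> ?T = {}"
    using S.ex_colon_prime[OF noetherian_ring Is _ _ T, of \<one>] by auto
  have "colon R (self_module R) I r \<subseteq> p"
    using r(1,3) by (auto simp: colon_def)
  then show thesis using that r(1,2) by simp
qed

lemma image_contains_multiples_at_minimal_prime:
  assumes p: "primeideal p R" and min: "\<And>q. primeideal q R \<Longrightarrow> q \<subseteq> p \<Longrightarrow> q = p"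
  obtains s t where "s \<in> carrier R" "p = annih R s" "t \<in> carrier R" "t \<notin> p"
    "\<And>v. v \<in> carrier F \<Longrightarrow> t \<odot>\<^bsub>F\<^esub> v \<in> U"
proof -
  interpret p: primeideal p R by fact
  have "{\<zero>} \<subseteq> p" using p.zero_closed by simp
  then obtain s where s: "s \<in> carrier R" "primeideal (annih R s) R" "annih R s \<subseteq> p"
    using ex_associated_prime_of_ring[OF R.zeroideal p] unfolding annih_eq_colon by blast
  then have ps: "p = annih R s" using min by metis
  then show thesis using image_contains_multiples[OF s(1,2)] that[OF s(1) ps] by blast
qed

text \<open>Serre's condition on \<open>M\<close> will supply \<open>min\<close>. A nonzero kernel
  has an associated prime \<open>p = (0 : y)\<close>, minimal by \<open>min\<close>, at which the
  evaluation map has a section \<open>k\<close> up to a factor \<open>t0\<close>. Since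
  \<open>y\<close> keeps \<open>M\<close> larger than the image of \<open>k\<close> at
  \<open>p\<close>, there is a functional that vanishes on this image and is not killed by
  \<open>t0\<close>; but \<open>t0\<close> kills all its coefficients.\<close>

lemma inj_evaluation:
  assumes min: "\<And>p q x. x \<in> carrier M \<Longrightarrow> primeideal p R \<Longrightarrow> colon R M {\<zero>\<^bsub>M\<^esub>} x = p \<Longrightarrow>
      primeideal q R \<Longrightarrow> q \<subseteq> p \<Longrightarrow> q = p"
    and x: "x \<in> carrier M" and ex: "evaluation B x = \<zero>\<^bsub>F\<^esub>"
  shows "x = \<zero>\<^bsub>M\<^esub>"
proof (rule ccontr)
  assume nz: "x \<noteq> \<zero>\<^bsub>M\<^esub>"
  have z: "submodule {\<zero>\<^bsub>M\<^esub>} R M" by (rule submoduleI') auto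
  have "colon R M {\<zero>\<^bsub>M\<^esub>} x \<inter> {\<one>} = {}" using nz x by (auto simp: colon_def)
  then obtain r where r: "r \<in> carrier R" "primeideal (colon R M {\<zero>\<^bsub>M\<^esub>} (r \<odot>\<^bsub>M\<^esub> x)) R"
    by (rule_tac ex_colon_prime[OF noetherian_ring z x, of "{\<one>}"]) auto
  define y where "y = r \<odot>\<^bsub>M\<^esub> x"
  have y: "y \<in> carrier M" using r x by (simp add: y_def)
  have ey: "evaluation B y = \<zero>\<^bsub>F\<^esub>"
    unfolding y_def evaluation_smult[OF r(1) x] ex by (rule F.smult_r_null[OF r(1)])
  define p where "p = colon R M {\<zero>\<^bsub>M\<^esub>} y"
  have p: "primeideal p R" using r(2) by (simp add: p_def y_def)
  interpret p: primeideal p R by fact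
  obtain s t0 where s: "s \<in> carrier R" "p = annih R s" and t0: "t0 \<in> carrier R" "t0 \<notin> p"
    and t0U: "\<And>v. v \<in> carrier F \<Longrightarrow> t0 \<odot>\<^bsub>F\<^esub> v \<in> U"
    using image_contains_multiples_at_minimal_prime[OF p min[OF y p p_def[symmetric]]] by metis
  have unit: "t0 \<odot>\<^bsub>F\<^esub> unit_vector R B \<one> b = unit_vector R B t0 b" for b
    using t0 by (auto intro!: restrict_ext)
  have "\<forall>b. \<exists>m \<in> carrier M. evaluation B m = unit_vector R B t0 b"
  proof
    fix b
    have "unit_vector R B t0 b \<in> U"
      using t0U[of "unit_vector R B \<one> b"] unfolding unit by simp
    then show "\<exists>m \<in> carrier M. evaluation B m = unit_vector R B t0 b"
      by (elim imageE) (rule bexI, erule sym)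
  qed
  then obtain e where e: "\<And>b. e b \<in> carrier M" "\<And>b. evaluation B (e b) = unit_vector R B t0 b"
    by metis
  \<comment> \<open>The evaluation of \<open>k v\<close> is \<open>t0 v\<close>.\<close>
  define k where "k v = (\<Oplus>\<^bsub>M\<^esub> b \<in> B. v b \<odot>\<^bsub>M\<^esub> e b)" for v
  have vc: "v b \<in> carrier R" if "v \<in> carrier F" "b \<in> B" for v b using that by auto
  have ek: "evaluation B (k v) = t0 \<odot>\<^bsub>F\<^esub> v" if "v \<in> carrier F" for v
    unfolding k_def
    by (rule linear_combination_of_preimages[OF finite_B linear_evaluation t0(1)]) (use e that in auto)
  have k_lin: "linear_map R F M k"
    unfolding linear_map_def
  proof (intro conjI ballI funcsetI)
    fix v assume v: "v \<in> carrier F"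
    show "k v \<in> carrier M" unfolding k_def using vc[OF v] e(1) by (intro M.finsum_closed) auto
    fix w assume w: "w \<in> carrier F"
    have "k (v \<oplus>\<^bsub>F\<^esub> w) = (\<Oplus>\<^bsub>M\<^esub> b \<in> B. v b \<odot>\<^bsub>M\<^esub> e b \<oplus>\<^bsub>M\<^esub> w b \<odot>\<^bsub>M\<^esub> e b)"
      unfolding k_def using vc[OF v] vc[OF w] e(1)
      by (intro M.finsum_cong') (auto simp: smult_l_distr)
    also have "\<dots> = k v \<oplus>\<^bsub>M\<^esub> k w"
      unfolding k_def using vc[OF v] vc[OF w] e(1) by (intro M.finsum_addf) auto
    finally show "k (v \<oplus>\<^bsub>F\<^esub> w) = k v \<oplus>\<^bsub>M\<^esub> k w" .
  next
    fix a v assume a: "a \<in> carrier R" and v: "v \<in> carrier F"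
    have "k (a \<odot>\<^bsub>F\<^esub> v) = (\<Oplus>\<^bsub>M\<^esub> b \<in> B. a \<odot>\<^bsub>M\<^esub> (v b \<odot>\<^bsub>M\<^esub> e b))"
      unfolding k_def using a vc[OF v] e(1)
      by (intro M.finsum_cong') (auto simp: smult_assoc1)
    also have "\<dots> = a \<odot>\<^bsub>M\<^esub> k v"
      unfolding k_def using a vc[OF v] e(1) finite_B by (intro finsum_smult_ldistr[symmetric]) auto
    finally show "k (a \<odot>\<^bsub>F\<^esub> v) = a \<odot>\<^bsub>M\<^esub> k v" .
  qed
  let ?W = "k ` carrier F"
  have W: "submodule ?W R M"
    by (rule submodule_image[OF F.module_axioms module_axioms k_lin F.carrier_is_submodule])
  \<comment> \<open>If \<open>u y = k v\<close>, evaluating gives \<open>t0 v = 0\<close>, hence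
    \<open>t0 u y = k (t0 v) = 0\<close>, although \<open>t0\<close> and \<open>u\<close> lie
    outside the prime \<open>p = (0 : y)\<close>.\<close>
  have supp: "\<exists>m \<in> carrier M. u \<odot>\<^bsub>M\<^esub> m \<notin> ?W" if u: "u \<in> carrier R - p" for u
  proof (rule bexI[OF _ y], rule notI)
    assume "u \<odot>\<^bsub>M\<^esub> y \<in> ?W"
    then obtain v where v: "v \<in> carrier F" "u \<odot>\<^bsub>M\<^esub> y = k v" by blast
    have uc: "u \<in> carrier R" using u by simp
    have "t0 \<odot>\<^bsub>F\<^esub> v = evaluation B (u \<odot>\<^bsub>M\<^esub> y)" unfolding v(2) using ek[OF v(1)] by simp
    also have "\<dots> = \<zero>\<^bsub>F\<^esub>" unfolding evaluation_smult[OF uc y] ey by (rule F.smult_r_null[OF uc])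
    finally have tv: "t0 \<odot>\<^bsub>F\<^esub> v = \<zero>\<^bsub>F\<^esub>" .
    have "(t0 \<otimes> u) \<odot>\<^bsub>M\<^esub> y = t0 \<odot>\<^bsub>M\<^esub> k v"
      using t0 uc y v(2) by (simp add: smult_assoc1)
    also have "\<dots> = k (t0 \<odot>\<^bsub>F\<^esub> v)" using linear_map_smult[OF k_lin t0(1) v(1)] by simp
    also have "\<dots> = \<zero>\<^bsub>M\<^esub>"
      unfolding tv by (rule linear_map_zero[OF F.module_axioms module_axioms k_lin])
    finally have "t0 \<otimes> u \<in> p" unfolding p_def colon_def using t0 uc by simp
    then show False using p.I_prime[OF t0(1) uc] t0(2) u by blast
  qed
  obtain N z t where N: "submodule N R M" "?W \<subseteq> N" and z: "z \<in> carrier M"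
    and t: "t \<in> carrier R" "t \<notin> p" and col: "colon R M N z = p"
    and dec: "\<And>m. m \<in> carrier M \<Longrightarrow>
       \<exists>a \<in> carrier R. \<exists>n \<in> N. t \<odot>\<^bsub>M\<^esub> m = a \<odot>\<^bsub>M\<^esub> z \<oplus>\<^bsub>M\<^esub> n"
    by (rule ex_torsion_free_quotient[OF noetherian_module p W supp]) blast+
  note NE = submoduleE[OF N(1)]
  have Nc: "n \<in> carrier M" if "n \<in> N" for n using NE(1) that by blast
  \<comment> \<open>\<open>\<alpha>\<close> is an arbitrary choice and need not be linear; only the
    class of \<open>\<alpha> m\<close> modulo \<open>p\<close> is determined. Since \<open>p\<close>
    annihilates \<open>s\<close>, the product \<open>\<alpha> m \<otimes> s\<close> is determined,
    and therefore linear in \<open>m\<close>.\<close>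
  obtain \<alpha> where \<alpha>: "\<And>m. m \<in> carrier M \<Longrightarrow> \<alpha> m \<in> carrier R"
    "\<And>m. m \<in> carrier M \<Longrightarrow> \<exists>n \<in> N. t \<odot>\<^bsub>M\<^esub> m = \<alpha> m \<odot>\<^bsub>M\<^esub> z \<oplus>\<^bsub>M\<^esub> n"
    using dec by metis
  have uniq: "\<alpha> m \<otimes> s = a \<otimes> s"
    if m: "m \<in> carrier M" and a: "a \<in> carrier R" "n \<in> N" "t \<odot>\<^bsub>M\<^esub> m = a \<odot>\<^bsub>M\<^esub> z \<oplus>\<^bsub>M\<^esub> n"
    for m a n
  proof -
    obtain n' where n': "n' \<in> N" "t \<odot>\<^bsub>M\<^esub> m = \<alpha> m \<odot>\<^bsub>M\<^esub> z \<oplus>\<^bsub>M\<^esub> n'" using \<alpha>(2)[OF m] by blast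
    note \<alpha>c = \<alpha>(1)[OF m]
    have az: "a \<odot>\<^bsub>M\<^esub> z \<in> carrier M" using a z by simp
    have "(\<alpha> m \<ominus> a) \<odot>\<^bsub>M\<^esub> z \<oplus>\<^bsub>M\<^esub> n' = t \<odot>\<^bsub>M\<^esub> m \<oplus>\<^bsub>M\<^esub> \<ominus>\<^bsub>M\<^esub> (a \<odot>\<^bsub>M\<^esub> z)"
      unfolding n'(2) using \<alpha>c a(1) z Nc[OF n'(1)]
      by (simp add: a_minus_def smult_l_distr smult_l_minus M.a_ac)
    also have "\<dots> = n"
      unfolding a(3) using az Nc[OF a(2)] by (simp add: M.a_ac M.r_neg M.r_neg1 M.r_neg2)
    finally have "(\<alpha> m \<ominus> a) \<odot>\<^bsub>M\<^esub> z \<oplus>\<^bsub>M\<^esub> n' \<in> N" using a(2) by simp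
    then have "(\<alpha> m \<ominus> a) \<odot>\<^bsub>M\<^esub> z \<in> N"
      by (rule submodule_add_cancel[OF N(1) n'(1) smult_closed[OF R.minus_closed[OF \<alpha>c a(1)] z]])
    then have "\<alpha> m \<ominus> a \<in> p" unfolding col[symmetric] colon_def using \<alpha>c a(1) by simp
    then have "(\<alpha> m \<ominus> a) \<otimes> s = \<zero>" unfolding s(2) annih_def by simp
    then have "\<alpha> m \<otimes> s \<ominus> a \<otimes> s = \<zero>"
      using \<alpha>c a(1) s(1) by (simp add: a_minus_def R.l_distr R.l_minus)
    then show ?thesis using \<alpha>c a(1) s(1) by (simp add: R.r_right_minus_eq)
  qed
  have g_lin: "linear_map R M (self_module R) (\<lambda>m. \<alpha> m \<otimes> s)"
    unfolding linear_map_def self_module_simps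
  proof (intro conjI ballI funcsetI)
    fix m assume m: "m \<in> carrier M"
    note am = \<alpha>(1)[OF m]
    show "\<alpha> m \<otimes> s \<in> carrier R" using am s by simp
    obtain n where n: "n \<in> N" "t \<odot>\<^bsub>M\<^esub> m = \<alpha> m \<odot>\<^bsub>M\<^esub> z \<oplus>\<^bsub>M\<^esub> n" using \<alpha>(2)[OF m] by blast
    fix m' assume m': "m' \<in> carrier M"
    note am' = \<alpha>(1)[OF m']
    obtain n' where n': "n' \<in> N" "t \<odot>\<^bsub>M\<^esub> m' = \<alpha> m' \<odot>\<^bsub>M\<^esub> z \<oplus>\<^bsub>M\<^esub> n'" using \<alpha>(2)[OF m'] by blast
    have "t \<odot>\<^bsub>M\<^esub> (m \<oplus>\<^bsub>M\<^esub> m') = (\<alpha> m \<oplus> \<alpha> m') \<odot>\<^bsub>M\<^esub> z \<oplus>\<^bsub>M\<^esub> (n \<oplus>\<^bsub>M\<^esub> n')"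
      using n(2) n'(2) t(1) m m' am am' z Nc[OF n(1)] Nc[OF n'(1)]
      by (simp add: smult_r_distr smult_l_distr M.a_ac)
    then have "\<alpha> (m \<oplus>\<^bsub>M\<^esub> m') \<otimes> s = (\<alpha> m \<oplus> \<alpha> m') \<otimes> s"
      using uniq[of "m \<oplus>\<^bsub>M\<^esub> m'" "\<alpha> m \<oplus> \<alpha> m'" "n \<oplus>\<^bsub>M\<^esub> n'"] m m' am am' NE(5)[OF n(1) n'(1)] by simp
    then show "\<alpha> (m \<oplus>\<^bsub>M\<^esub> m') \<otimes> s = \<alpha> m \<otimes> s \<oplus> \<alpha> m' \<otimes> s"
      using am am' s(1) by (simp add: R.l_distr)
  next
    fix a m assume a: "a \<in> carrier R" and m: "m \<in> carrier M"
    note am = \<alpha>(1)[OF m]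
    obtain n where n: "n \<in> N" "t \<odot>\<^bsub>M\<^esub> m = \<alpha> m \<odot>\<^bsub>M\<^esub> z \<oplus>\<^bsub>M\<^esub> n" using \<alpha>(2)[OF m] by blast
    have "t \<odot>\<^bsub>M\<^esub> (a \<odot>\<^bsub>M\<^esub> m) = a \<odot>\<^bsub>M\<^esub> (t \<odot>\<^bsub>M\<^esub> m)"
      using t(1) a m by (simp add: smult_assoc1[symmetric] R.m_comm)
    also have "\<dots> = (a \<otimes> \<alpha> m) \<odot>\<^bsub>M\<^esub> z \<oplus>\<^bsub>M\<^esub> a \<odot>\<^bsub>M\<^esub> n"
      unfolding n(2) using a am z Nc[OF n(1)] by (simp add: smult_r_distr smult_assoc1)
    finally have "\<alpha> (a \<odot>\<^bsub>M\<^esub> m) \<otimes> s = (a \<otimes> \<alpha> m) \<otimes> s"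
      using uniq[of "a \<odot>\<^bsub>M\<^esub> m" "a \<otimes> \<alpha> m" "a \<odot>\<^bsub>M\<^esub> n"] a m am NE(4)[OF a n(1)] by simp
    then show "\<alpha> (a \<odot>\<^bsub>M\<^esub> m) \<otimes> s = a \<otimes> (\<alpha> m \<otimes> s)" using a am s(1) by (simp add: R.m_assoc)
  qed
  then obtain d where d: "d \<in> B \<rightarrow> carrier R"
    "\<And>m. m \<in> carrier M \<Longrightarrow> \<alpha> m \<otimes> s = pairing R B d (evaluation B m)"
    using B_generate by blast
  \<comment> \<open>\<open>e b\<close> lies in the image of \<open>k\<close>, where the functional
    vanishes. Its evaluation is \<open>t0\<close> times a unit vector, so the vanishing value is
    \<open>t0\<close> times the coefficient at \<open>b\<close>.\<close>
  have dt: "t0 \<otimes> d b = \<zero>" if b: "b \<in> B" for b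
  proof -
    have "e b = k (unit_vector R B \<one> b)"
    proof -
      have "k (unit_vector R B \<one> b) = (\<Oplus>\<^bsub>M\<^esub> b' \<in> B. if b = b' then e b' else \<zero>\<^bsub>M\<^esub>)"
        unfolding k_def using e(1) by (intro M.finsum_cong') auto
      also have "\<dots> = e b" by (rule M.finsum_singleton) (use b finite_B e(1) in auto)
      finally show ?thesis by simp
    qed
    then have "e b \<in> ?W" by (intro image_eqI) auto
    then have eN: "e b \<in> N" using N(2) by blast
    have "\<alpha> (e b) \<otimes> s = \<zero> \<otimes> s"
      by (rule uniq[OF e(1) _ NE(4)[OF t(1) eN]]) (use t e z in auto)
    moreover have "pairing R B d (evaluation B (e b)) = d b \<otimes> t0"
      unfolding e(2) by (rule R.pairing_unit_vector[OF finite_B d(1) t0(1) b])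
    ultimately have "d b \<otimes> t0 = \<zero>" using d(2)[OF e(1), of b] s(1) by simp
    moreover have "d b \<in> carrier R" using d(1) b by auto
    ultimately show ?thesis using t0(1) by (simp add: R.m_comm)
  qed
  \<comment> \<open>The decomposition of \<open>t z\<close> with coefficient \<open>t\<close> and
    remainder zero shows that the functional takes the value \<open>t \<otimes> s\<close> at
    \<open>z\<close>.\<close>
  have "t0 \<otimes> (t \<otimes> s) = t0 \<otimes> pairing R B d (evaluation B z)"
  proof -
    have "\<alpha> z \<otimes> s = t \<otimes> s"
      by (rule uniq[OF z t(1) submodule_zero[OF N(1)]]) (use t z in auto)
    then show ?thesis using d(2)[OF z] by simp
  qed
  also have "\<dots> = \<zero>"
  proof -
    have ez: "evaluation B z \<in> B \<rightarrow> carrier R" using evaluation_closed[OF z] by auto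
    have "t0 \<otimes> pairing R B d (evaluation B z) = t0 \<otimes> pairing R B (evaluation B z) d"
      using R.pairing_commute[OF d(1) ez] by simp
    also have "\<dots> = pairing R B (evaluation B z) (\<lambda>b. t0 \<otimes> d b)"
      by (rule R.pairing_smult_right[OF finite_B ez d(1) t0(1), symmetric])
    also have "\<dots> = \<zero>"
      unfolding pairing_def using dt linear_functionalD(1)[OF B_linear z]
      by (intro R.add.finprod_one_eqI) auto
    finally show ?thesis .
  qed
  finally have "t0 \<otimes> t \<in> p" unfolding s(2) annih_def using t0(1) t(1) s(1) by (simp add: R.m_assoc)
  then show False using p.I_prime[OF t0(1) t(1)] t0(2) t(2) by blast
qed

text \<open>The ideal \<open>J\<close> of all elements multiplying \<open>F\<close> into
  \<open>U\<close> lies in no associated prime of \<open>R\<close>, and such an ideal contains a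
  nonzerodivisor.\<close>

lemma ex_regular_conductor:
  obtains x where "x \<in> carrier R" "\<And>v. v \<in> carrier F \<Longrightarrow> x \<odot>\<^bsub>F\<^esub> v \<in> U"
    "\<And>r. r \<in> carrier R \<Longrightarrow> r \<otimes> x = \<zero> \<Longrightarrow> r = \<zero>"
proof -
  define J where "J = {t \<in> carrier R. \<forall>v \<in> carrier F. t \<odot>\<^bsub>F\<^esub> v \<in> U}"
  note UE = F.submoduleE[OF submodule_U]
  have "submodule J R (self_module R)"
  proof (rule S.submoduleI')
    show "\<zero>\<^bsub>self_module R\<^esub> \<in> J"
      unfolding J_def using F.submodule_zero[OF submodule_U] F.smult_l_null
      by (simp del: fun_module_simps)
  next
    fix a b assume "a \<in> J" "b \<in> J"
    then show "a \<oplus>\<^bsub>self_module R\<^esub> b \<in> J"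
      unfolding J_def using UE(5) by (simp add: F.smult_l_distr del: fun_module_simps)
  next
    fix a b assume "a \<in> carrier R" "b \<in> J"
    then show "a \<odot>\<^bsub>self_module R\<^esub> b \<in> J"
      unfolding J_def using UE(4) by (simp add: F.smult_assoc1 del: fun_module_simps)
  qed (auto simp: J_def)
  then have J: "ideal J R" by (simp add: R.ideal_iff_submodule)
  have avoid: "\<not> J \<subseteq> annih R s" if s: "s \<in> carrier R" "primeideal (annih R s) R" for s
  proof -
    obtain t where "t \<in> carrier R" "t \<notin> annih R s" "\<And>v. v \<in> carrier F \<Longrightarrow> t \<odot>\<^bsub>F\<^esub> v \<in> U"
      by (rule image_contains_multiples[OF s]) blast+
    then have "t \<in> J" unfolding J_def by simp
    then show ?thesis using \<open>t \<notin> annih R s\<close> by blast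
  qed
  obtain x where x: "x \<in> J" and reg: "\<And>r. r \<in> carrier R \<Longrightarrow> r \<otimes> x = \<zero> \<Longrightarrow> r = \<zero>"
    by (rule R.ex_regular_element[OF noetherian_ring J avoid]) blast+
  from x show thesis unfolding J_def by (intro that[OF _ _ reg]) auto
qed

text \<open>This is the vanishing of \<open>Hom(C, R/xR)\<close> for the cokernel \<open>C\<close> of the evaluation map.\<close>

lemma functional_divisible:
  assumes x: "x \<in> carrier R" and reg: "\<And>r. r \<in> carrier R \<Longrightarrow> r \<otimes> x = \<zero> \<Longrightarrow> r = \<zero>"
    and c: "c \<in> B \<rightarrow> carrier R"
    and div: "\<And>m. m \<in> carrier M \<Longrightarrow> \<exists>r \<in> carrier R. pairing R B c (evaluation B m) = x \<otimes> r"
    and b: "b \<in> B"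
  shows "\<exists>r \<in> carrier R. c b = x \<otimes> r"
proof -
  have cancel: "r = r'" if "x \<otimes> r = x \<otimes> r'" "r \<in> carrier R" "r' \<in> carrier R" for r r'
  proof -
    have "(r \<ominus> r') \<otimes> x = r \<otimes> x \<oplus> \<ominus> (r' \<otimes> x)"
      using that(2,3) x by (simp add: a_minus_def R.l_distr R.l_minus)
    also have "\<dots> = x \<otimes> r \<oplus> \<ominus> (x \<otimes> r')"
      using that(2,3) x by (simp add: R.m_comm)
    also have "\<dots> = \<zero>" unfolding that(1) using that(3) x by (simp add: R.r_neg)
    finally have "r \<ominus> r' = \<zero>" using reg that(2,3) by simp
    then show ?thesis using that by (simp add: R.r_right_minus_eq)
  qed
  \<comment> \<open>Division by the nonzerodivisor \<open>x\<close> is unambiguous, which makes the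
    quotient \<open>g\<close> linear on \<open>M\<close>.\<close>
  obtain g where g: "\<And>m. m \<in> carrier M \<Longrightarrow> g m \<in> carrier R"
    "\<And>m. m \<in> carrier M \<Longrightarrow> pairing R B c (evaluation B m) = x \<otimes> g m"
    using div by metis
  note lin = linear_functionalD[OF R.linear_map_pairing[OF finite_B c]]
  have "linear_map R M (self_module R) g"
    unfolding linear_map_def self_module_simps
  proof (intro conjI ballI funcsetI)
    fix m assume m: "m \<in> carrier M"
    show "g m \<in> carrier R" by (rule g(1)[OF m])
    fix n assume n: "n \<in> carrier M"
    have "x \<otimes> g (m \<oplus>\<^bsub>M\<^esub> n) = pairing R B c (evaluation B (m \<oplus>\<^bsub>M\<^esub> n))"
      using g(2) m n by simp
    also have "\<dots> = x \<otimes> g m \<oplus> x \<otimes> g n"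
      unfolding evaluation_add[OF m n] lin(2)[OF evaluation_closed[OF m] evaluation_closed[OF n]]
      using g(2) m n by simp
    also have "\<dots> = x \<otimes> (g m \<oplus> g n)" using x g(1) m n by (simp add: R.r_distr)
    finally show "g (m \<oplus>\<^bsub>M\<^esub> n) = g m \<oplus> g n" by (rule cancel) (use g(1) m n in auto)
  next
    fix a m assume a: "a \<in> carrier R" and m: "m \<in> carrier M"
    have "x \<otimes> g (a \<odot>\<^bsub>M\<^esub> m) = pairing R B c (evaluation B (a \<odot>\<^bsub>M\<^esub> m))"
      using g(2) a m by simp
    also have "\<dots> = a \<otimes> (x \<otimes> g m)"
      unfolding evaluation_smult[OF a m] lin(3)[OF a evaluation_closed[OF m]] using g(2) m by simp
    also have "\<dots> = x \<otimes> (a \<otimes> g m)" using x g(1) a m by (simp add: R.m_lcomm)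
    finally show "g (a \<odot>\<^bsub>M\<^esub> m) = a \<otimes> g m" by (rule cancel) (use g(1) a m in auto)
  qed
  then obtain d where d: "d \<in> B \<rightarrow> carrier R"
    "\<And>m. m \<in> carrier M \<Longrightarrow> g m = pairing R B d (evaluation B m)"
    using B_generate by blast
  have dc: "d b \<in> carrier R" "c b \<in> carrier R" if "b \<in> B" for b using d(1) c that by auto
  \<comment> \<open>\<open>c - x d\<close> pairs to zero with all of \<open>U\<close>, so
    \<open>B_independent\<close> makes it vanish.\<close>
  let ?h = "\<lambda>b. c b \<oplus> (\<ominus> x) \<otimes> d b"
  have h: "?h \<in> B \<rightarrow> carrier R" using dc x by auto
  have xd: "(\<lambda>b. (\<ominus> x) \<otimes> d b) \<in> B \<rightarrow> carrier R" using dc x by auto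
  have "pairing R B ?h (evaluation B m) = \<zero>" if m: "m \<in> carrier M" for m
  proof -
    have em: "evaluation B m \<in> B \<rightarrow> carrier R" using evaluation_closed[OF m] by auto
    have "pairing R B ?h (evaluation B m) = pairing R B (evaluation B m) ?h"
      by (rule R.pairing_commute[OF h em])
    also have "\<dots> = pairing R B (evaluation B m) c \<oplus> pairing R B (evaluation B m) (\<lambda>b. (\<ominus> x) \<otimes> d b)"
      by (rule R.pairing_add_right[OF em c xd])
    also have "pairing R B (evaluation B m) (\<lambda>b. (\<ominus> x) \<otimes> d b)
        = (\<ominus> x) \<otimes> pairing R B (evaluation B m) d"
      by (rule R.pairing_smult_right[OF finite_B em d(1)]) (use x in simp)
    also have "pairing R B (evaluation B m) d = g m"
      using R.pairing_commute[OF em d(1)] d(2)[OF m] by simp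
    also have "pairing R B (evaluation B m) c = x \<otimes> g m"
      using R.pairing_commute[OF em c] g(2)[OF m] by simp
    also have "x \<otimes> g m \<oplus> (\<ominus> x) \<otimes> g m = \<zero>"
      using x g(1)[OF m] by (simp add: R.l_minus R.r_neg)
    finally show ?thesis .
  qed
  then have "?h b = \<zero>" using B_independent[OF h _ b] by simp
  then have "c b = x \<otimes> d b"
    using dc[OF b] x by (simp add: R.l_minus R.r_right_minus_eq[unfolded a_minus_def])
  then show ?thesis using dc[OF b] by blast
qed

lemma inj_on_evaluation:
  assumes inj: "\<And>m. m \<in> carrier M \<Longrightarrow> evaluation B m = \<zero>\<^bsub>F\<^esub> \<Longrightarrow> m = \<zero>\<^bsub>M\<^esub>"
  shows "inj_on (evaluation B) (carrier M)"
proof (rule inj_onI)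
  fix m n assume that: "m \<in> carrier M" "n \<in> carrier M" "evaluation B m = evaluation B n"
  have n': "(\<ominus> \<one>) \<odot>\<^bsub>M\<^esub> n \<in> carrier M" using that by simp
  have "evaluation B (m \<oplus>\<^bsub>M\<^esub> (\<ominus> \<one>) \<odot>\<^bsub>M\<^esub> n) = evaluation B n \<oplus>\<^bsub>F\<^esub> (\<ominus> \<one>) \<odot>\<^bsub>F\<^esub> evaluation B n"
    unfolding evaluation_add[OF that(1) n'] that(3)
    using evaluation_smult[of "\<ominus> \<one>" n] that(2) by (simp del: fun_module_simps)
  also have "\<dots> = \<zero>\<^bsub>F\<^esub>"
    using evaluation_closed[OF that(2)]
    by (simp add: F.smult_l_minus F.M.r_neg del: fun_module_simps)
  finally have "m \<oplus>\<^bsub>M\<^esub> (\<ominus> \<one>) \<odot>\<^bsub>M\<^esub> n = \<zero>\<^bsub>M\<^esub>"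
    by (rule inj[rotated]) (use that n' in simp)
  then have "m \<oplus>\<^bsub>M\<^esub> (\<ominus>\<^bsub>M\<^esub> n) = \<zero>\<^bsub>M\<^esub>" using that by (simp add: smult_l_minus)
  then show "m = n" using M.minus_equality[of m "\<ominus>\<^bsub>M\<^esub> n"] that by simp
qed

lemma surj_evaluation:
  assumes inj: "\<And>m. m \<in> carrier M \<Longrightarrow> evaluation B m = \<zero>\<^bsub>F\<^esub> \<Longrightarrow> m = \<zero>\<^bsub>M\<^esub>"
    and depth: "\<And>q. primeideal q R \<Longrightarrow> enat 2 \<le> height R q \<Longrightarrow> \<exists>a b. locally_regular_pair R M q a b"
  shows "carrier F \<subseteq> U"
proof (rule ccontr)
  assume "\<not> carrier F \<subseteq> U"
  then obtain y0 where y0: "y0 \<in> carrier F" "y0 \<notin> U" by blast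
  note UE = F.submoduleE[OF submodule_U]
  have "colon R F U y0 \<inter> {\<one>} = {}" using y0 F.smult_one[OF y0(1)] by (simp add: colon_def del: fun_module_simps)
  then obtain r where r: "r \<in> carrier R" "primeideal (colon R F U (r \<odot>\<^bsub>F\<^esub> y0)) R"
    by (rule_tac F.ex_colon_prime[OF noetherian_ring submodule_U y0(1), of "{\<one>}"]) (simp_all del: fun_module_simps)
  \<comment> \<open>\<open>q = (U : y)\<close> is an associated prime of the cokernel; membership in
    \<open>q\<close> means multiplying \<open>y\<close> into \<open>U\<close>.\<close>
  define y where "y = r \<odot>\<^bsub>F\<^esub> y0"
  define q where "q = colon R F U y"
  have y: "y \<in> carrier F" unfolding y_def by (rule F.smult_closed[OF r(1) y0(1)])
  have q: "primeideal q R" using r(2) unfolding q_def y_def .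
  have qI: "a \<in> q \<longleftrightarrow> a \<odot>\<^bsub>F\<^esub> y \<in> U" if "a \<in> carrier R" for a
    unfolding q_def colon_def using that by blast
  interpret q: primeideal q R by fact
  obtain x where x: "x \<in> carrier R" and xU: "\<And>v. v \<in> carrier F \<Longrightarrow> x \<odot>\<^bsub>F\<^esub> v \<in> U"
    and reg: "\<And>r. r \<in> carrier R \<Longrightarrow> r \<otimes> x = \<zero> \<Longrightarrow> r = \<zero>"
    by (rule ex_regular_conductor) blast+
  have xq: "x \<in> q" using qI[OF x] xU[OF y] by blast
  show False
  proof (cases "\<forall>q'. primeideal q' R \<longrightarrow> x \<in> q' \<longrightarrow> q' \<subseteq> q \<longrightarrow> q' = q")
    case True
    let ?I = "PIdl\<^bsub>R\<^esub> x"
    have I: "ideal ?I R" by (rule R.cgenideal_ideal[OF x])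
    have xI: "x \<in> ?I" by (rule R.cgenideal_self[OF x])
    have Iq: "?I \<subseteq> q" by (rule R.cgenideal_minimal[OF q.is_ideal xq])
    obtain s where s: "s \<in> carrier R" "primeideal (colon R (self_module R) ?I s) R"
      "colon R (self_module R) ?I s \<subseteq> q"
      using ex_associated_prime_of_ring[OF I q Iq] .
    \<comment> \<open>The colon ideal is a prime over \<open>x\<close> inside \<open>q\<close>, so
      the minimality of \<open>q\<close> over \<open>x\<close> identifies the two.\<close>
    have "x \<in> colon R (self_module R) ?I s"
      using x xI s(1) ideal.I_r_closed[OF I xI s(1)] by (simp add: colon_def)
    then have "colon R (self_module R) ?I s = q" using True s by blast
    then have qs: "a \<in> q \<longleftrightarrow> a \<otimes> s \<in> ?I" if "a \<in> carrier R" for a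
      using that unfolding colon_def by auto
    have supp: "\<exists>v \<in> carrier F. t \<odot>\<^bsub>F\<^esub> v \<notin> U" if "t \<in> carrier R - q" for t
      using y qI that by blast
    obtain c where c: "c \<in> B \<rightarrow> carrier R" "\<And>v. v \<in> U \<Longrightarrow> pairing R B c v \<in> ?I" "\<exists>b \<in> B. c b \<notin> ?I"
      by (rule R.ex_separating_functional[OF noetherian_ring finite_B submodule_U q s(1) I qs supp]) blast+
    have Imem: "a \<in> ?I \<longleftrightarrow> (\<exists>r \<in> carrier R. a = x \<otimes> r)" for a
      unfolding cgenideal_def using x R.m_comm by auto
    obtain b where b: "b \<in> B" "c b \<notin> ?I" using c(3) by blast
    have "\<exists>r \<in> carrier R. c b = x \<otimes> r"
      by (rule functional_divisible[OF x reg c(1) _ b(1)]) (use c(2) Imem in blast)+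
    then show False using b(2) Imem by blast
  next
    case False
    then obtain q' where q': "primeideal q' R" "x \<in> q'" "q' \<subset> q" by blast
    interpret q': primeideal q' R by fact
    have "{\<zero>} \<subseteq> q'" using q'.zero_closed by simp
    then obtain s where s: "s \<in> carrier R" "primeideal (annih R s) R" "annih R s \<subseteq> q'"
      using ex_associated_prime_of_ring[OF R.zeroideal q'(1)] unfolding annih_eq_colon by blast
    \<comment> \<open>A nonzerodivisor lies in no proper annihilator of an element, so
      \<open>annih R s\<close>, \<open>q'\<close> and \<open>q\<close> form a strict chain.\<close>
    have "x \<notin> annih R s"
    proof
      assume "x \<in> annih R s"
      then have "s \<otimes> x = \<zero>" using x s(1) by (simp add: annih_def R.m_comm)
      then have "s = \<zero>" by (rule reg[OF s(1)])
      then have "\<one> \<in> annih R s" by (simp add: annih_def)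
      then show False using ideal.one_imp_carrier[OF primeideal.axioms(1)[OF s(2)]] primeideal.I_notcarr[OF s(2)] by simp
    qed
    then have sq': "annih R s \<subset> q'" using s(3) q'(2) by blast
    have "enat 2 \<le> height R q"
    proof (rule height_geI[of 2 "\<lambda>i. if i = 0 then annih R s else if i = 1 then q' else q"])
      fix i :: nat assume "i < 2"
      then have "i = 0 \<or> i = 1" by auto
      then show "(if i = 0 then annih R s else if i = 1 then q' else q)
          \<subset> (if Suc i = 0 then annih R s else if Suc i = 1 then q' else q)"
        using sq' q'(3) by auto
    qed (use s(2) q'(1) q in auto)
    then obtain a b where ab: "locally_regular_pair R M q a b" using depth[OF q] by blast
    note ab' = ab[unfolded locally_regular_pair_def]
    have a: "a \<in> q" and b: "b \<in> q" using ab' by simp_all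
    note reg1 = ab'[THEN conjunct2, THEN conjunct2, THEN conjunct1, rule_format]
    note reg2 = ab'[THEN conjunct2, THEN conjunct2, THEN conjunct2, rule_format]
    have ac: "a \<in> carrier R" and bc: "b \<in> carrier R" using a b q.Icarr by auto
    obtain m1 where m1: "m1 \<in> carrier M" "a \<odot>\<^bsub>F\<^esub> y = evaluation B m1" using a qI[OF ac] by blast
    obtain m2 where m2: "m2 \<in> carrier M" "b \<odot>\<^bsub>F\<^esub> y = evaluation B m2" using b qI[OF bc] by blast
    have inj_on: "inj_on (evaluation B) (carrier M)"
      by (rule inj_on_evaluation) (rule inj)
    \<comment> \<open>Both \<open>b m1\<close> and \<open>a m2\<close> evaluate to
      \<open>a b y\<close>, so injectivity gives the relation in \<open>M\<close> to which the
      second regularity condition applies.\<close>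
    have "evaluation B (b \<odot>\<^bsub>M\<^esub> m1) = b \<odot>\<^bsub>F\<^esub> (a \<odot>\<^bsub>F\<^esub> y)"
      unfolding m1(2) by (rule evaluation_smult[OF bc m1(1)])
    also have "\<dots> = a \<odot>\<^bsub>F\<^esub> (b \<odot>\<^bsub>F\<^esub> y)"
      using ac bc y by (simp add: F.smult_assoc1[symmetric] R.m_comm del: fun_module_simps)
    also have "\<dots> = evaluation B (a \<odot>\<^bsub>M\<^esub> m2)"
      unfolding m2(2) by (rule evaluation_smult[OF ac m2(1), symmetric])
    finally have "b \<odot>\<^bsub>M\<^esub> m1 = a \<odot>\<^bsub>M\<^esub> m2" by (rule inj_onD[OF inj_on]) (use ac bc m1 m2 in auto)
    then obtain u m3 where u: "u \<in> carrier R - q" and m3: "m3 \<in> carrier M" "u \<odot>\<^bsub>M\<^esub> m1 = a \<odot>\<^bsub>M\<^esub> m3"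
      using reg2[OF m1(1) m2(1)] by blast
    have uc: "u \<in> carrier R" using u by simp
    define v where "v = evaluation B m3"
    \<comment> \<open>\<open>a y\<close> is the evaluation of \<open>m1\<close>, and
      \<open>u m1 = a m3\<close>, so \<open>u y\<close> ought to be the evaluation of
      \<open>m3\<close>. The difference \<open>z\<close> satisfies \<open>a z = 0\<close>.\<close>
    define z where "z = u \<odot>\<^bsub>F\<^esub> y \<oplus>\<^bsub>F\<^esub> (\<ominus> \<one>) \<odot>\<^bsub>F\<^esub> v"
    have e3: "v \<in> carrier F" unfolding v_def by (rule evaluation_closed[OF m3(1)])
    have zc: "z \<in> carrier F" unfolding z_def
      by (intro F.M.a_closed F.smult_closed uc y e3 R.a_inv_closed R.one_closed)
    have az: "a \<odot>\<^bsub>F\<^esub> z = \<zero>\<^bsub>F\<^esub>"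
    proof -
      have "a \<odot>\<^bsub>F\<^esub> z = u \<odot>\<^bsub>F\<^esub> (a \<odot>\<^bsub>F\<^esub> y) \<oplus>\<^bsub>F\<^esub> (\<ominus> \<one>) \<odot>\<^bsub>F\<^esub> (a \<odot>\<^bsub>F\<^esub> v)"
        unfolding z_def using ac uc y e3
        by (simp add: F.smult_r_distr F.smult_assoc1[symmetric] R.m_comm del: fun_module_simps)
      also have "u \<odot>\<^bsub>F\<^esub> (a \<odot>\<^bsub>F\<^esub> y) = evaluation B (u \<odot>\<^bsub>M\<^esub> m1)"
        unfolding m1(2) by (rule evaluation_smult[OF uc m1(1), symmetric])
      also have "\<dots> = a \<odot>\<^bsub>F\<^esub> v"
        unfolding m3(2) v_def by (rule evaluation_smult[OF ac m3(1)])
      finally show ?thesis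
        using F.smult_closed[OF ac e3] by (simp add: F.smult_l_minus F.M.r_neg del: fun_module_simps)
    qed
    \<comment> \<open>\<open>a\<close> is regular only on \<open>M_q\<close>, while \<open>z\<close>
      lives in \<open>F\<close>. Multiplying by \<open>x\<close> moves \<open>z\<close> into
      \<open>U\<close>, where \<open>a\<close> can be cancelled up to a factor \<open>u'\<close>;
      afterwards \<open>x\<close> is cancelled coordinatewise.\<close>
    obtain w where w: "w \<in> carrier M" "x \<odot>\<^bsub>F\<^esub> z = evaluation B w" using xU[OF zc] by blast
    have "evaluation B (a \<odot>\<^bsub>M\<^esub> w) = a \<odot>\<^bsub>F\<^esub> (x \<odot>\<^bsub>F\<^esub> z)"
      unfolding w(2) by (rule evaluation_smult[OF ac w(1)])
    also have "\<dots> = x \<odot>\<^bsub>F\<^esub> (a \<odot>\<^bsub>F\<^esub> z)"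
      using ac x zc by (simp add: F.smult_assoc1[symmetric] R.m_comm del: fun_module_simps)
    also have "\<dots> = \<zero>\<^bsub>F\<^esub>" unfolding az by (rule F.smult_r_null[OF x])
    finally have "a \<odot>\<^bsub>M\<^esub> w = \<zero>\<^bsub>M\<^esub>" by (rule inj[rotated]) (use ac w in auto)
    then obtain u' where u': "u' \<in> carrier R - q" "u' \<odot>\<^bsub>M\<^esub> w = \<zero>\<^bsub>M\<^esub>" using reg1[OF w(1)] by blast
    have u'c: "u' \<in> carrier R" using u'(1) by simp
    have "x \<odot>\<^bsub>F\<^esub> (u' \<odot>\<^bsub>F\<^esub> z) = u' \<odot>\<^bsub>F\<^esub> (x \<odot>\<^bsub>F\<^esub> z)"
      using u'c x zc by (simp add: F.smult_assoc1[symmetric] R.m_comm del: fun_module_simps)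
    also have "\<dots> = evaluation B (u' \<odot>\<^bsub>M\<^esub> w)"
      unfolding w(2) by (rule evaluation_smult[OF u'c w(1), symmetric])
    also have "\<dots> = \<zero>\<^bsub>F\<^esub>"
      unfolding u'(2) by (rule linear_map_zero[OF module_axioms F.module_axioms linear_evaluation])
    finally have xz: "x \<odot>\<^bsub>F\<^esub> (u' \<odot>\<^bsub>F\<^esub> z) = \<zero>\<^bsub>F\<^esub>" .
    have u'z: "u' \<odot>\<^bsub>F\<^esub> z \<in> carrier F" by (rule F.smult_closed[OF u'c zc])
    have "u' \<odot>\<^bsub>F\<^esub> z = \<zero>\<^bsub>F\<^esub>"
      unfolding zero_vector_iff[OF u'z]
    proof
      fix b assume b: "b \<in> B"
      have vb: "(u' \<odot>\<^bsub>F\<^esub> z) b \<in> carrier R" using u'z b unfolding fun_module_simps(1) by (rule PiE_mem)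
      have "(x \<odot>\<^bsub>F\<^esub> (u' \<odot>\<^bsub>F\<^esub> z)) b = \<zero>" unfolding xz using b by simp
      then have "x \<otimes> (u' \<odot>\<^bsub>F\<^esub> z) b = \<zero>" unfolding fun_module_simps(4)[where a = x] using b by simp
      then show "(u' \<odot>\<^bsub>F\<^esub> z) b = \<zero>" using reg[OF vb] R.m_comm[OF x vb] by simp
    qed
    moreover have "u' \<odot>\<^bsub>F\<^esub> z = (u' \<otimes> u) \<odot>\<^bsub>F\<^esub> y \<oplus>\<^bsub>F\<^esub> \<ominus>\<^bsub>F\<^esub> (u' \<odot>\<^bsub>F\<^esub> v)"
      unfolding z_def using u'c uc y e3
      by (simp add: F.smult_r_distr F.smult_assoc1 F.smult_l_minus F.smult_r_minus del: fun_module_simps)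
    ultimately have "(u' \<otimes> u) \<odot>\<^bsub>F\<^esub> y = u' \<odot>\<^bsub>F\<^esub> v"
      using F.M.minus_equality[of "(u' \<otimes> u) \<odot>\<^bsub>F\<^esub> y" "\<ominus>\<^bsub>F\<^esub> (u' \<odot>\<^bsub>F\<^esub> v)"] u'c uc y e3
      by (simp del: fun_module_simps)
    also have "\<dots> = evaluation B (u' \<odot>\<^bsub>M\<^esub> m3)"
      unfolding v_def by (rule evaluation_smult[OF u'c m3(1), symmetric])
    finally have "(u' \<otimes> u) \<odot>\<^bsub>F\<^esub> y \<in> U"
      by (rule image_eqI[OF _ smult_closed[OF u'c m3(1)]])
    then have "u' \<otimes> u \<in> q" using qI[of "u' \<otimes> u"] u'c uc by simp
    then show False using q.I_prime[OF u'c uc] u u'(1) by blast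
  qed
qed

end

section \<open>From a basis of the dual to the theorem\<close>

lemma dual_basisI:
  assumes "module R M" "noetherian_ring R" "finitely_generated_module R M"
    and one: "\<one>\<^bsub>R\<^esub> \<noteq> \<zero>\<^bsub>R\<^esub>" and B: "module_basis R (dual_module R M) B"
  shows "dual_basis R M B"
proof -
  interpret M: module R M by fact
  let ?D = "dual_module R M"
  interpret D: module R ?D by (rule M.module_dual_module)
  have fin: "finite B"
    by (rule D.finite_module_basis[OF M.noetherian_dual_module[OF assms(2,3)] B one])
  have Bc: "B \<subseteq> carrier ?D" using B unfolding module_basis_def by blast
  have Bl: "linear_map R M (self_module R) b" if "b \<in> B" for b
    using Bc that carrier_dual_module by blast
  \<comment> \<open>Evaluation at a fixed \<open>m\<close> is a linear map from the dual to
    \<open>R\<close>, so it turns a combination of basis functionals into a pairing.\<close>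
  have ev: "(\<Oplus>\<^bsub>?D\<^esub> b \<in> B. c b \<odot>\<^bsub>?D\<^esub> b) m = pairing R B c (evaluation B m)"
    if c: "c \<in> B \<rightarrow> carrier R" and m: "m \<in> carrier M" for c m
  proof -
    have lin: "linear_map R ?D (self_module R) (\<lambda>f. f m)"
      unfolding linear_map_def using m linear_functionalD(1)
      by (auto simp: carrier_dual_module)
    have "(\<Oplus>\<^bsub>?D\<^esub> b \<in> B. c b \<odot>\<^bsub>?D\<^esub> b) m = (\<Oplus>\<^bsub>self_module R\<^esub> b \<in> B. (c b \<odot>\<^bsub>?D\<^esub> b) m)"
      by (rule linear_map_finsum[OF D.module_axioms M.R.module_self_module lin fin])
        (use c Bc D.smult_closed in blast)
    also have "\<dots> = (\<Oplus>\<^bsub>R\<^esub> b \<in> B. (c b \<odot>\<^bsub>?D\<^esub> b) m)"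
      by (simp add: finsum_def finprod_def self_module_def)
    also have "\<dots> = pairing R B c (evaluation B m)"
      unfolding pairing_def using c m linear_functionalD(1)[OF Bl]
      by (intro M.R.finsum_cong') auto
    finally show ?thesis .
  qed
  have ex1: "\<exists>!c. c \<in> B \<rightarrow>\<^sub>E carrier R \<and> f = (\<Oplus>\<^bsub>?D\<^esub> b \<in> B. c b \<odot>\<^bsub>?D\<^esub> b)" if "f \<in> carrier ?D" for f
    using B that unfolding D.module_basis_finite_iff[OF fin Bc] by blast
  show ?thesis
  proof (intro dual_basis.intro dual_basis_axioms.intro)
    show "noetherian_module R M" by (rule M.noetherian_moduleI[OF assms(2,3)])
    fix g assume g: "linear_map R M (self_module R) g"
    have "restrict g (carrier M) \<in> carrier ?D"
      by (rule M.restrict_in_dual_module) (use linear_functionalD[OF g] in auto)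
    then obtain c where c: "c \<in> B \<rightarrow>\<^sub>E carrier R" "restrict g (carrier M) = (\<Oplus>\<^bsub>?D\<^esub> b \<in> B. c b \<odot>\<^bsub>?D\<^esub> b)"
      using ex1 by blast
    have "g m = pairing R B c (evaluation B m)" if m: "m \<in> carrier M" for m
    proof -
      have "g m = restrict g (carrier M) m" using m by simp
      also have "\<dots> = pairing R B c (evaluation B m)"
        unfolding c(2) by (rule ev) (use c(1) m in auto)
      finally show ?thesis .
    qed
    then show "\<exists>c \<in> B \<rightarrow> carrier R. \<forall>m \<in> carrier M. g m = pairing R B c (evaluation B m)"
      using c(1) by (intro bexI[of _ c]) auto
  next
    fix c b assume c: "c \<in> B \<rightarrow> carrier R" and b: "b \<in> B"
      and zero: "\<And>m. m \<in> carrier M \<Longrightarrow> pairing R B c (evaluation B m) = \<zero>\<^bsub>R\<^esub>"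
    \<comment> \<open>A family with vanishing pairings represents the zero functional. Coefficient
      families of a basis are extensional, hence the restriction to \<open>B\<close>; uniqueness is
      then applied to \<open>c\<close> and the zero family.\<close>
    have rep: "(\<lambda>b \<in> B. d b) \<in> B \<rightarrow>\<^sub>E carrier R \<and>
        \<zero>\<^bsub>?D\<^esub> = (\<Oplus>\<^bsub>?D\<^esub> b \<in> B. (\<lambda>b \<in> B. d b) b \<odot>\<^bsub>?D\<^esub> b)"
      if d: "d \<in> B \<rightarrow> carrier R"
        and dz: "\<And>m. m \<in> carrier M \<Longrightarrow> pairing R B d (evaluation B m) = \<zero>\<^bsub>R\<^esub>" for d
    proof
      show dE: "(\<lambda>b \<in> B. d b) \<in> B \<rightarrow>\<^sub>E carrier R" using d by auto
      let ?s = "\<Oplus>\<^bsub>?D\<^esub> b \<in> B. (\<lambda>b \<in> B. d b) b \<odot>\<^bsub>?D\<^esub> b"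
      have "?s \<in> carrier ?D"
        by (rule D.M.finsum_closed) (use d Bc D.smult_closed in \<open>simp add: Pi_iff subset_eq del: dual_module_simps\<close>)
      then have ext: "?s \<in> extensional (carrier M)" unfolding carrier_dual_module by blast
      show "\<zero>\<^bsub>?D\<^esub> = ?s"
      proof (rule extensionalityI[OF _ ext])
        fix m assume m: "m \<in> carrier M"
        have em: "evaluation B m \<in> B \<rightarrow> carrier R" using linear_functionalD(1)[OF Bl] m by auto
        have "?s m = pairing R B (\<lambda>b \<in> B. d b) (evaluation B m)"
          by (rule ev) (use dE m in auto)
        also have "\<dots> = pairing R B d (evaluation B m)"
          by (rule M.R.pairing_cong) (use d em in auto)
        finally show "\<zero>\<^bsub>?D\<^esub> m = ?s m" using dz[OF m] m by simp
      qed simp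
    qed
    have "(\<lambda>b \<in> B. c b) = (\<lambda>b \<in> B. \<zero>\<^bsub>R\<^esub>)"
    proof -
      have "pairing R B (\<lambda>b. \<zero>\<^bsub>R\<^esub>) (evaluation B m) = \<zero>\<^bsub>R\<^esub>" if "m \<in> carrier M" for m
        unfolding pairing_def using that linear_functionalD(1)[OF Bl]
        by (intro M.R.add.finprod_one_eqI) simp
      then show ?thesis
        using ex1[OF D.M.zero_closed] rep[OF c zero] rep[of "\<lambda>b. \<zero>\<^bsub>R\<^esub>"] by blast
    qed
    then show "c b = \<zero>\<^bsub>R\<^esub>" using b by (metis restrict_apply')
  qed (use assms(1,2) fin Bl in auto)
qed

theorem theorem3p10:
  fixes R :: "('a, 'm) ring_scheme" and M :: "('a, 'b, 'n) module_scheme"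
  assumes "noetherian_ring R" and "local_ring R"
    and "module R M" and "finitely_generated_module R M"
    and "serre_condition 2 R (self_module R)" and "serre_condition 2 R M"
    and "free_module R (dual_module R M)"
  shows "free_module R M"
proof -
  interpret M: module R M by fact
  \<comment> \<open>The zero ring has no proper ideal, so it is not local. The finiteness of the
    dual basis and the distinctness of the final basis elements rest on this.\<close>
  have one: "\<one>\<^bsub>R\<^esub> \<noteq> \<zero>\<^bsub>R\<^esub>"
  proof
    assume "\<one>\<^bsub>R\<^esub> = \<zero>\<^bsub>R\<^esub>"
    then have triv: "carrier R = {\<zero>\<^bsub>R\<^esub>}" by (rule M.R.one_zeroD)
    obtain I where I: "maximalideal I R" using assms(2) unfolding local_ring_def by blast
    interpret I: maximalideal I R by fact
    have "I \<subseteq> {\<zero>\<^bsub>R\<^esub>}" using I.a_subset triv by simp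
    then have "I = {\<zero>\<^bsub>R\<^esub>}" using I.zero_closed by blast
    then show False using triv I.I_notcarr by simp
  qed
  obtain B where B: "module_basis R (dual_module R M) B"
    using assms(7) unfolding free_module_def by blast
  interpret dual_basis R M B by (rule dual_basisI[OF assms(3,1,4) one B])
  have ker: "m = \<zero>\<^bsub>M\<^esub>" if "m \<in> carrier M" "evaluation B m = \<zero>\<^bsub>F\<^esub>" for m
    by (rule inj_evaluation[OF _ that])
      (rule M.serre_condition_associated_prime[OF assms(6)], auto)
  have "carrier F \<subseteq> U"
    by (rule surj_evaluation[OF ker]) (use M.serre_condition_two[OF assms(6)] in blast)+
  moreover have "inj_on (evaluation B) (carrier M)"
    by (rule inj_on_evaluation[OF ker])
  ultimately have "bij_betw (evaluation B) (carrier M) (carrier F)"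
    using evaluation_closed by (auto simp: bij_betw_def simp del: fun_module_simps)
  then show ?thesis by (rule M.free_module_if_bij_betw[OF finite_B one linear_evaluation])
qed

end
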